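(* For each of the following five functions $f(q)$ (with $q$-expansion $f(q)=\sum_{n\ge1}a_nq^n$), the value $L(f,1)$ is as stated: \begin{enumerate} \item[(i)] $f(q)=\tfrac13 a(q^3)c(q^3)b(q^3)$: $\displaystyle L(f,1)=\frac{\Gamma^6(\frac13)}{8\sqrt3\,\pi^3}$. \item[(ii)] $f(q)=\tfrac13 c(q^3)b^2(q^3)$: $\displaystyle L(f,1)=\frac{2\pi}{9\sqrt3}\,{}_3F_2\!\left[\begin{matrix}\frac13,\frac13,\frac23\\ 1,1\end{matrix}\,\middle|\,1\right]$. \item[(iii)] $f(q)=\tfrac19 c^2(q^3)b(q^3)$: $\displaystyle L(f,1)=\frac{2\pi}{27\sqrt3}\,{}_3F_2\!\left[\begin{matrix}\frac13,\frac23,\frac23\\ 1,1\end{matrix}\,\middle|\,1\right]$. \item[(iv)] $f(q)=\tfrac13 c(q^3)b^2(q^9)$: $\displaystyle L(f,1)=\frac{2\pi}{3^{11/6}}\,{}_3F_2\!\left[\begin{matrix}\frac19,\frac49,\frac79\\ 1,1\end{matrix}\,\middle|\,1\right]$. \item[(v)] $f(q)=\tfrac19 c^2(q^3)b(q^9)$: $\displaystyle L(f,1)=\frac{2\pi}{3^{13/6}}\,{}_3F_2\!\left[\begin{matrix}\frac29,\frac59,\frac89\\ 1,1\end{matrix}\,\middle|\,1\right]$. \end{enumerate}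
   Context: Let $\omega$ be a primitive cube root of unity. The Borwein theta series are $a(q)=\sum_{n,m\in\mathbb Z}q^{n^2+nm+m^2}$, $b(q)=\sum_{n,m\in\mathbb Z}\omega^{n-m}q^{n^2+nm+m^2}$, $c(q)=\sum_{n,m\in\mathbb Z}q^{(n+1/3)^2+(n+1/3)(m+1/3)+(m+1/3)^2}$, for $0<q<1$ (each listed $f$ is a modular form of weight $3$ whose $q$-expansion has only positive integral powers of $q$). For a modular form $f(q)=\sum_{n\ge1}a_nq^n$ of weight $k$, its $L$-function is $L(f,s)=\sum_{n\ge1}a_n n^{-s}$ for $\mathrm{Re}(s)>k+1$, extended meromorphically to $\mathbb C$; $L(f,1)$ denotes the value at $s=1$ of this continuation, which equals $\int_0^1 f(q)\,\frac{dq}{q}$. The generalized hypergeometric function is ${}_{3}F_2\!\left[\begin{matrix}a_1,a_2,a_3\\ b_1,b_2\end{matrix}\middle| z\right]=\sum_{n\ge0}\frac{(a_1)_n(a_2)_n(a_3)_n}{(b_1)_n(b_2)_n}\frac{z^n}{n!}$, where $(a)_n=\Gamma(a+n)/\Gamma(a)$; $\Gamma$ is the gamma function. *)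

theory Defs
  imports "HOL-Complex_Analysis.Complex_Analysis"
begin

text \<open>
  The Borwein theta series, for real \<open>0 < q < 1\<close>, where all three double series converge
  absolutely.  The parameter \<open>\<omega>\<close> of the second one is a primitive cube root of unity.
\<close>

definition borwein_a :: "real \<Rightarrow> complex" where
  "borwein_a q = (\<Sum>\<^sub>\<infinity>(n, m) \<in> (UNIV :: (int \<times> int) set).
     of_real (q powi (n ^ 2 + n * m + m ^ 2)))"

definition borwein_b :: "complex \<Rightarrow> real \<Rightarrow> complex" where
  "borwein_b \<omega> q = (\<Sum>\<^sub>\<infinity>(n, m) \<in> (UNIV :: (int \<times> int) set).
     \<omega> powi (n - m) * of_real (q powi (n ^ 2 + n * m + m ^ 2)))"

definition borwein_c :: "real \<Rightarrow> complex" where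
  "borwein_c q = (\<Sum>\<^sub>\<infinity>(n, m) \<in> (UNIV :: (int \<times> int) set).
     of_real (q powr ((of_int n + 1/3) ^ 2 + (of_int n + 1/3) * (of_int m + 1/3)
       + (of_int m + 1/3) ^ 2)))"

definition hypergeometric_3F2 ::
    "real \<Rightarrow> real \<Rightarrow> real \<Rightarrow> real \<Rightarrow> real \<Rightarrow> real \<Rightarrow> real" where
  "hypergeometric_3F2 a1 a2 a3 b1 b2 z =
     (\<Sum>n. (pochhammer a1 n * pochhammer a2 n * pochhammer a3 n)
            / (pochhammer b1 n * pochhammer b2 n) * (z ^ n / fact n))"

lemma hypergeometric_3F2_eq_eval_fps:
  "hypergeometric_3F2 a1 a2 a3 b1 b2 z = eval_fps (fps_hypergeo [a1, a2, a3] [b1, b2] 1) z"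
  by (simp add: hypergeometric_3F2_def eval_fps_def)

text \<open>
  The value \<open>a 0\<close> plays no role: the expansion has no constant term.
\<close>

definition has_q_expansion :: "(real \<Rightarrow> complex) \<Rightarrow> (nat \<Rightarrow> complex) \<Rightarrow> bool" where
  "has_q_expansion f a \<longleftrightarrow>
     (\<forall>q. 0 < q \<and> q < 1 \<longrightarrow> (\<lambda>n. a (Suc n) * of_real (q ^ Suc n)) sums f q)"

text \<open>
  \<open>is_L_function k f L\<close>: \<open>L\<close> is the meromorphic continuation to the whole plane of the
  Dirichlet series attached to the \<open>q\<close>-expansion of \<open>f\<close>, which converges for
  \<open>Re s > k + 1\<close>.  Plain \<open>(meromorphic_on)\<close> would leave the values of \<open>L\<close> on a discrete set
  arbitrary; \<open>(nicely_meromorphic_on)\<close> excludes removable singularities, and its convention of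
  value 0 at poles makes \<open>L\<close> unique as a total function.
\<close>

definition is_L_function :: "nat \<Rightarrow> (real \<Rightarrow> complex) \<Rightarrow> (complex \<Rightarrow> complex) \<Rightarrow> bool" where
  "is_L_function k f L \<longleftrightarrow>
     (\<exists>a. has_q_expansion f a \<and>
          (\<forall>s. Re s > real k + 1 \<longrightarrow>
               (\<lambda>n. a (Suc n) * of_nat (Suc n) powr (- s)) sums L s)) \<and>
     L nicely_meromorphic_on UNIV"

text \<open>
  \<open>L(f, s) = v\<close> for \<open>f\<close> of weight \<open>k\<close>, including that the continuation exists and that
  \<open>s\<close> is not a pole of it.
\<close>

definition has_L_value :: "nat \<Rightarrow> (real \<Rightarrow> complex) \<Rightarrow> complex \<Rightarrow> complex \<Rightarrow> bool" where
  "has_L_value k f s v \<longleftrightarrow> (\<exists>L. is_L_function k f L \<and> L analytic_on {s} \<and> L s = v)"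

lemma has_q_expansion_unique:
  assumes "has_q_expansion f a" "has_q_expansion f b"
  shows   "a (Suc n) = b (Suc n)"
proof (rule ccontr)
  assume neq: "a (Suc n) \<noteq> b (Suc n)"
  define d where "d i = (if i = 0 then 0 else a i - b i)" for i
  have sums0: "(\<lambda>i. d i * of_real q ^ i) sums 0" if q: "0 < q" "q < 1" for q :: real
  proof -
    have "(\<lambda>i. a (Suc i) * of_real (q ^ Suc i) - b (Suc i) * of_real (q ^ Suc i))
            sums (f q - f q)"
      using assms q unfolding has_q_expansion_def by (intro sums_diff) auto
    hence "(\<lambda>i. d (Suc i) * of_real q ^ Suc i) sums 0"
      by (simp add: d_def algebra_simps)
    thus ?thesis
      by (subst (asm) sums_Suc_iff) (simp add: d_def)
  qed
  have smm: "summable (\<lambda>i. d i * (x - 0) ^ i)" if "norm (x - 0) < 1" for x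
  proof -
    obtain q where q: "norm x < q" "q < 1"
      using \<open>norm (x - 0) < 1\<close> dense by auto
    hence q0: "0 < q" using norm_ge_zero[of x] by linarith
    have "summable (\<lambda>i. d i * x ^ i)"
      by (rule powser_inside[of _ "of_real q"])
         (use sums0[OF q0 q(2)] q q0 in \<open>auto simp: sums_iff\<close>)
    thus ?thesis by simp
  qed
  obtain s where s: "0 < s" "\<And>z. z \<in> cball 0 s - {0} \<Longrightarrow> (\<Sum>i. d i * (z - 0) ^ i) \<noteq> 0"
  proof (rule powser_0_nonzero[of 1 0 d "\<lambda>z. \<Sum>i. d i * (z - 0) ^ i" "Suc n"])
    show "(\<Sum>i. d i * (0 - 0) ^ i) = 0"
      using powser_zero[of d] by (simp add: d_def)
    show "d (Suc n) \<noteq> 0"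
      using neq by (simp add: d_def)
    show "(\<lambda>i. d i * (x - 0) ^ i) sums (\<Sum>i. d i * (x - 0) ^ i)" if "norm (x - 0) < 1" for x
      using smm[OF that] by (rule summable_sums)
  qed auto
  define q where "q = min s (1/2)"
  have q: "0 < q" "q < 1" "q \<le> s" using s(1) by (auto simp: q_def)
  have "(\<Sum>i. d i * (of_real q - 0) ^ i) \<noteq> 0"
    by (rule s(2)) (use q in auto)
  thus False
    using sums0[OF q(1,2)] by (simp add: sums_iff)
qed

lemma is_L_function_unique:
  assumes "is_L_function k f L" "is_L_function k f M"
  shows   "L = M"
proof
  fix z
  obtain a where a: "has_q_expansion f a"
    "\<And>s. Re s > real k + 1 \<Longrightarrow> (\<lambda>n. a (Suc n) * of_nat (Suc n) powr (- s)) sums L s"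
    using assms(1) unfolding is_L_function_def by blast
  obtain b where b: "has_q_expansion f b"
    "\<And>s. Re s > real k + 1 \<Longrightarrow> (\<lambda>n. b (Suc n) * of_nat (Suc n) powr (- s)) sums M s"
    using assms(2) unfolding is_L_function_def by blast
  have eq: "L s = M s" if "Re s > real k + 1" for s
    using a(2)[OF that] b(2)[OF that] has_q_expansion_unique[OF a(1) b(1)]
    by (simp add: sums_iff)
  have nice: "L nicely_meromorphic_on UNIV" "M nicely_meromorphic_on UNIV"
    using assms unfolding is_L_function_def by blast+
  hence mero: "(\<lambda>s. L s - M s) meromorphic_on UNIV"
    by (intro meromorphic_intros) (auto simp: nicely_meromorphic_on_def)
  define s0 :: complex where "s0 = of_nat (k + 2)"
  have "open {s. Re s > real k + 1}" by (rule open_halfspace_Re_gt)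
  hence "eventually (\<lambda>s. s \<in> {s. Re s > real k + 1}) (at s0)"
    by (intro eventually_at_in_open') (auto simp: s0_def)
  hence freq: "frequently (\<lambda>s. L s - M s = 0) (at s0)"
    by (intro eventually_frequently) (auto elim!: eventually_mono simp: eq)
  have "eventually (\<lambda>s. L s - M s = 0) (cosparse UNIV) \<or>
        eventually (\<lambda>s. L s - M s \<noteq> 0) (cosparse UNIV)"
    by (rule meromorphic_imp_constant_or_avoid[OF mero]) auto
  hence "eventually (\<lambda>s. L s - M s = 0) (cosparse UNIV)"
    using freq by (auto simp: eventually_cosparse_open_eq frequently_def)
  hence ev: "eventually (\<lambda>s. L s = M s) (at z)"
    by (auto simp: eventually_cosparse_open_eq)
  hence pole: "is_pole L z \<longleftrightarrow> is_pole M z"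
    by (intro is_pole_cong refl)
  show "L z = M z"
  proof (cases "is_pole L z")
    case True
    have "\<not> (h \<midarrow>z\<rightarrow> h z)" if "is_pole h z" for h :: "complex \<Rightarrow> complex"
      using that not_tendsto_and_filterlim_at_infinity[of "at z" h "h z"]
      by (auto simp: is_pole_def)
    thus ?thesis using True pole nice unfolding nicely_meromorphic_on_def by (metis UNIV_I)
  next
    case False
    hence "L \<midarrow>z\<rightarrow> L z" "M \<midarrow>z\<rightarrow> M z"
      using nice pole unfolding nicely_meromorphic_on_def by blast+
    moreover from this(2) have "L \<midarrow>z\<rightarrow> M z"
      using tendsto_cong[OF ev] by blast
    ultimately show ?thesis by (intro tendsto_unique[of "at z" L]) auto
  qed
qed

lemma has_L_value_unique:
  "has_L_value k f s v \<Longrightarrow> has_L_value k f s w \<Longrightarrow> v = w"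
  unfolding has_L_value_def using is_L_function_unique by blast

end

theory Submission
  imports Defs
begin

text \<open>
  Write \<open>X(q) = a(q\<^sup>3)\<close>, \<open>Y(q) = c(q\<^sup>3)\<close> and \<open>Z(q) = b(q\<^sup>3)\<close>. Splitting the Eisenstein lattice by
  residues modulo the prime above 3, and a unitary map of three copies of it, give
  \<open>X(q) = (X + 2 Y)(q\<^sup>3)\<close>, \<open>Z(q) = (X - Y)(q\<^sup>3)\<close> and \<open>Y(q)\<^sup>3 = 9 Y (X\<^sup>2 + X Y + Y\<^sup>2)(q\<^sup>3)\<close>, hence
  \<open>X\<^sup>3 = Y\<^sup>3 + Z\<^sup>3\<close>. Thus \<open>U = Y / X\<close> transforms under \<open>q \<mapsto> q\<^sup>3\<close> by Ramanujan's cubic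
  transformation, and comparing with \<open>F = \<^sub>2F\<^sub>1(1/3, 2/3; 1; _)\<close> along the iterates \<open>q, q\<^sup>3, q\<^sup>9, \<dots> \<rightarrow> 0\<close>
  yields \<open>X = F(U\<^sup>3)\<close> and \<open>q U' = U (1 - U\<^sup>3) X\<^sup>2\<close>. The differential equation forces \<open>Z(exp (- t))\<close> to
  vanish rapidly as \<open>t \<rightarrow> 0\<close>, so every \<open>f\<close> has an entire Mellin transform and
  \<open>L(f, 1) = \<integral> f(exp (- t)) dt\<close>. In the variable \<open>U\<close> (or \<open>U\<^sup>3\<close>) this is an integral of \<open>F\<close> against a
  beta kernel, evaluated termwise.
\<close>

text \<open>The forms are taken at \<open>q ^ 3\<close> because c then has integral exponents as
  well, and all three series become sums over residue classes of one lattice.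

  The point s = 1 lies outside the half-plane Re s > 4 where L is given by its Dirichlet series, so
  a continuation has to be built. Every listed f contains a factor b, and this factor alone supplies
  the decay at q = 1. Instead of modular inversion, lattice points are counted to show that X is at
  least of order 1/t, and the differential equation turns this into exponential decay of 1 - U^3.

  The Jacobian of t -> U absorbs X^2, so weight 3 leaves exactly one factor F. For (iv) and (v) one
  has b(q^9) = Z(q^3), and the right variable is u = U(q^3): Y(q) is X(q^3) times the cube root of 9
  u (1 + u + u^2), and Z(q^3) is X(q^3) times the cube root of (1 - u)(1 + u + u^2). The three cube
  roots of 1 + u + u^2 combine to the factor that cancels against the Jacobian. What remains is a
  beta kernel in u itself against F(u^3); the index 3n in its moments is the origin of the
  ninths.\<close>

section \<open>Theta series of the Eisenstein lattice\<close>

text \<open>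
  The pair \<open>(n, m)\<close> stands for the Eisenstein integer \<open>n - \<omega> m\<close>, and its class for the residue
  modulo the prime above 3.
\<close>
definition eis_norm :: "int \<times> int \<Rightarrow> nat" where
  "eis_norm p = nat (fst p ^ 2 + fst p * snd p + snd p ^ 2)"

definition eis_class :: "int \<Rightarrow> (int \<times> int) set" where
  "eis_class j = {p. (fst p - snd p) mod 3 = j}"

definition eis_theta :: "(int \<times> int) set \<Rightarrow> real \<Rightarrow> real" where
  "eis_theta S q = (\<Sum>\<^sub>\<infinity>p\<in>S. q ^ eis_norm p)"

section \<open>Convergence of lattice sums, with a bound of order \<open>1 / (1 - q)\<close>\<close>

lemma eis_form_bound: "(n::int) ^ 2 + m ^ 2 \<le> 2 * (n ^ 2 + n * m + m ^ 2)"
proof -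
  have "0 \<le> (n + m) ^ 2" by simp
  thus ?thesis by (simp add: power2_eq_square algebra_simps)
qed

lemma eis_form_nonneg: "0 \<le> (n::int) ^ 2 + n * m + m ^ 2"
  using eis_form_bound[of n m] by (smt (verit) zero_le_power2)

lemma int_eis_norm: "int (eis_norm p) = fst p ^ 2 + fst p * snd p + snd p ^ 2"
  unfolding eis_norm_def using eis_form_nonneg by simp

lemma eis_norm_bound: "nat (fst p ^ 2) + nat (snd p ^ 2) \<le> 2 * eis_norm p"
proof -
  have "int (nat (fst p ^ 2) + nat (snd p ^ 2)) \<le> int (2 * eis_norm p)"
    using eis_form_bound[of "fst p" "snd p"] by (simp add: int_eis_norm)
  thus ?thesis by linarith
qed

lemma eis_norm_eq_0_iff: "eis_norm p = 0 \<longleftrightarrow> p = (0, 0)"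
  using eis_norm_bound[of p] by (cases p) (auto simp: eis_norm_def)

text \<open>Bernoulli's inequality for \<open>(1 / r) ^ (n ^ 2)\<close>. The right-hand side is the
  derivative of arctan at \<open>sqrt (1 - r) * n\<close>, prepared for the telescoping in
  \<open>gauss_sum_le\<close>.\<close>

lemma power_square_le:
  fixes r :: real
  assumes "0 < r" "r < 1"
  shows   "r ^ (n ^ 2) \<le> 1 / (1 + (sqrt (1 - r) * real n) ^ 2)"
proof -
  have r1: "1 - r \<le> 1 / r - 1"
  proof -
    have "0 \<le> (1 - r) ^ 2" by simp
    thus ?thesis using assms by (simp add: field_simps power2_eq_square)
  qed
  have "1 + real (n ^ 2) * (1 - r) \<le> 1 + real (n ^ 2) * (1 / r - 1)"
    using r1 by (intro add_left_mono mult_left_mono) auto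
  also have "\<dots> \<le> (1 + (1 / r - 1)) ^ (n ^ 2)"
    by (rule Bernoulli_inequality) (use assms in auto)
  also have "\<dots> = 1 / r ^ (n ^ 2)" by (simp add: power_one_over)
  finally have *: "1 + real (n ^ 2) * (1 - r) \<le> 1 / r ^ (n ^ 2)" .
  have pos: "0 < 1 + real (n ^ 2) * (1 - r)" using assms by (intro add_pos_nonneg) auto
  have "r ^ (n ^ 2) * (1 + real (n ^ 2) * (1 - r)) \<le> r ^ (n ^ 2) * (1 / r ^ (n ^ 2))"
    using * assms by (intro mult_left_mono) auto
  hence "r ^ (n ^ 2) * (1 + real (n ^ 2) * (1 - r)) \<le> 1" using assms by simp
  hence "r ^ (n ^ 2) \<le> 1 / (1 + real (n ^ 2) * (1 - r))"
    using pos by (simp add: pos_le_divide_eq)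
  thus ?thesis using assms by (simp add: power_mult_distrib mult.commute)
qed

lemma arctan_step:
  fixes s :: real
  assumes "0 < s"
  shows "s / (1 + (s * real (Suc n)) ^ 2) \<le> arctan (s * real (Suc n)) - arctan (s * real n)"
proof -
  have "s * real n < s * real (Suc n)" using assms by simp
  from MVT2[OF this DERIV_arctan]
  obtain z where z: "s * real n < z" "z < s * real (Suc n)"
    "arctan (s * real (Suc n)) - arctan (s * real n) =
       (s * real (Suc n) - s * real n) * inverse (1 + z ^ 2)" by blast
  have "z > 0" using z(1) assms by (smt (verit) mult_nonneg_nonneg of_nat_0_le_iff)
  hence "z ^ 2 \<le> (s * real (Suc n)) ^ 2" using z by (intro power_mono) auto
  hence "s * inverse (1 + (s * real (Suc n)) ^ 2) \<le> s * inverse (1 + z ^ 2)"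
    using assms by (intro mult_left_mono le_imp_inverse_le) (auto intro: add_pos_nonneg)
  thus ?thesis unfolding z(3) by (simp add: algebra_simps divide_inverse)
qed

text \<open>Multiplied by \<open>s = sqrt (1 - r)\<close>, the terms with n > 0 are dominated by
  increments of arctan along the multiples of s, with total below pi / 2. The bound is uniform in N,
  and its square has the order 1 that every theta series contributes to the growth at q = 1.\<close>

lemma gauss_sum_le:
  fixes r :: real
  assumes "0 < r" "r < 1"
  shows   "(\<Sum>n\<in>{-int N..int N}. r ^ nat (n ^ 2)) \<le> (1 + pi) / sqrt (1 - r)"
proof -
  define s where "s = sqrt (1 - r)"
  have s: "0 < s" "s \<le> 1" using assms by (auto simp: s_def)
  have "s * (\<Sum>k<N. r ^ (Suc k ^ 2)) \<le> (\<Sum>k<N. arctan (s * real (Suc k)) - arctan (s * real k))"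
    unfolding sum_distrib_left
  proof (rule sum_mono)
    fix k
    have "s * r ^ (Suc k ^ 2) \<le> s * (1 / (1 + (s * real (Suc k)) ^ 2))"
      using power_square_le[OF assms, of "Suc k"] s unfolding s_def by (intro mult_left_mono) auto
    also have "\<dots> \<le> arctan (s * real (Suc k)) - arctan (s * real k)"
      using arctan_step[OF s(1), of k] by simp
    finally show "s * r ^ (Suc k ^ 2) \<le> \<dots>" .
  qed
  also have "\<dots> = arctan (s * real N)"
    by (subst sum_lessThan_telescope) simp
  also have "\<dots> \<le> pi / 2" using arctan_ubound[of "s * real N"] by simp
  finally have *: "2 * s * (\<Sum>k<N. r ^ (Suc k ^ 2)) \<le> pi" by simp
  have "(\<Sum>n\<in>{-int N..int N}. r ^ nat (n ^ 2)) = 1 + 2 * (\<Sum>k<N. r ^ (Suc k ^ 2))"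
  proof (induction N)
    case (Suc N)
    have "{-int (Suc N)..int (Suc N)} =
            insert (-int (Suc N)) (insert (int (Suc N)) {-int N..int N})" by auto
    moreover have "nat ((int (Suc N)) ^ 2) = Suc N ^ 2"
      by (simp only: of_nat_power [symmetric] nat_int)
    moreover have "nat ((- int (Suc N)) ^ 2) = Suc N ^ 2"
      by (simp only: power2_minus of_nat_power [symmetric] nat_int)
    ultimately show ?case using Suc by simp
  qed simp
  also have "s * \<dots> \<le> 1 + pi" using * s by (simp add: algebra_simps)
  hence "1 + 2 * (\<Sum>k<N. r ^ (Suc k ^ 2)) \<le> (1 + pi) / s" using s by (simp add: field_simps)
  finally show ?thesis unfolding s_def .
qed

text \<open>The form is at least half the sum of squares, so passing to \<open>r = sqrt q\<close>
  bounds the sum by the square of a one-dimensional theta sum.\<close>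

lemma eis_partial_sum_le:
  fixes q :: real
  assumes q: "0 < q" "q < 1" and F: "finite F"
  shows "(\<Sum>p\<in>F. q ^ eis_norm p) \<le> 2 * (1 + pi) ^ 2 / (1 - q)"
proof -
  define r where "r = sqrt q"
  have r: "0 < r" "r < 1" and rq: "r ^ 2 = q" using q by (auto simp: r_def)
  obtain N :: nat where N: "F \<subseteq> {-int N..int N} \<times> {-int N..int N}"
  proof
    define K where "K = (\<Sum>p\<in>F. nat \<bar>fst p\<bar> + nat \<bar>snd p\<bar>)"
    show "F \<subseteq> {-int K..int K} \<times> {-int K..int K}"
    proof
      fix p assume "p \<in> F"
      hence "nat \<bar>fst p\<bar> + nat \<bar>snd p\<bar> \<le> K" unfolding K_def
        by (intro member_le_sum F) auto
      thus "p \<in> {-int K..int K} \<times> {-int K..int K}" by (cases p) auto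
    qed
  qed
  have "(\<Sum>p\<in>F. q ^ eis_norm p) \<le> (\<Sum>p\<in>F. r ^ nat (fst p ^ 2) * r ^ nat (snd p ^ 2))"
  proof (rule sum_mono)
    fix p
    have "q ^ eis_norm p = r ^ (2 * eis_norm p)" by (simp add: rq [symmetric] power_mult)
    also have "\<dots> \<le> r ^ (nat (fst p ^ 2) + nat (snd p ^ 2))"
      using r eis_norm_bound by (intro power_decreasing) auto
    finally show "q ^ eis_norm p \<le> r ^ nat (fst p ^ 2) * r ^ nat (snd p ^ 2)"
      by (simp add: power_add)
  qed
  also have "\<dots> \<le> (\<Sum>p\<in>{-int N..int N} \<times> {-int N..int N}. r ^ nat (fst p ^ 2) * r ^ nat (snd p ^ 2))"
    using N r by (intro sum_mono2) auto
  also have "\<dots> = (\<Sum>n\<in>{-int N..int N}. r ^ nat (n ^ 2)) ^ 2"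
    by (simp add: power2_eq_square sum_product sum.cartesian_product case_prod_beta)
  also have "\<dots> \<le> ((1 + pi) / sqrt (1 - r)) ^ 2"
    using r by (intro power_mono gauss_sum_le sum_nonneg) auto
  also have "\<dots> = (1 + pi) ^ 2 / (1 - r)" using r by (simp add: power_divide)
  also have "\<dots> \<le> 2 * (1 + pi) ^ 2 / (1 - q)"
  proof -
    have "1 - q = (1 - r) * (1 + r)" by (simp add: rq [symmetric] power2_eq_square algebra_simps)
    also have "\<dots> \<le> (1 - r) * 2" using r by (intro mult_left_mono) auto
    finally have *: "1 - q \<le> 2 * (1 - r)" by simp
    have "(1 + pi) ^ 2 * (1 - q) \<le> (1 + pi) ^ 2 * (2 * (1 - r))"
      using * by (intro mult_left_mono) auto
    thus ?thesis using q r by (simp add: field_simps)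
  qed
  finally show ?thesis .
qed

lemma eis_summable:
  fixes q :: real
  assumes "0 \<le> q" "q < 1"
  shows "(\<lambda>p. q ^ eis_norm p) summable_on S"
proof (cases "q = 0")
  case True
  have "(\<lambda>p. q ^ eis_norm p) summable_on UNIV"
    by (rule finite_nonzero_values_imp_summable_on)
       (auto simp: True power_0_left eis_norm_eq_0_iff)
  thus ?thesis by (rule summable_on_subset_banach) auto
next
  case False
  show ?thesis
    by (rule nonneg_bdd_above_summable_on)
       (use assms False eis_partial_sum_le[of q] in \<open>auto simp: bdd_above_def\<close>)
qed

lemma eis_theta_has_sum:
  fixes q :: real
  assumes "0 \<le> q" "q < 1"
  shows "((\<lambda>p. q ^ eis_norm p) has_sum eis_theta S q) S"
  unfolding eis_theta_def using eis_summable[OF assms] by simp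

lemma eis_theta_le:
  fixes q :: real
  assumes "0 < q" "q < 1"
  shows "eis_theta S q \<le> 2 * (1 + pi) ^ 2 / (1 - q)"
  unfolding eis_theta_def
  by (rule infsum_le_finite_sums) (use assms eis_summable eis_partial_sum_le in auto)

section \<open>Residue classes modulo the prime above 3\<close>

lemma eis_theta_reindex:
  assumes "bij_betw h S T" "\<And>p. p \<in> S \<Longrightarrow> eis_norm (h p) = k * eis_norm p"
  shows   "eis_theta T q = eis_theta S (q ^ k)"
proof -
  have "eis_theta T q = (\<Sum>\<^sub>\<infinity>p\<in>S. q ^ eis_norm (h p))"
    unfolding eis_theta_def by (rule infsum_reindex_bij_betw [OF assms(1), symmetric])
  also have "\<dots> = eis_theta S (q ^ k)" unfolding eis_theta_def
    by (rule infsum_cong) (simp add: assms(2) power_mult)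
  finally show ?thesis .
qed

text \<open>Exchanging the coordinates preserves the form and negates the class.\<close>

lemma eis_theta_class_2: "eis_theta (eis_class 2) q = eis_theta (eis_class 1) q"
proof -
  have "bij_betw prod.swap (eis_class 1) (eis_class 2)"
    by (rule bij_betwI[of _ _ _ prod.swap]) (auto simp: eis_class_def; presburger)+
  from eis_theta_reindex[OF this, of 1 q] show ?thesis
    by (simp add: eis_norm_def algebra_simps)
qed

lemma eis_class_partition: "UNIV = eis_class 0 \<union> (eis_class 1 \<union> eis_class 2)"
  unfolding eis_class_def by auto

lemma eis_theta_UNIV:
  assumes "0 \<le> q" "q < 1"
  shows "eis_theta UNIV q = eis_theta (eis_class 0) q + 2 * eis_theta (eis_class 1) q"
proof -
  have "eis_theta UNIV q = eis_theta (eis_class 0) q + (eis_theta (eis_class 1) q + eis_theta (eis_class 2) q)"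
    unfolding eis_theta_def using eis_summable[OF assms]
    by (subst eis_class_partition, subst infsum_Un_disjoint, simp, simp, force simp: eis_class_def,
        subst infsum_Un_disjoint) (auto simp: eis_class_def)
  thus ?thesis by (simp add: eis_theta_class_2)
qed

text \<open>Classes at argument q rather than shifted lattices at \<open>q ^ 3\<close>: both
  functions are then power series in q with counting coefficients. The agreement with a and c is
  \<open>borwein_a_cube\<close> and \<open>borwein_c_cube\<close>.\<close>

definition thX :: "real \<Rightarrow> real" where "thX = eis_theta (eis_class 0)"
definition thY :: "real \<Rightarrow> real" where "thY = eis_theta (eis_class 1)"

text \<open>The map is multiplication by \<lambda> = 2 + \<omega>, an element of norm 3 whose
  multiples are exactly the class 0.\<close>

lemma bij_mult_lambda: "bij_betw (\<lambda>p. (2 * fst p + snd p, snd p - fst p)) UNIV (eis_class 0)"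
  by (rule bij_betwI[of _ _ _ "\<lambda>p. ((fst p - snd p) div 3, (fst p - snd p) div 3 + snd p)"])
     (auto simp: eis_class_def; presburger)+

lemma thX_eq_UNIV: "thX q = eis_theta UNIV (q ^ 3)"
proof -
  have "eis_norm (2 * fst p + snd p, snd p - fst p) = 3 * eis_norm p" for p
  proof -
    have "int (eis_norm (2 * fst p + snd p, snd p - fst p)) = int (3 * eis_norm p)"
      by (simp add: int_eis_norm power2_eq_square algebra_simps)
    thus ?thesis by linarith
  qed
  thus ?thesis unfolding thX_def by (intro eis_theta_reindex[OF bij_mult_lambda])
qed

lemma thX_cube:
  assumes "0 \<le> q" "q < 1"
  shows "thX q = thX (q ^ 3) + 2 * thY (q ^ 3)"
  using thX_eq_UNIV eis_theta_UNIV[of "q ^ 3"] assms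
  by (simp add: thX_def thY_def power_less_one_iff)

section \<open>The cube of \<open>thY\<close>\<close>

lemma has_sum_triple_product:
  fixes f g h :: "'a \<Rightarrow> real"
  assumes "(f has_sum a) A" "(g has_sum b) B" "(h has_sum c) C"
  assumes "\<And>x. 0 \<le> f x" "\<And>x. 0 \<le> g x" "\<And>x. 0 \<le> h x"
  shows "((\<lambda>(x, y, z). f x * g y * h z) has_sum (a * b * c)) (A \<times> B \<times> C)"
proof -
  have two: "((\<lambda>(x, y). u x * v y) has_sum (s * t)) (P \<times> Q)"
    if "(u has_sum s) P" "(v has_sum t) Q" "\<And>x. 0 \<le> u x" "\<And>x. 0 \<le> v x"
    for u :: "'a \<Rightarrow> real" and v :: "'c \<Rightarrow> real" and s t P Q
  proof -
    have 1: "((\<lambda>y. case (x, y) of (x, y) \<Rightarrow> u x * v y) has_sum (u x * t)) Q" for x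
      using has_sum_cmult_right[OF that(2), of "u x"] by simp
    have 2: "((\<lambda>x. u x * t) has_sum (s * t)) P"
      using has_sum_cmult_left[OF that(1), of t] by simp
    show ?thesis
    proof (rule has_sum_SigmaI[OF 1 2])
      show "(\<lambda>(x, y). u x * v y) summable_on P \<times> Q"
        by (rule summable_on_SigmaI[OF 1]) (use has_sum_imp_summable[OF 2] that in auto)
    qed
  qed
  have "((\<lambda>(x, p). f x * (case p of (y, z) \<Rightarrow> g y * h z)) has_sum (a * (b * c))) (A \<times> B \<times> C)"
    using assms by (intro two) auto
  thus ?thesis by (simp add: case_prod_unfold mult.assoc)
qed

text \<open>The map p -> 1 + \<lambda> p with \<lambda> = 2 + \<omega>. As \<lambda> (1 - \<omega>)
  = 3, its value is \<lambda> times p shifted by 1/3 in both coordinates, which is the shift in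
  \<open>borwein_c\<close>.\<close>

definition eis_shift :: "int \<times> int \<Rightarrow> int \<times> int" where
  "eis_shift p = (2 * fst p + snd p + 1, snd p - fst p)"

lemma bij_eis_shift: "bij_betw eis_shift UNIV (eis_class 1)"
  by (rule bij_betwI[of _ _ _ "\<lambda>p. ((fst p - snd p) div 3, (fst p - snd p) div 3 + snd p)"])
     (auto simp: eis_class_def eis_shift_def; presburger)+

definition triple_class :: "int \<Rightarrow> ((int \<times> int) \<times> (int \<times> int) \<times> (int \<times> int)) set" where
  "triple_class j = {(x, y, z). (fst x - snd x + fst y - snd y + fst z - snd z) mod 3 = j}"

lemma mod3_in: "(d :: int) mod 3 \<in> {0, 1, 2}"
proof -
  have "0 \<le> d mod 3" "d mod 3 < 3" by simp_all
  thus ?thesis unfolding insert_iff by linarith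
qed

lemma triple_class_eq_Union:
  "triple_class 2 = (\<Union>ij\<in>{0,1,2} \<times> {0,1,2}.
     eis_class (fst ij) \<times> eis_class (snd ij) \<times> eis_class ((2 - fst ij - snd ij) mod 3))"
  (is "_ = (\<Union>ij\<in>?I. ?S ij)")
proof (intro equalityI subsetI)
  fix t assume "t \<in> triple_class 2"
  then obtain x y z where t: "t = (x, y, z)"
    and cl: "(fst x - snd x + fst y - snd y + fst z - snd z) mod 3 = 2"
    by (auto simp: triple_class_def)
  define i j where "i = (fst x - snd x) mod 3" and "j = (fst y - snd y) mod 3"
  have "(fst x - snd x + fst y - snd y + fst z - snd z) mod 3 = 2 mod 3" using cl by simp
  hence "3 dvd (fst x - snd x + fst y - snd y + fst z - snd z) - 2"
    by (simp only: mod_eq_dvd_iff)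
  hence "(fst z - snd z) mod 3 = (2 - (fst x - snd x) - (fst y - snd y)) mod 3"
    by (simp add: mod_eq_dvd_iff algebra_simps)
  also have "\<dots> = (2 - i - j) mod 3" unfolding i_def j_def by (intro mod_diff_cong) simp_all
  finally have "t \<in> ?S (i, j)" by (simp add: t eis_class_def i_def j_def)
  moreover have "(i, j) \<in> ?I" unfolding i_def j_def by (intro SigmaI mod3_in)
  ultimately show "t \<in> (\<Union>ij\<in>?I. ?S ij)" by blast
next
  fix t assume "t \<in> (\<Union>ij\<in>?I. ?S ij)"
  then obtain ij where ij: "t \<in> ?S ij" by blast
  obtain x y z where t: "t = (x, y, z)" by (metis surj_pair)
  define i j where "i = fst ij" and "j = snd ij"
  have cl: "(fst x - snd x) mod 3 = i" "(fst y - snd y) mod 3 = j"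
      "(fst z - snd z) mod 3 = (2 - i - j) mod 3"
    using ij by (simp_all add: t eis_class_def i_def j_def)
  have "((fst x - snd x) + (fst y - snd y) + (fst z - snd z)) mod 3 =
        ((fst x - snd x) mod 3 + (fst y - snd y) mod 3 + (fst z - snd z) mod 3) mod 3"
    by (intro mod_add_cong) simp_all
  also have "\<dots> = (i + j + (2 - i - j)) mod 3" unfolding cl by (simp only: mod_simps)
  also have "\<dots> = 2" by simp
  finally show "t \<in> triple_class 2" by (simp add: t triple_class_def algebra_simps)
qed

text \<open>The residue triples with sum 2 are the three arrangements each of (0, 0, 2), (0, 1, 1)
  and (1, 2, 2), and the classes 1 and 2 have the same theta series.\<close>

lemma has_sum_triple_class_2:
  assumes "0 \<le> q" "q < 1"
  shows "((\<lambda>(x, y, z). q ^ (eis_norm x + eis_norm y + eis_norm z)) has_sum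
          3 * thY q * (thX q ^ 2 + thX q * thY q + thY q ^ 2)) (triple_class 2)"
proof -
  define th where "th i = eis_theta (eis_class i) q" for i
  have th: "th 0 = thX q" "th 1 = thY q" "th 2 = thY q"
    using eis_theta_class_2 by (simp_all add: th_def thX_def thY_def)
  have "((\<lambda>(x, y, z). q ^ (eis_norm x + eis_norm y + eis_norm z)) has_sum
          (\<Sum>ij\<in>{0,1,2} \<times> {0,1,2}. th (fst ij) * th (snd ij) * th ((2 - fst ij - snd ij) mod 3)))
        (triple_class 2)"
    unfolding triple_class_eq_Union
  proof (rule sum_has_sum, goal_cases)
    case (2 ij)
    show ?case
      using has_sum_triple_product[OF eis_theta_has_sum[OF assms] eis_theta_has_sum[OF assms]
          eis_theta_has_sum[OF assms]] assms(1)
      by (simp add: case_prod_unfold power_add th_def)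
  next
    case (3 ij kl)
    from 3(3) show ?case by (auto simp: eis_class_def prod_eq_iff)
  qed simp
  also have "(\<Sum>ij\<in>{0,1,2} \<times> {0,1,2}. th (fst ij) * th (snd ij) * th ((2 - fst ij - snd ij) mod 3)) =
             (\<Sum>i\<in>{0,1,2}. \<Sum>j\<in>{0,1,2}. th i * th j * th ((2 - i - j) mod 3))"
    by (simp only: sum.cartesian_product case_prod_unfold)
  also have "\<dots> = 3 * thY q * (thX q ^ 2 + thX q * thY q + thY q ^ 2)"
    by (simp add: th power2_eq_square algebra_simps)
  finally show ?thesis .
qed

text \<open>The divisibility that makes the inverse of \<open>fou\<close> in \<open>thY_cube\<close>
  integral.\<close>

lemma mod3_witness:
  assumes "(p1 - p2 + q1 - q2 + r1 - r2) mod 3 = (2 :: int)"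
  shows   "\<exists>x. p2 + q2 + r2 - 1 - (p1 + q1 + r1) = 3 * x"
proof -
  define d where "d = p1 - p2 + q1 - q2 + r1 - r2"
  have "d = 3 * (d div 3) + 2" using assms unfolding d_def [symmetric]
    by (metis mult_div_mod_eq)
  thus ?thesis by (intro exI[of _ "- (d div 3) - 1"]) (simp add: d_def)
qed

text \<open>
  Let \<open>\<lambda> = 2 + \<omega>\<close>, of norm 3. The terms of \<open>thY q ^ 3\<close> belong to the triples
  \<open>(1 + \<lambda> x, 1 + \<lambda> y, 1 + \<lambda> z)\<close>. Multiplying one entry by \<open>\<omega>\<close> (\<open>sig\<close> below) permutes the classes of
  \<open>x + y + z\<close> cyclically, so the class 0 carries a third of the sum. There \<open>z = \<lambda> k - x - y\<close> (\<open>par\<close>),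
  and the unitary matrix with entries \<open>\<omega>\<^bsup>i j\<^esup> / \<lambda>\<close> maps the triple to \<open>\<lambda>\<close> times an integral triple (\<open>fou\<close>).
\<close>
lemma thY_cube:
  assumes q: "0 \<le> q" "q < 1"
  shows "thY q ^ 3 = 9 * thY (q ^ 3) * (thX (q ^ 3) ^ 2 + thX (q ^ 3) * thY (q ^ 3) + thY (q ^ 3) ^ 2)"
proof -
  define w where "w = (\<lambda>(x, y, z). q ^ (eis_norm (eis_shift x) + eis_norm (eis_shift y) + eis_norm (eis_shift z)))"
  have "((\<lambda>x. q ^ eis_norm (eis_shift x)) has_sum thY q) UNIV"
    using eis_theta_has_sum[OF q, of "eis_class 1"] unfolding thY_def
    by (subst has_sum_reindex_bij_betw[OF bij_eis_shift])
  from has_sum_triple_product[OF this this this] q(1)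
  have total: "(w has_sum thY q ^ 3) UNIV"
    by (simp add: w_def power_add power3_eq_cube)
  define s where "s = 3 * thY (q ^ 3) * (thX (q ^ 3) ^ 2 + thX (q ^ 3) * thY (q ^ 3) + thY (q ^ 3) ^ 2)"
  have q3: "0 \<le> q ^ 3" "q ^ 3 < 1" using q by (auto simp: power_less_one_iff)
  define fou :: "(int \<times> int) \<times> (int \<times> int) \<times> (int \<times> int) \<Rightarrow> _" where
    "fou = (\<lambda>((x1, x2), (y1, y2), (k1, k2)). ((k1, k2 + 1),
        (x1 + y1 + y2 - k1 - k2, x2 - y1 + k1),
        (k2 - x2 - y1 - y2, x1 + x2 + y1 - k1 - k2)))"
  define par :: "(int \<times> int) \<times> (int \<times> int) \<times> (int \<times> int) \<Rightarrow> _" where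
    "par = (\<lambda>((x1, x2), (y1, y2), (k1, k2)). ((x1, x2), (y1, y2),
        (2 * k1 + k2 - x1 - y1, k2 - k1 - x2 - y2)))"
  \<comment> \<open>The entries of the output add up to 3 / \<lambda>^2 = - \<omega> times the first
    input 1 + \<lambda> x, and - \<omega>, the pair (0, 1), has class 2. In coordinates the sum is
    \<open>(x1 - x2, x1 + 2 * x2 + 1)\<close>, so \<open>d2 - d1 = 3 * x2\<close> recovers
    x.\<close>
  have fou: "bij_betw fou UNIV (triple_class 2)"
  proof (rule bij_betwI[of _ _ _ "\<lambda>((p1, p2), (q1, q2), (r1, r2)).
      let d1 = p1 + q1 + r1; d2 = p2 + q2 + r2 - 1; x2 = (d2 - d1) div 3; x1 = d1 + x2 in
      ((x1, x2), (p1 - q2 + x2, p2 - 1 + q1 - x1 + q2 - x2), (p1, p2 - 1))"], goal_cases)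
    case 1
    have "(k1 - (k2 + 1) + (x1 + y1 + y2 - k1 - k2) - (x2 - y1 + k1) +
        (k2 - x2 - y1 - y2) - (x1 + x2 + y1 - k1 - k2)) mod 3 = (2 :: int)" for x1 x2 y1 y2 k1 k2
    proof -
      have "k1 - (k2 + 1) + (x1 + y1 + y2 - k1 - k2) - (x2 - y1 + k1) +
          (k2 - x2 - y1 - y2) - (x1 + x2 + y1 - k1 - k2) = 2 + 3 * (- 1 - x2)" by simp
      thus ?thesis by (simp only: mod_mult_self2) simp
    qed
    thus ?case by (auto simp: fou_def triple_class_def)
  next
    case (4 t)
    obtain p1 p2 q1 q2 r1 r2 where t: "t = ((p1, p2), (q1, q2), (r1, r2))" by (metis surj_pair)
    have "(p1 - p2 + q1 - q2 + r1 - r2) mod 3 = 2" using 4 by (simp add: t triple_class_def)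
    then obtain x where x: "p2 + q2 + r2 - 1 - (p1 + q1 + r1) = 3 * x"
      by (metis mod3_witness)
    have "(p2 + q2 + r2 - 1 - (p1 + q1 + r1)) div 3 = x" unfolding x by simp
    thus ?case using x by (simp add: t fou_def Let_def)
  qed (auto simp: fou_def Let_def split: prod.splits)
  have par: "bij_betw par UNIV (triple_class 0)"
  proof (rule bij_betwI[of _ _ _ "\<lambda>((x1, x2), (y1, y2), (z1, z2)).
      let k1 = (x1 + y1 + z1 - x2 - y2 - z2) div 3 in
      ((x1, x2), (y1, y2), (k1, x2 + y2 + z2 + k1))"], goal_cases)
    case 1
    have "(x1 - x2 + y1 - y2 + (2 * k1 + k2 - x1 - y1) - (k2 - k1 - x2 - y2)) mod 3 = (0 :: int)"
      for x1 x2 y1 y2 k1 k2 by simp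
    thus ?case by (auto simp: par_def triple_class_def)
  next
    case (4 t)
    obtain x1 x2 y1 y2 z1 z2 where t: "t = ((x1, x2), (y1, y2), (z1, z2))" by (metis surj_pair)
    have "(x1 - x2 + y1 - y2 + z1 - z2) mod 3 = 0" using 4 by (simp add: t triple_class_def)
    then obtain k where k: "x1 - x2 + y1 - y2 + z1 - z2 = 3 * k" by auto
    hence "x1 + y1 + z1 - x2 - y2 - z2 = 3 * k" by simp
    hence "(x1 + y1 + z1 - x2 - y2 - z2) div 3 = k" by simp
    thus ?case using k by (simp add: t par_def Let_def)
  qed (auto simp: par_def Let_def split: prod.splits)
  have wpar: "w (par t) = (case fou t of (x, y, z) \<Rightarrow> (q ^ 3) ^ (eis_norm x + eis_norm y + eis_norm z))" for t
  proof -
    obtain x1 x2 y1 y2 k1 k2 where t: "t = ((x1, x2), (y1, y2), (k1, k2))"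
      by (metis surj_pair)
    \<comment> \<open>Parseval: the unitary matrix preserves the sum of norms, and dividing its
      output by \<lambda> divides this sum by 3.\<close>
    have "int (eis_norm (eis_shift (x1, x2)) + eis_norm (eis_shift (y1, y2)) +
              eis_norm (eis_shift (2 * k1 + k2 - x1 - y1, k2 - k1 - x2 - y2))) =
          int (3 * (eis_norm (k1, k2 + 1) + eis_norm (x1 + y1 + y2 - k1 - k2, x2 - y1 + k1) +
                    eis_norm (k2 - x2 - y1 - y2, x1 + x2 + y1 - k1 - k2)))"
      unfolding of_nat_add of_nat_mult int_eis_norm eis_shift_def fst_conv snd_conv of_nat_numeral
      by (simp add: power2_eq_square algebra_simps)
    thus ?thesis
      by (simp only: of_nat_eq_iff) (simp add: t w_def par_def fou_def power_mult [symmetric])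
  qed
  have "((\<lambda>t. w (par t)) has_sum s) UNIV"
    unfolding wpar s_def
    by (subst has_sum_reindex_bij_betw[OF fou]) (rule has_sum_triple_class_2[OF q3])
  hence s0: "(w has_sum s) (triple_class 0)"
    by (subst (asm) has_sum_reindex_bij_betw[OF par])
  \<comment> \<open>Since \<omega> - 1 = \<omega> \<lambda>, the entry \<omega> (1 + \<lambda> x)
    equals 1 + \<lambda> \<omega> (x + 1); as \<omega> is 1 modulo \<lambda>, the class of x rises
    by one.\<close>
  define sig :: "(int \<times> int) \<times> (int \<times> int) \<times> (int \<times> int) \<Rightarrow> _" where
    "sig = (\<lambda>((x1, x2), yz). ((x2, - x1 - x2 - 1), yz))"
  have wsig: "w (sig t) = w t" for t
  proof -
    obtain x1 x2 y z where t: "t = ((x1, x2), y, z)" by (metis surj_pair)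
    have "int (eis_norm (eis_shift (x2, - x1 - x2 - 1))) = int (eis_norm (eis_shift (x1, x2)))"
      by (simp add: int_eis_norm eis_shift_def power2_eq_square algebra_simps)
    thus ?thesis by (simp add: t sig_def w_def)
  qed
  have sig: "bij_betw sig (triple_class j) (triple_class ((j + 1) mod 3))" if "j \<in> {0, 1, 2}" for j
  proof (rule bij_betwI[of _ _ _ "\<lambda>((x1, x2), yz). ((- x1 - x2 - 1, x1), yz)"], goal_cases)
    case 1
    have "(x2 - (- x1 - x2 - 1) + a - b + c - d) mod 3 = ((x1 - x2 + a - b + c - d) mod 3 + 1) mod 3"
      for x1 x2 a b c d :: int
    proof -
      have "x2 - (- x1 - x2 - 1) + a - b + c - d = (x1 - x2 + a - b + c - d + 1) + 3 * x2" by simp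
      thus ?thesis by (metis mod_add_left_eq mod_mult_self2)
    qed
    thus ?case by (auto simp: sig_def triple_class_def)
  next
    case 2
    have "(- x1 - x2 - 1 - x1 + a - b + c - d) mod 3 = ((x1 - x2 + a - b + c - d) mod 3 - 1) mod 3"
      for x1 x2 a b c d :: int
    proof -
      have "- x1 - x2 - 1 - x1 + a - b + c - d = (x1 - x2 + a - b + c - d - 1) + 3 * (- x1)" by simp
      thus ?thesis by (metis mod_diff_left_eq mod_mult_self2)
    qed
    moreover have "((j + 1) mod 3 - 1) mod 3 = j" using that by auto
    ultimately show ?case by (auto simp: triple_class_def)
  qed (auto simp: sig_def)
  have s1: "(w has_sum s) (triple_class 1)"
    using has_sum_reindex_bij_betw[OF sig[of 0], of w s] s0 by (simp add: wsig)
  have s2: "(w has_sum s) (triple_class 2)"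
    using has_sum_reindex_bij_betw[OF sig[of 1], of w s] s1 by (simp add: wsig)
  have "(w has_sum (\<Sum>j\<in>{0,1,2::int}. s)) (\<Union>j\<in>{0,1,2}. triple_class j)"
    by (rule sum_has_sum) (use s0 s1 s2 in \<open>auto simp: triple_class_def\<close>)
  also have "(\<Union>j\<in>{0,1,2}. triple_class j) = UNIV"
  proof -
    show ?thesis unfolding triple_class_def using mod3_in by blast
  qed
  finally have "(w has_sum 3 * s) UNIV" by simp
  with total have "thY q ^ 3 = 3 * s" using has_sum_unique by blast
  thus ?thesis by (simp add: s_def)
qed

section \<open>The cubic transformation\<close>

definition cubic_coeff :: "nat \<Rightarrow> real" where
  "cubic_coeff n = pochhammer (1/3) n * pochhammer (2/3) n / fact n ^ 2"

definition cubic_F :: "real \<Rightarrow> real" where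
  "cubic_F x = (\<Sum>n. cubic_coeff n * x ^ n)"

definition cubic_F' :: "real \<Rightarrow> real" where
  "cubic_F' x = (\<Sum>n. diffs cubic_coeff n * x ^ n)"

lemma cubic_coeff_0 [simp]: "cubic_coeff 0 = 1"
  by (simp add: cubic_coeff_def)

lemma cubic_coeff_Suc:
  "real (Suc n) ^ 2 * cubic_coeff (Suc n) = (real n + 1/3) * (real n + 2/3) * cubic_coeff n"
proof -
  have "cubic_coeff (Suc n) =
          (pochhammer (1/3) n * (real n + 1/3)) * (pochhammer (2/3) n * (real n + 2/3)) /
          (real (Suc n) ^ 2 * fact n ^ 2)"
    by (simp only: cubic_coeff_def pochhammer_Suc fact_Suc power_mult_distrib of_nat_mult)
       (simp add: add.commute)
  thus ?thesis by (simp add: cubic_coeff_def)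
qed

lemma cubic_coeff_nonneg: "0 \<le> cubic_coeff n"
  by (auto simp: cubic_coeff_def intro!: divide_nonneg_nonneg mult_nonneg_nonneg pochhammer_nonneg)

lemma cubic_coeff_le_1: "cubic_coeff n \<le> 1"
proof (induction n)
  case (Suc n)
  have "real (Suc n) ^ 2 * cubic_coeff (Suc n) \<le> ((real n + 1/3) * (real n + 2/3)) * 1"
    unfolding cubic_coeff_Suc using Suc by (intro mult_left_mono) auto
  also have "\<dots> \<le> real (Suc n) ^ 2 * 1" by (simp add: power2_eq_square algebra_simps)
  finally show ?case by (subst (asm) mult_le_cancel_left_pos) auto
qed simp

lemma summable_cubic_coeff:
  assumes "\<bar>x\<bar> < 1"
  shows   "summable (\<lambda>n. cubic_coeff n * x ^ n)"
proof (rule summable_comparison_test')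
  show "summable (\<lambda>n. \<bar>x\<bar> ^ n)" using assms by simp
  show "norm (cubic_coeff n * x ^ n) \<le> \<bar>x\<bar> ^ n" for n
    using cubic_coeff_nonneg[of n] cubic_coeff_le_1[of n]
    by (simp add: abs_mult power_abs mult_left_le_one_le)
qed

lemma cubic_F_sums: "\<bar>x\<bar> < 1 \<Longrightarrow> (\<lambda>n. cubic_coeff n * x ^ n) sums cubic_F x"
  unfolding cubic_F_def by (rule summable_sums) (rule summable_cubic_coeff)

lemma cubic_F_deriv: "\<bar>x\<bar> < 1 \<Longrightarrow> (cubic_F has_field_derivative cubic_F' x) (at x)"
  unfolding cubic_F_def[abs_def] cubic_F'_def
  by (rule termdiffs_strong'[of 1]) (auto intro: summable_cubic_coeff)

lemma summable_diffs_cubic: "\<bar>x\<bar> < 1 \<Longrightarrow> summable (\<lambda>n. diffs cubic_coeff n * x ^ n)"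
  by (rule termdiff_converges[of _ 1]) (auto intro: summable_cubic_coeff)

text \<open>The hypergeometric equation for a b = 2/9 and a + b = c = 1, in self-adjoint form so
  that a weighted Wronskian is constant. Coefficientwise it is the recursion
  \<open>cubic_coeff_Suc\<close>.\<close>

lemma cubic_F_ode:
  assumes x: "\<bar>x\<bar> < 1"
  shows "((\<lambda>x. x * (1 - x) * cubic_F' x) has_field_derivative 2/9 * cubic_F x) (at x)"
proof -
  define d where "d = diffs cubic_coeff"
  define F'' where "F'' = (\<Sum>n. diffs d n * x ^ n)"
  have "(cubic_F' has_field_derivative F'') (at x)"
    unfolding cubic_F'_def[abs_def] F''_def d_def
    by (rule termdiffs_strong'[of 1]) (auto intro: summable_diffs_cubic x)
  hence D: "((\<lambda>x. x * (1 - x) * cubic_F' x) has_field_derivative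
           (1 - 2 * x) * cubic_F' x + x * (1 - x) * F'') (at x)"
    by (auto intro!: derivative_eq_intros simp: algebra_simps)
  have s1: "(\<lambda>n. d n * x ^ n) sums cubic_F' x"
    unfolding cubic_F'_def d_def using summable_diffs_cubic[OF x] by (rule summable_sums)
  have s2: "(\<lambda>n. real n * cubic_coeff n * x ^ n) sums (x * cubic_F' x)"
  proof -
    have "(\<lambda>n. x * (real n * cubic_coeff n * x ^ (n - Suc 0))) sums (x * cubic_F' x)"
      unfolding cubic_F'_def using diffs_equiv[OF summable_diffs_cubic[OF x]] by (rule sums_mult)
    also have "(\<lambda>n. x * (real n * cubic_coeff n * x ^ (n - Suc 0))) = (\<lambda>n. real n * cubic_coeff n * x ^ n)"
      by (rule ext, rename_tac n, case_tac n) auto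
    finally show ?thesis .
  qed
  have "summable (\<lambda>n. diffs d n * x ^ n)"
    unfolding d_def by (rule termdiff_converges[of _ 1]) (auto intro: summable_diffs_cubic x)
  hence s3: "(\<lambda>n. real n * d n * x ^ n) sums (x * F'')"
  proof -
    have "(\<lambda>n. x * (real n * d n * x ^ (n - Suc 0))) sums (x * F'')"
      unfolding F''_def using diffs_equiv[OF \<open>summable _\<close>] by (rule sums_mult)
    also have "(\<lambda>n. x * (real n * d n * x ^ (n - Suc 0))) = (\<lambda>n. real n * d n * x ^ n)"
      by (rule ext, rename_tac n, case_tac n) auto
    finally show ?thesis .
  qed
  have s4: "(\<lambda>n. real n * (real n - 1) * cubic_coeff n * x ^ n) sums (x * (x * F''))"
  proof (subst sums_Suc_iff [where f = "\<lambda>n. real n * (real n - 1) * cubic_coeff n * x ^ n" and s = "x * (x * F'')", simplified, symmetric])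
    have "(\<lambda>n. x * (real n * d n * x ^ n)) sums (x * (x * F''))" using s3 by (rule sums_mult)
    thus "(\<lambda>n. (1 + real n) * real n * cubic_coeff (Suc n) * (x * x ^ n)) sums (x * (x * F''))"
      by (simp add: d_def diffs_def mult_ac)
  qed
  have "(\<lambda>n. d n * x ^ n - 2 * (real n * cubic_coeff n * x ^ n) + real n * d n * x ^ n
            - real n * (real n - 1) * cubic_coeff n * x ^ n)
          sums (cubic_F' x - 2 * (x * cubic_F' x) + x * F'' - x * (x * F''))"
    by (intro sums_add sums_diff s1 s2 s3 s4 sums_mult)
  also have "(\<lambda>n. d n * x ^ n - 2 * (real n * cubic_coeff n * x ^ n) + real n * d n * x ^ n
            - real n * (real n - 1) * cubic_coeff n * x ^ n) = (\<lambda>n. 2/9 * (cubic_coeff n * x ^ n))"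
  proof
    fix n
    have "d n + real n * d n = real (Suc n) ^ 2 * cubic_coeff (Suc n)"
      by (simp add: d_def diffs_def power2_eq_square algebra_simps)
    also have "\<dots> = (real n + 1/3) * (real n + 2/3) * cubic_coeff n" by (rule cubic_coeff_Suc)
    finally have e: "d n = (real n + 1/3) * (real n + 2/3) * cubic_coeff n - real n * d n" by simp
    have "d n * x ^ n + real n * d n * x ^ n = (real n + 1/3) * (real n + 2/3) * cubic_coeff n * x ^ n"
      by (subst e) (simp add: algebra_simps)
    thus "d n * x ^ n - 2 * (real n * cubic_coeff n * x ^ n) + real n * d n * x ^ n
            - real n * (real n - 1) * cubic_coeff n * x ^ n = 2/9 * (cubic_coeff n * x ^ n)"
      by (simp add: algebra_simps)
  qed
  finally have "(\<lambda>n. 2/9 * (cubic_coeff n * x ^ n)) sums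
      (cubic_F' x - 2 * (x * cubic_F' x) + x * F'' - x * (x * F''))" .
  moreover have "(\<lambda>n. 2/9 * (cubic_coeff n * x ^ n)) sums (2/9 * cubic_F x)"
    by (intro sums_mult cubic_F_sums x)
  ultimately have "cubic_F' x - 2 * (x * cubic_F' x) + x * F'' - x * (x * F'') = 2/9 * cubic_F x"
    by (rule sums_unique2)
  hence *: "2/9 * cubic_F x = (1 - 2 * x) * cubic_F' x + x * (1 - x) * F''"
    by (simp add: algebra_simps)
  show ?thesis unfolding * by (rule D)
qed

lemma cubic_F_ge_1: assumes "0 \<le> x" "x < 1" shows "1 \<le> cubic_F x"
proof -
  have "(\<Sum>n<1. cubic_coeff n * x ^ n) \<le> cubic_F x"
    unfolding cubic_F_def
    by (rule sum_le_suminf) (use assms in \<open>auto intro!: summable_cubic_coeff mult_nonneg_nonneg cubic_coeff_nonneg\<close>)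
  thus ?thesis by simp
qed

text \<open>For u = U(q^3) the quotient is Z(q) / X(q), so the value is U(q)^3; see
  \<open>thU_cube\<close>.\<close>

definition cubic_phi :: "real \<Rightarrow> real" where
  "cubic_phi u = 1 - ((1 - u) / (1 + 2 * u)) ^ 3"

lemma cubic_phi_bounds: "0 \<le> u \<Longrightarrow> u < 1 \<Longrightarrow> 0 \<le> cubic_phi u \<and> cubic_phi u < 1"
  by (auto simp: cubic_phi_def intro!: power_le_one)

lemma cubic_phi_deriv:
  "0 \<le> u \<Longrightarrow> (cubic_phi has_field_derivative 9 * (1 - u) ^ 2 / (1 + 2 * u) ^ 4) (at u)"
  unfolding cubic_phi_def[abs_def]
  by (rule derivative_eq_intros refl | simp)+
     (simp add: field_simps power2_eq_square power4_eq_xxxx)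

text \<open>Compares the weights x (1 - x) and u (1 - u^3) under x = \<open>cubic_phi u\<close>. It
  serves twice: for the hypergeometric transformation and for the invariance under cubing in
  \<open>thU_ode\<close>.\<close>

lemma cubic_phi_identity:
  assumes "0 \<le> (u::real)"
  shows "u * (1 - u ^ 3) * (9 * (1 - u) ^ 2 / (1 + 2 * u) ^ 4) =
           (1 + 2 * u) ^ 2 * (cubic_phi u * (1 - cubic_phi u))"
proof -
  have "cubic_phi u = 9 * u * (1 + u + u ^ 2) / (1 + 2 * u) ^ 3"
    using assms by (simp add: cubic_phi_def power_divide field_simps) (simp add: algebra_simps power2_eq_square power3_eq_cube)
  moreover have "1 - cubic_phi u = (1 - u) ^ 3 / (1 + 2 * u) ^ 3"
    by (simp add: cubic_phi_def power_divide)
  ultimately have "(1 + 2 * u) ^ 2 * (cubic_phi u * (1 - cubic_phi u)) =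
      (1 + 2 * u) ^ 2 * (9 * u * (1 + u + u ^ 2) * (1 - u) ^ 3) / (1 + 2 * u) ^ 6"
    by (simp add: power_add [symmetric])
  also have "\<dots> = (9 * u * (1 + u + u ^ 2) * (1 - u) ^ 3) / (1 + 2 * u) ^ 4"
    using assms by (simp add: field_simps power_add [symmetric])
  also have "9 * u * (1 + u + u ^ 2) * (1 - u) ^ 3 = u * (1 - u ^ 3) * (9 * (1 - u) ^ 2)"
    by (simp add: algebra_simps power2_eq_square power3_eq_cube)
  finally show ?thesis by simp
qed

text \<open>
  Both sides, divided by \<open>1 + 2 * u\<close>, solve \<open>(u (1 - u\<^sup>3) w')' = 2 u\<^sup>2 w\<close>, so
  \<open>u (1 - u\<^sup>3)\<close> times their Wronskian is constant, and it vanishes at 0.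
\<close>
theorem cubic_F_transformation:
  assumes u: "0 \<le> u" "u < 1"
  shows "cubic_F (cubic_phi u) = (1 + 2 * u) * cubic_F (u ^ 3)"
proof (cases "u = 0")
  case True thus ?thesis by (simp add: cubic_phi_def)
next
  case False
  with u have u0: "0 < u" by simp
  define dp where "dp v = 9 * (1 - v) ^ 2 / (1 + 2 * v) ^ 4" for v :: real
  define H where "H x = x * (1 - x) * cubic_F' x" for x
  define w where "w v = cubic_F (cubic_phi v) / (1 + 2 * v)" for v
  define w' where "w' v = cubic_F' (cubic_phi v) * dp v / (1 + 2 * v)
                           - 2 * cubic_F (cubic_phi v) / (1 + 2 * v) ^ 2" for v
  define z where "z v = cubic_F (v ^ 3)" for v
  define z' where "z' v = 3 * v ^ 2 * cubic_F' (v ^ 3)" for v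
  \<comment> \<open>This is v (1 - v^3) w' after substituting \<open>cubic_phi_identity\<close>. In
    this form the second derivative of \<open>cubic_F\<close> enters only through H, whose
    derivative \<open>cubic_F_ode\<close> supplies.\<close>
  define pw where "pw v = (1 + 2 * v) * H (cubic_phi v)
                    - 2 * v * (1 - v ^ 3) * cubic_F (cubic_phi v) / (1 + 2 * v) ^ 2" for v
  define pz where "pz v = 3 * H (v ^ 3)" for v
  have phi: "\<bar>cubic_phi v\<bar> < 1" "\<bar>v ^ 3\<bar> < 1" if "0 \<le> v" "v < 1" for v
    using cubic_phi_bounds[of v] that by (auto simp: power_less_one_iff)
  have dphi: "(cubic_phi has_field_derivative dp v) (at v)" if "0 \<le> v" for v
    using cubic_phi_deriv that by (simp add: dp_def)
  have dF: "((\<lambda>v. cubic_F (cubic_phi v)) has_field_derivative cubic_F' (cubic_phi v) * dp v) (at v)"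
    if "0 \<le> v" "v < 1" for v
    using DERIV_chain2[OF cubic_F_deriv[OF phi(1)[OF that]] dphi] that by simp
  have dH: "((\<lambda>v. H (cubic_phi v)) has_field_derivative 2/9 * cubic_F (cubic_phi v) * dp v) (at v)"
    if "0 \<le> v" "v < 1" for v
    unfolding H_def[abs_def]
    using DERIV_chain2[OF cubic_F_ode[OF phi(1)[OF that]] dphi] that by simp
  have d3: "((\<lambda>v. v ^ 3) has_field_derivative 3 * v ^ 2) (at v)" for v :: real
    by (auto intro!: derivative_eq_intros simp: power2_eq_square)
  have dz: "(z has_field_derivative z' v) (at v)" if "0 \<le> v" "v < 1" for v
    unfolding z_def[abs_def] z'_def
    using DERIV_chain2[OF cubic_F_deriv[OF phi(2)[OF that]] d3] by (simp add: mult_ac)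
  have dpz: "(pz has_field_derivative 2 * v ^ 2 * z v) (at v)" if "0 \<le> v" "v < 1" for v
    unfolding pz_def[abs_def] H_def z_def
    using DERIV_cmult[OF DERIV_chain2[OF cubic_F_ode[OF phi(2)[OF that]] d3], of 3] by (simp add: mult_ac)
  have dw: "(w has_field_derivative w' v) (at v)" if "0 \<le> v" "v < 1" for v
    unfolding w_def[abs_def] w'_def using that
    by (auto intro!: derivative_eq_intros dF simp: diff_divide_distrib power2_eq_square)
  have key: "v * (1 - v ^ 3) * dp v = (1 + 2 * v) ^ 2 * (cubic_phi v * (1 - cubic_phi v))" if "0 \<le> v" for v
    unfolding dp_def by (rule cubic_phi_identity[OF that])
  have pw: "pw v = v * (1 - v ^ 3) * w' v" if "0 \<le> v" for v
  proof -
    have "v * (1 - v ^ 3) * w' v = (v * (1 - v ^ 3) * dp v) * cubic_F' (cubic_phi v) / (1 + 2 * v)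
             - 2 * v * (1 - v ^ 3) * cubic_F (cubic_phi v) / (1 + 2 * v) ^ 2"
      by (simp add: w'_def algebra_simps)
    thus ?thesis unfolding key[OF that] pw_def H_def
      using that by (simp add: power2_eq_square)
  qed
  have pz: "pz v = v * (1 - v ^ 3) * z' v" for v
    by (simp add: pz_def H_def z'_def power2_eq_square power3_eq_cube)
  have dpw: "(pw has_field_derivative 2 * v ^ 2 * w v) (at v)" if v: "0 \<le> v" "v < 1" for v
  proof -
    have nz: "1 + 2 * v \<noteq> 0" using v by simp
    have dR: "((\<lambda>v. 2 * v * (1 - v ^ 3) / (1 + 2 * v) ^ 2) has_field_derivative
            2 * (1 - 2 * v - 4 * v ^ 3 - 4 * v ^ 4) / (1 + 2 * v) ^ 3) (at v)"
      using nz
      by (auto intro!: derivative_eq_intros)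
         (simp add: divide_simps, simp add: algebra_simps power2_eq_square power3_eq_cube power4_eq_xxxx)
    define R where "R v = 2 * v * (1 - v ^ 3) / (1 + 2 * v) ^ 2" for v :: real
    have pw_R: "pw = (\<lambda>v. (1 + 2 * v) * H (cubic_phi v) - R v * cubic_F (cubic_phi v))"
      by (simp add: fun_eq_iff pw_def R_def)
    have "(pw has_field_derivative
       2 * H (cubic_phi v) + (1 + 2 * v) * (2/9 * cubic_F (cubic_phi v) * dp v)
       - (2 * (1 - 2 * v - 4 * v ^ 3 - 4 * v ^ 4) / (1 + 2 * v) ^ 3 * cubic_F (cubic_phi v) +
           2 * v * (1 - v ^ 3) / (1 + 2 * v) ^ 2 * (cubic_F' (cubic_phi v) * dp v))) (at v)"
      unfolding pw_R using dR unfolding R_def [symmetric]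
      by (auto intro!: derivative_eq_intros dH dF v simp: algebra_simps)
    \<comment> \<open>The terms with \<open>cubic_F'\<close> cancel, and the derivative of
      \<open>pw\<close> becomes a rational multiple of \<open>cubic_F (cubic_phi v)\<close>
      alone.\<close>
    also have "2 * v * (1 - v ^ 3) / (1 + 2 * v) ^ 2 * (cubic_F' (cubic_phi v) * dp v) =
               2 * (v * (1 - v ^ 3) * dp v) * cubic_F' (cubic_phi v) / (1 + 2 * v) ^ 2"
      by simp
    also have "\<dots> = 2 * H (cubic_phi v)"
      unfolding key[OF v(1)] H_def using nz by simp
    also have "2 * H (cubic_phi v) + (1 + 2 * v) * (2/9 * cubic_F (cubic_phi v) * dp v)
       - (2 * (1 - 2 * v - 4 * v ^ 3 - 4 * v ^ 4) / (1 + 2 * v) ^ 3 * cubic_F (cubic_phi v) +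
           2 * H (cubic_phi v)) =
       cubic_F (cubic_phi v) * ((1 + 2 * v) * (2/9 * dp v) -
             2 * (1 - 2 * v - 4 * v ^ 3 - 4 * v ^ 4) / (1 + 2 * v) ^ 3)"
      by (simp add: algebra_simps)
    also have "(1 + 2 * v) * (2/9 * dp v) = 2 * (1 - v) ^ 2 / (1 + 2 * v) ^ 3"
      using nz by (simp add: dp_def power4_eq_xxxx power3_eq_cube)
    also have "2 * (1 - v) ^ 2 / (1 + 2 * v) ^ 3 - 2 * (1 - 2 * v - 4 * v ^ 3 - 4 * v ^ 4) / (1 + 2 * v) ^ 3
               = 2 * v ^ 2 * (1 + 2 * v) ^ 2 / (1 + 2 * v) ^ 3"
      by (simp add: diff_divide_distrib [symmetric])
         (simp add: algebra_simps power2_eq_square power3_eq_cube power4_eq_xxxx)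
    also have "\<dots> = 2 * v ^ 2 / (1 + 2 * v)" using nz by (simp add: power2_eq_square power3_eq_cube)
    finally show ?thesis by (simp add: w_def mult_ac)
  qed
  have D: "pw v * z v - w v * pz v = 0" if v: "0 < v" "v < 1" for v
  proof -
    have "pw v * z v - w v * pz v = pw 0 * z 0 - w 0 * pz 0"
    proof (rule DERIV_isconst_end[of 0 v "\<lambda>v. pw v * z v - w v * pz v"])
      show "continuous_on {0..v} (\<lambda>v. pw v * z v - w v * pz v)"
        by (intro continuous_at_imp_continuous_on ballI continuous_intros DERIV_isCont[OF dpw]
            DERIV_isCont[OF dz] DERIV_isCont[OF dw] DERIV_isCont[OF dpz]) (use v in auto)
      show "((\<lambda>v. pw v * z v - w v * pz v) has_real_derivative 0) (at t)" if "0 < t" "t < v" for t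
      proof -
        have t: "0 \<le> t" "t < 1" using that v by auto
        have "((\<lambda>v. pw v * z v - w v * pz v) has_real_derivative
            (2 * t ^ 2 * w t * z t + z' t * pw t) - (w' t * pz t + 2 * t ^ 2 * z t * w t)) (at t)"
          by (intro DERIV_diff DERIV_mult dpw dz dw dpz t)
        thus ?thesis by (simp add: pw[OF t(1)] pz algebra_simps)
      qed
    qed (use v in auto)
    thus ?thesis by (simp add: pw pz)
  qed
  have zpos: "1 \<le> z v" if "0 \<le> v" "v < 1" for v
    unfolding z_def by (rule cubic_F_ge_1) (use that in \<open>auto simp: power_less_one_iff\<close>)
  have "w u / z u = w 0 / z 0"
  proof (rule DERIV_isconst_end[of 0 u "\<lambda>v. w v / z v"])
    show "continuous_on {0..u} (\<lambda>v. w v / z v)"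
      by (intro continuous_at_imp_continuous_on ballI continuous_intros DERIV_isCont[OF dw] DERIV_isCont[OF dz])
         (use u zpos in fastforce)+
    fix t assume t: "0 < t" "t < u"
    have "t * (1 - t ^ 3) * (w' t * z t - w t * z' t) = 0"
      using D[of t] t u by (simp add: pw pz algebra_simps)
    moreover have "t * (1 - t ^ 3) \<noteq> 0" using phi(2)[of t] t u by auto
    ultimately have *: "w' t * z t - w t * z' t = 0" by simp
    have "z t \<noteq> 0" using zpos[of t] t u by auto
    thus "((\<lambda>v. w v / z v) has_real_derivative 0) (at t)"
      using t u * by (auto intro!: derivative_eq_intros dw dz)
  qed (use u0 in auto)
  also have "\<dots> = 1" by (simp add: w_def z_def cubic_phi_def cubic_F_def)
  finally have "w u = z u" using zpos[of u] u by simp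
  thus ?thesis using u by (simp add: w_def z_def field_simps)
qed

section \<open>Power series of polynomial growth\<close>

definition eis_count :: "(int \<times> int) set \<Rightarrow> nat \<Rightarrow> real" where
  "eis_count S n = real (card {p \<in> S. eis_norm p = n})"

lemma finite_eis_norm: "finite {p \<in> S. eis_norm p = n}"
proof (rule finite_subset)
  show "{p \<in> S. eis_norm p = n} \<subseteq> {- int (2 * n)..int (2 * n)} \<times> {- int (2 * n)..int (2 * n)}"
  proof
    fix p assume "p \<in> {p \<in> S. eis_norm p = n}"
    hence *: "nat (fst p ^ 2) + nat (snd p ^ 2) \<le> 2 * n" using eis_norm_bound[of p] by simp
    have "\<bar>a\<bar> \<le> int (2 * n)" if "nat (a ^ 2) \<le> 2 * n" for a :: int
    proof -
      have "\<bar>a\<bar> \<le> a ^ 2" 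
      proof (cases "a = 0")
        case False
        hence "\<bar>a\<bar> \<le> \<bar>a\<bar> ^ 2" by (intro self_le_power) auto
        thus ?thesis by simp
      qed simp
      also have "\<dots> \<le> int (2 * n)" using that by simp
      finally show ?thesis .
    qed
    from this[of "fst p"] this[of "snd p"] *
    have "\<bar>fst p\<bar> \<le> int (2 * n)" "\<bar>snd p\<bar> \<le> int (2 * n)" by linarith+
    thus "p \<in> {- int (2 * n)..int (2 * n)} \<times> {- int (2 * n)..int (2 * n)}"
      unfolding mem_Times_iff atLeastAtMost_iff by linarith
  qed
qed simp

lemma eis_theta_sums:
  assumes "0 \<le> q" "q < 1"
  shows "(\<lambda>n. eis_count S n * q ^ n) sums eis_theta S q"
proof -
  have bij: "bij_betw (\<lambda>p. (eis_norm p, p)) S (SIGMA n:UNIV. {p \<in> S. eis_norm p = n})"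
    by (rule bij_betwI[of _ _ _ snd]) auto
  have "((\<lambda>x. q ^ eis_norm (snd (eis_norm x, x))) has_sum eis_theta S q) S"
    using eis_theta_has_sum[OF assms] by simp
  hence "((\<lambda>x. q ^ eis_norm (snd x)) has_sum eis_theta S q) (SIGMA n:UNIV. {p \<in> S. eis_norm p = n})"
    by (subst (asm) has_sum_reindex_bij_betw[OF bij, where f = "\<lambda>x. q ^ eis_norm (snd x)"])
  hence "((\<lambda>n. eis_count S n * q ^ n) has_sum eis_theta S q) UNIV"
  proof (rule has_sum_SigmaD)
    show "((\<lambda>p. q ^ eis_norm (snd (n, p))) has_sum eis_count S n * q ^ n) {p \<in> S. eis_norm p = n}" for n
      by (rule has_sum_finiteI[OF finite_eis_norm]) (simp add: eis_count_def)
  qed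
  thus ?thesis by (rule has_sum_imp_sums)
qed

lemma eis_count_nonneg: "0 \<le> eis_count S n" by (simp add: eis_count_def)

text \<open>The bound concerns the series of absolute values, since the coefficients of
  \<open>thZ\<close> may have either sign. It therefore survives Cauchy products, with exponents
  adding up, and later dominates the Mellin integrals.\<close>

definition growth_series :: "nat \<Rightarrow> (real \<Rightarrow> real) \<Rightarrow> (nat \<Rightarrow> real) \<Rightarrow> bool" where
  "growth_series k f a \<longleftrightarrow> (\<exists>M. \<forall>q. 0 < q \<longrightarrow> q < 1 \<longrightarrow>
     (\<lambda>n. a n * q ^ n) sums f q \<and>
     summable (\<lambda>n. \<bar>a n\<bar> * q ^ n) \<and> (\<Sum>n. \<bar>a n\<bar> * q ^ n) \<le> M / (1 - q) ^ k)"

lemma growth_seriesE: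
  assumes "growth_series k f a"
  obtains M where
    "\<And>q. 0 < q \<Longrightarrow> q < 1 \<Longrightarrow> (\<lambda>n. a n * q ^ n) sums f q"
    "\<And>q. 0 < q \<Longrightarrow> q < 1 \<Longrightarrow> summable (\<lambda>n. \<bar>a n\<bar> * q ^ n)"
    "\<And>q. 0 < q \<Longrightarrow> q < 1 \<Longrightarrow> (\<Sum>n. \<bar>a n\<bar> * q ^ n) \<le> M / (1 - q) ^ k"
proof -
  from assms obtain M where M: "\<forall>q. 0 < q \<longrightarrow> q < 1 \<longrightarrow>
     (\<lambda>n. a n * q ^ n) sums f q \<and> summable (\<lambda>n. \<bar>a n\<bar> * q ^ n) \<and>
     (\<Sum>n. \<bar>a n\<bar> * q ^ n) \<le> M / (1 - q) ^ k"
    unfolding growth_series_def ..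
  show ?thesis by (rule that[of M]) (use M in simp_all)
qed

lemma growth_series_theta: "growth_series 1 (eis_theta S) (eis_count S)"
  unfolding growth_series_def
proof (intro exI[of _ "2 * (1 + pi) ^ 2"] allI impI)
  fix q :: real assume q: "0 < q" "q < 1"
  have s: "(\<lambda>n. \<bar>eis_count S n\<bar> * q ^ n) sums eis_theta S q"
    using eis_theta_sums[of q S] q by (simp add: eis_count_nonneg)
  show "(\<lambda>n. eis_count S n * q ^ n) sums eis_theta S q \<and>
     summable (\<lambda>n. \<bar>eis_count S n\<bar> * q ^ n) \<and>
     (\<Sum>n. \<bar>eis_count S n\<bar> * q ^ n) \<le> 2 * (1 + pi) ^ 2 / (1 - q) ^ 1"
    using eis_theta_sums[of q S] eis_theta_le[OF q, of S] q
      sums_summable[OF s] sums_unique[OF s, symmetric] by simp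
qed

lemma growth_series_diff:
  assumes "growth_series k f a" "growth_series k g b"
  shows   "growth_series k (\<lambda>q. f q - g q) (\<lambda>n. a n - b n)"
proof -
  obtain M where M:
    "\<And>q. 0 < q \<Longrightarrow> q < 1 \<Longrightarrow> (\<lambda>n. a n * q ^ n) sums f q"
    "\<And>q. 0 < q \<Longrightarrow> q < 1 \<Longrightarrow> summable (\<lambda>n. \<bar>a n\<bar> * q ^ n)"
    "\<And>q. 0 < q \<Longrightarrow> q < 1 \<Longrightarrow> (\<Sum>n. \<bar>a n\<bar> * q ^ n) \<le> M / (1 - q) ^ k"
    by (rule growth_seriesE[OF assms(1)]) blast
  obtain N where N:
    "\<And>q. 0 < q \<Longrightarrow> q < 1 \<Longrightarrow> (\<lambda>n. b n * q ^ n) sums g q"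
    "\<And>q. 0 < q \<Longrightarrow> q < 1 \<Longrightarrow> summable (\<lambda>n. \<bar>b n\<bar> * q ^ n)"
    "\<And>q. 0 < q \<Longrightarrow> q < 1 \<Longrightarrow> (\<Sum>n. \<bar>b n\<bar> * q ^ n) \<le> N / (1 - q) ^ k"
    by (rule growth_seriesE[OF assms(2)]) blast
  show ?thesis unfolding growth_series_def
  proof (intro exI[of _ "M + N"] allI impI conjI)
    fix q :: real assume q: "0 < q" "q < 1"
    show "(\<lambda>n. (a n - b n) * q ^ n) sums (f q - g q)"
      using sums_diff[OF M(1)[OF q] N(1)[OF q]] by (simp add: algebra_simps)
    have s: "summable (\<lambda>n. \<bar>a n\<bar> * q ^ n + \<bar>b n\<bar> * q ^ n)"
      by (intro summable_add M N q)
    have le: "\<bar>a n - b n\<bar> * q ^ n \<le> \<bar>a n\<bar> * q ^ n + \<bar>b n\<bar> * q ^ n" for n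
      using q mult_right_mono[OF abs_triangle_ineq4[of "a n" "b n"], of "q ^ n"]
      by (simp add: algebra_simps)
    show s': "summable (\<lambda>n. \<bar>a n - b n\<bar> * q ^ n)"
      by (rule summable_comparison_test'[OF s]) (use le q in \<open>auto simp: abs_mult\<close>)
    have "(\<Sum>n. \<bar>a n - b n\<bar> * q ^ n) \<le> (\<Sum>n. \<bar>a n\<bar> * q ^ n + \<bar>b n\<bar> * q ^ n)"
      by (rule suminf_le[OF le s' s])
    also have "\<dots> = (\<Sum>n. \<bar>a n\<bar> * q ^ n) + (\<Sum>n. \<bar>b n\<bar> * q ^ n)"
      by (intro suminf_add [symmetric] M N q)
    also have "\<dots> \<le> M / (1 - q) ^ k + N / (1 - q) ^ k" by (intro add_mono M N q)
    finally show "(\<Sum>n. \<bar>a n - b n\<bar> * q ^ n) \<le> (M + N) / (1 - q) ^ k"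
      by (simp add: add_divide_distrib)
  qed
qed

lemma growth_series_mult:
  assumes "growth_series k f a" "growth_series l g b"
  shows   "growth_series (k + l) (\<lambda>q. f q * g q) (\<lambda>n. \<Sum>i\<le>n. a i * b (n - i))"
proof -
  obtain M where M:
    "\<And>q. 0 < q \<Longrightarrow> q < 1 \<Longrightarrow> (\<lambda>n. a n * q ^ n) sums f q"
    "\<And>q. 0 < q \<Longrightarrow> q < 1 \<Longrightarrow> summable (\<lambda>n. \<bar>a n\<bar> * q ^ n)"
    "\<And>q. 0 < q \<Longrightarrow> q < 1 \<Longrightarrow> (\<Sum>n. \<bar>a n\<bar> * q ^ n) \<le> M / (1 - q) ^ k"
    by (rule growth_seriesE[OF assms(1)]) blast
  obtain N where N:
    "\<And>q. 0 < q \<Longrightarrow> q < 1 \<Longrightarrow> (\<lambda>n. b n * q ^ n) sums g q"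
    "\<And>q. 0 < q \<Longrightarrow> q < 1 \<Longrightarrow> summable (\<lambda>n. \<bar>b n\<bar> * q ^ n)"
    "\<And>q. 0 < q \<Longrightarrow> q < 1 \<Longrightarrow> (\<Sum>n. \<bar>b n\<bar> * q ^ n) \<le> N / (1 - q) ^ l"
    by (rule growth_seriesE[OF assms(2)]) blast
  show ?thesis unfolding growth_series_def
  proof (intro exI[of _ "M * N"] allI impI conjI)
    fix q :: real assume q: "0 < q" "q < 1"
    have conv: "(\<Sum>i\<le>n. u i * q ^ i * (v (n - i) * q ^ (n - i))) = (\<Sum>i\<le>n. u i * v (n - i)) * q ^ n"
      for u v :: "nat \<Rightarrow> real" and n
      unfolding sum_distrib_right
      by (rule sum.cong) (auto simp: power_add [symmetric] mult_ac)
    have na: "summable (\<lambda>n. norm (a n * q ^ n))" and nb: "summable (\<lambda>n. norm (b n * q ^ n))"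
      using M(2)[OF q] N(2)[OF q] q by (simp_all add: abs_mult)
    show "(\<lambda>n. (\<Sum>i\<le>n. a i * b (n - i)) * q ^ n) sums (f q * g q)"
      using Cauchy_product_sums[OF na nb] M(1)[OF q] N(1)[OF q] unfolding conv by (simp add: sums_iff)
    have na': "summable (\<lambda>n. norm (\<bar>a n\<bar> * q ^ n))" and nb': "summable (\<lambda>n. norm (\<bar>b n\<bar> * q ^ n))"
      using M(2)[OF q] N(2)[OF q] q by (simp_all add: abs_mult)
    have s: "(\<lambda>n. (\<Sum>i\<le>n. \<bar>a i\<bar> * \<bar>b (n - i)\<bar>) * q ^ n) sums
        ((\<Sum>n. \<bar>a n\<bar> * q ^ n) * (\<Sum>n. \<bar>b n\<bar> * q ^ n))"
      using Cauchy_product_sums[OF na' nb']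
      unfolding conv[of "\<lambda>i. \<bar>a i\<bar>" "\<lambda>i. \<bar>b i\<bar>"] .
    have le: "\<bar>\<Sum>i\<le>n. a i * b (n - i)\<bar> * q ^ n \<le> (\<Sum>i\<le>n. \<bar>a i\<bar> * \<bar>b (n - i)\<bar>) * q ^ n" for n
      using q sum_abs[of "\<lambda>i. a i * b (n - i)" "{..n}"] by (intro mult_right_mono) (auto simp: abs_mult)
    show s': "summable (\<lambda>n. \<bar>\<Sum>i\<le>n. a i * b (n - i)\<bar> * q ^ n)"
      by (rule summable_comparison_test'[OF sums_summable[OF s]]) (use le q in \<open>auto simp: abs_mult\<close>)
    have "(\<Sum>n. \<bar>\<Sum>i\<le>n. a i * b (n - i)\<bar> * q ^ n) \<le> (\<Sum>n. \<bar>a n\<bar> * q ^ n) * (\<Sum>n. \<bar>b n\<bar> * q ^ n)"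
      using suminf_le[OF le s' sums_summable[OF s]] s by (simp add: sums_iff)
    also have "\<dots> \<le> (M / (1 - q) ^ k) * (N / (1 - q) ^ l)"
    proof (intro mult_mono M N q suminf_nonneg)
      show "0 \<le> M / (1 - q) ^ k"
        by (rule order_trans[OF suminf_nonneg[OF M(2)[OF q]] M(3)[OF q]]) (use q in auto)
    qed (use q in auto)
    finally show "(\<Sum>n. \<bar>\<Sum>i\<le>n. a i * b (n - i)\<bar> * q ^ n) \<le> M * N / (1 - q) ^ (k + l)"
      by (simp add: power_add)
  qed
qed

lemma growth_series_cmult:
  assumes "growth_series k f a"
  shows   "growth_series k (\<lambda>q. c * f q) (\<lambda>n. c * a n)"
proof -
  obtain M where
    M: "\<And>q. 0 < q \<Longrightarrow> q < 1 \<Longrightarrow> (\<lambda>n. a n * q ^ n) sums f q"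
       "\<And>q. 0 < q \<Longrightarrow> q < 1 \<Longrightarrow> summable (\<lambda>n. \<bar>a n\<bar> * q ^ n)"
       "\<And>q. 0 < q \<Longrightarrow> q < 1 \<Longrightarrow> (\<Sum>n. \<bar>a n\<bar> * q ^ n) \<le> M / (1 - q) ^ k"
    by (rule growth_seriesE[OF assms]) blast
  show ?thesis unfolding growth_series_def
  proof (intro exI[of _ "\<bar>c\<bar> * M"] allI impI conjI)
    fix q :: real assume q: "0 < q" "q < 1"
    show "(\<lambda>n. c * a n * q ^ n) sums (c * f q)"
      using sums_mult[OF M(1)[OF q], of c] by (simp add: mult.assoc)
    show "summable (\<lambda>n. \<bar>c * a n\<bar> * q ^ n)"
      using summable_mult[OF M(2)[OF q], of "\<bar>c\<bar>"] by (simp add: abs_mult mult.assoc)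
    have "(\<Sum>n. \<bar>c * a n\<bar> * q ^ n) = \<bar>c\<bar> * (\<Sum>n. \<bar>a n\<bar> * q ^ n)"
      using suminf_mult[OF M(2)[OF q], of "\<bar>c\<bar>"] by (simp add: abs_mult mult.assoc)
    also have "\<dots> \<le> \<bar>c\<bar> * (M / (1 - q) ^ k)" by (intro mult_left_mono M q) auto
    finally show "(\<Sum>n. \<bar>c * a n\<bar> * q ^ n) \<le> \<bar>c\<bar> * M / (1 - q) ^ k" by simp
  qed
qed

lemma growth_series_cube:
  assumes "growth_series k f a"
  shows   "growth_series k (\<lambda>q. f (q ^ 3)) (\<lambda>n. if 3 dvd n then a (n div 3) else 0)"
proof -
  obtain M where
    M: "\<And>q. 0 < q \<Longrightarrow> q < 1 \<Longrightarrow> (\<lambda>n. a n * q ^ n) sums f q"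
       "\<And>q. 0 < q \<Longrightarrow> q < 1 \<Longrightarrow> summable (\<lambda>n. \<bar>a n\<bar> * q ^ n)"
       "\<And>q. 0 < q \<Longrightarrow> q < 1 \<Longrightarrow> (\<Sum>n. \<bar>a n\<bar> * q ^ n) \<le> M / (1 - q) ^ k"
    by (rule growth_seriesE[OF assms]) blast
  have M0: "0 \<le> M"
  proof -
    have "0 \<le> (\<Sum>n. \<bar>a n\<bar> * (1/2) ^ n)" by (intro suminf_nonneg M) auto
    also have "\<dots> \<le> M / (1 - 1/2) ^ k" by (rule M) auto
    finally show ?thesis by (simp add: zero_le_divide_iff power_le_zero_eq)
  qed
  have reindex: "(\<lambda>n. (if 3 dvd n then b (n div 3) else 0) * q ^ n) sums s \<longleftrightarrow> (\<lambda>n. b n * (q ^ 3) ^ n) sums s"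
    for b :: "nat \<Rightarrow> real" and q s
  proof -
    have "(\<lambda>n. (if 3 dvd 3 * n then b (3 * n div 3) else 0) * q ^ (3 * n)) sums s \<longleftrightarrow>
          (\<lambda>n. (if 3 dvd n then b (n div 3) else 0) * q ^ n) sums s"
      by (rule sums_mono_reindex[of "\<lambda>n. 3 * n"]) (auto simp: strict_mono_def)
    thus ?thesis by (simp add: power_mult)
  qed
  show ?thesis unfolding growth_series_def
  proof (intro exI[of _ M] allI impI conjI)
    fix q :: real assume q: "0 < q" "q < 1"
    hence q3: "0 < q ^ 3" "q ^ 3 < 1" by (auto simp: power_less_one_iff)
    show "(\<lambda>n. (if 3 dvd n then a (n div 3) else 0) * q ^ n) sums f (q ^ 3)"
      unfolding reindex by (rule M(1)[OF q3])
    have "(\<lambda>n. (if 3 dvd n then \<bar>a (n div 3)\<bar> else 0) * q ^ n) sums (\<Sum>n. \<bar>a n\<bar> * (q ^ 3) ^ n)"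
      by (subst reindex[of "\<lambda>n. \<bar>a n\<bar>"]) (rule summable_sums[OF M(2)[OF q3]])
    moreover have "(\<lambda>n. (if 3 dvd n then \<bar>a (n div 3)\<bar> else 0) * q ^ n) =
                   (\<lambda>n. \<bar>if 3 dvd n then a (n div 3) else 0\<bar> * q ^ n)" by auto
    ultimately have s: "(\<lambda>n. \<bar>if 3 dvd n then a (n div 3) else 0\<bar> * q ^ n) sums
        (\<Sum>n. \<bar>a n\<bar> * (q ^ 3) ^ n)" by simp
    thus "summable (\<lambda>n. \<bar>if 3 dvd n then a (n div 3) else 0\<bar> * q ^ n)" by (rule sums_summable)
    have "(\<Sum>n. \<bar>if 3 dvd n then a (n div 3) else 0\<bar> * q ^ n) = (\<Sum>n. \<bar>a n\<bar> * (q ^ 3) ^ n)"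
      using s by (simp add: sums_iff)
    also have "\<dots> \<le> M / (1 - q ^ 3) ^ k" by (rule M(3)[OF q3])
    also have "\<dots> \<le> M / (1 - q) ^ k"
    proof (intro divide_left_mono power_mono)
      have "q ^ 3 \<le> q ^ 1" using q by (intro power_decreasing) auto
      thus "1 - q \<le> 1 - q ^ 3" by simp
    qed (use M0 q q3 in auto)
    finally show "(\<Sum>n. \<bar>if 3 dvd n then a (n div 3) else 0\<bar> * q ^ n) \<le> M / (1 - q) ^ k" .
  qed
qed

section \<open>The modular parameter\<close>

definition thX' :: "real \<Rightarrow> real" where
  "thX' x = (\<Sum>n. diffs (eis_count (eis_class 0)) n * x ^ n)"
definition thY' :: "real \<Rightarrow> real" where
  "thY' x = (\<Sum>n. diffs (eis_count (eis_class 1)) n * x ^ n)"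

lemma summable_eis_count: "\<bar>x\<bar> < 1 \<Longrightarrow> summable (\<lambda>n. eis_count S n * x ^ n)"
  by (rule summable_comparison_test'[OF sums_summable[OF eis_theta_sums[of "\<bar>x\<bar>" S]]])
     (auto simp: abs_mult power_abs eis_count_nonneg)

lemma summable_diffs_eis_count: "\<bar>x\<bar> < 1 \<Longrightarrow> summable (\<lambda>n. diffs (eis_count S) n * x ^ n)"
  by (rule termdiff_converges[of _ 1]) (auto intro: summable_eis_count)

lemma eis_theta_deriv:
  assumes "0 < q" "q < 1"
  shows "(eis_theta S has_field_derivative (\<Sum>n. diffs (eis_count S) n * q ^ n)) (at q)"
proof -
  have "((\<lambda>q. \<Sum>n. eis_count S n * q ^ n) has_field_derivative (\<Sum>n. diffs (eis_count S) n * q ^ n)) (at q)"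
    by (rule termdiffs_strong'[of 1]) (use assms summable_eis_count in auto)
  thus ?thesis
  proof (rule has_field_derivative_transform_within_open)
    show "(\<Sum>n. eis_count S n * x ^ n) = eis_theta S x" if "x \<in> {0<..<1}" for x
      using eis_theta_sums[of x S] that by (auto dest!: sums_unique)
  qed (use assms in auto)
qed

lemmas thX_deriv = eis_theta_deriv[of _ "eis_class 0", folded thX_def thX'_def]
lemmas thY_deriv = eis_theta_deriv[of _ "eis_class 1", folded thY_def thY'_def]

lemma eis_count_X_0: "eis_count (eis_class 0) 0 = 1"
proof -
  have "{p \<in> eis_class 0. eis_norm p = 0} = {(0, 0)}" by (auto simp: eis_norm_eq_0_iff eis_class_def)
  thus ?thesis by (simp add: eis_count_def)
qed

lemma eis_count_Y_0: "eis_count (eis_class 1) 0 = 0"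
proof -
  have "{p \<in> eis_class 1. eis_norm p = 0} = {}" by (auto simp: eis_norm_eq_0_iff eis_class_def)
  thus ?thesis by (simp only: eis_count_def card.empty of_nat_0)
qed

lemma eis_count_Y_1: "0 < eis_count (eis_class 1) 1"
proof -
  have "(1, 0) \<in> {p \<in> eis_class 1. eis_norm p = 1}" by (auto simp: eis_norm_def eis_class_def)
  hence "0 < card {p \<in> eis_class 1. eis_norm p = 1}"
    using finite_eis_norm card_gt_0_iff by blast
  thus ?thesis by (simp add: eis_count_def)
qed

lemma thX_ge_1: "0 \<le> q \<Longrightarrow> q < 1 \<Longrightarrow> 1 \<le> thX q"
  using sum_le_suminf[OF summable_eis_count, of q "{0}" "eis_class 0"] eis_theta_sums[of q "eis_class 0"]
  by (simp add: thX_def eis_count_nonneg eis_count_X_0 sums_iff)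

lemma thY_pos: assumes "0 < q" "q < 1" shows "0 < thY q"
proof -
  have "0 < eis_count (eis_class 1) 1 * q ^ 1" using eis_count_Y_1 assms by simp
  also have "\<dots> = (\<Sum>n\<in>{1}. eis_count (eis_class 1) n * q ^ n)" by simp
  also have "\<dots> \<le> (\<Sum>n. eis_count (eis_class 1) n * q ^ n)"
    by (rule sum_le_suminf) (use assms summable_eis_count eis_count_nonneg in auto)
  also have "\<dots> = thY q" using eis_theta_sums[of q "eis_class 1"] assms by (simp add: thY_def sums_iff)
  finally show ?thesis .
qed

section \<open>Comparison of functions along iterated cubes\<close>

lemma cube_iterates_tendsto:
  fixes q :: real assumes "0 < q" "q < 1"
  shows "(\<lambda>k. q ^ (3 ^ k)) \<longlonglongrightarrow> 0"
proof -
  have "strict_mono (\<lambda>k. (3::nat) ^ k)" by (auto simp: strict_mono_def)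
  from LIMSEQ_subseq_LIMSEQ[OF LIMSEQ_power_zero[of q] this] show ?thesis
    using assms by (simp add: o_def)
qed

text \<open>An invariant function has the same value at q and at all its iterated cubes, which tend
  to 0. The second function g extends h continuously to 0, where h itself may read 0 / 0.\<close>

lemma cube_invariant_eq:
  fixes h g :: "real \<Rightarrow> real"
  assumes inv: "\<And>q. 0 < q \<Longrightarrow> q < 1 \<Longrightarrow> h q = h (q ^ 3)"
    and eq: "\<And>q. 0 < q \<Longrightarrow> q < 1 \<Longrightarrow> h q = g q"
    and cont: "isCont g 0" and q: "0 < q" "q < 1"
  shows "h q = g 0"
proof -
  have pos: "0 < q ^ (3 ^ k)" "q ^ (3 ^ k) < 1" for k
    using q by (auto simp: power_less_one_iff)
  have "h (q ^ (3 ^ k)) = h q" for k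
  proof (induction k)
    case (Suc k)
    have "h (q ^ (3 ^ Suc k)) = h ((q ^ (3 ^ k)) ^ 3)"
      by (simp add: power_mult [symmetric] mult.commute)
    also have "\<dots> = h (q ^ (3 ^ k))" using inv[OF pos] by simp
    finally show ?case using Suc by simp
  qed simp
  hence "(\<lambda>k. g (q ^ (3 ^ k))) = (\<lambda>k. h q)" using eq[OF pos] by simp
  moreover have "(\<lambda>k. g (q ^ (3 ^ k))) \<longlonglongrightarrow> g 0"
    using isCont_tendsto_compose[OF cont cube_iterates_tendsto[OF q]] .
  ultimately show ?thesis using LIMSEQ_const_iff by metis
qed

lemma thXY_cubes:
  assumes "0 \<le> q" "q < 1"
  shows "thX q ^ 3 - thY q ^ 3 = (thX (q ^ 3) - thY (q ^ 3)) ^ 3"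
  unfolding thX_cube[OF assms] thY_cube[OF assms]
  by (simp add: power2_eq_square power3_eq_cube algebra_simps)

text \<open>Continuity at 0 is two-sided, whereas the identities for \<open>thX\<close> and
  \<open>thY\<close> are stated for nonnegative arguments; the power series bridge this.
  \<open>powY1\<close> divides out the simple zero of \<open>thY\<close> at 0.\<close>

definition powX :: "real \<Rightarrow> real" where "powX x = (\<Sum>n. eis_count (eis_class 0) n * x ^ n)"
definition powY1 :: "real \<Rightarrow> real" where "powY1 x = (\<Sum>n. eis_count (eis_class 1) (Suc n) * x ^ n)"

lemma powX_eq: "0 \<le> q \<Longrightarrow> q < 1 \<Longrightarrow> thX q = powX q"
  using eis_theta_sums[of q "eis_class 0"] by (simp add: thX_def powX_def sums_iff)

lemma powY1_eq: assumes "0 \<le> q" "q < 1" shows "thY q = q * powY1 q"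
proof -
  have s: "(\<lambda>n. eis_count (eis_class 1) n * q ^ n) sums thY q"
    unfolding thY_def by (rule eis_theta_sums[OF assms])
  have "(\<lambda>n. eis_count (eis_class 1) (Suc n) * q ^ Suc n) sums thY q"
    using s by (subst sums_Suc_iff) (simp add: eis_count_Y_0)
  hence "thY q = (\<Sum>n. q * (eis_count (eis_class 1) (Suc n) * q ^ n))"
    by (simp add: sums_iff mult_ac)
  also have "\<dots> = q * powY1 q" unfolding powY1_def
  proof (rule suminf_mult)
    show "summable (\<lambda>n. eis_count (eis_class 1) (Suc n) * q ^ n)"
    proof (cases "q = 0")
      case False
      have "summable (\<lambda>n. eis_count (eis_class 1) (Suc n) * q ^ Suc n / q)"
        by (intro summable_divide, subst summable_Suc_iff) (use assms summable_eis_count in auto)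
      thus ?thesis using False by simp
    qed simp
  qed
  finally show ?thesis .
qed

lemma isCont_powX: "isCont powX 0"
  unfolding powX_def[abs_def]
  by (rule isCont_powser[of _ "1/2"]) (auto intro: summable_eis_count)

lemma isCont_powY1: "isCont powY1 0"
  unfolding powY1_def[abs_def]
proof (rule isCont_powser[of _ "1/2"])
  have "summable (\<lambda>n. eis_count (eis_class 1) (Suc n) * (1/2) ^ Suc n * 2)"
    by (intro summable_mult2, subst summable_Suc_iff) (auto intro: summable_eis_count)
  thus "summable (\<lambda>n. eis_count (eis_class 1) (Suc n) * (1/2::real) ^ n)" by simp
qed auto

lemma isCont_thX': "isCont thX' 0"
  unfolding thX'_def[abs_def]
  by (rule isCont_powser[of _ "1/2"]) (auto intro: summable_diffs_eis_count)

lemma isCont_thY': "isCont thY' 0"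
  unfolding thY'_def[abs_def]
  by (rule isCont_powser[of _ "1/2"]) (auto intro: summable_diffs_eis_count)

lemma powX_0: "powX 0 = 1"
  unfolding powX_def by (simp add: eis_count_X_0)

lemma powY1_0: "powY1 0 = thY' 0" "powY1 0 > 0"
  using eis_count_Y_1 unfolding powY1_def thY'_def by (simp_all add: diffs_def)

text \<open>By \<open>thXY_cubes\<close> the inequality passes from \<open>q ^ 3\<close> to q. It
  holds at some iterated cube because there X tends to 1 and Y to 0.\<close>

lemma thY_less_thX:
  assumes q: "0 < q" "q < 1"
  shows "thY q < thX q"
proof -
  have pos: "0 < q ^ (3 ^ k)" "q ^ (3 ^ k) < 1" for k
    using q by (auto simp: power_less_one_iff)
  have step: "thY q < thX q" if "thY (q ^ 3) < thX (q ^ 3)" "0 < q" "q < 1" for q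
  proof -
    have "0 < (thX (q ^ 3) - thY (q ^ 3)) ^ 3" using that by simp
    hence "0 < thX q ^ 3 - thY q ^ 3" using thXY_cubes[of q] that(2,3) by simp
    hence "thY q ^ 3 < thX q ^ 3" by linarith
    thus ?thesis by (rule power_less_imp_less_base) (use thX_ge_1[of q] that in auto)
  qed
  have down: "thY (q ^ (3 ^ k)) < thX (q ^ (3 ^ k)) \<Longrightarrow> thY q < thX q" for k
  proof (induction k)
    case (Suc k)
    have "q ^ (3 ^ Suc k) = (q ^ (3 ^ k)) ^ 3" by (simp add: power_mult [symmetric] mult.commute)
    with Suc step[OF _ pos] show ?case by metis
  qed simp
  have "isCont (\<lambda>x. powX x - x * powY1 x) 0"
    by (intro continuous_intros isCont_powX isCont_powY1)
  from isCont_tendsto_compose[OF this cube_iterates_tendsto[OF q]]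
  have "(\<lambda>k. powX (q ^ (3 ^ k)) - q ^ (3 ^ k) * powY1 (q ^ (3 ^ k))) \<longlonglongrightarrow> 1"
    by (simp add: powX_0)
  from order_tendstoD(1)[OF this, of 0]
  have "eventually (\<lambda>k. powX (q ^ (3 ^ k)) - q ^ (3 ^ k) * powY1 (q ^ (3 ^ k)) > 0) sequentially" by simp
  then obtain k where "powX (q ^ (3 ^ k)) - q ^ (3 ^ k) * powY1 (q ^ (3 ^ k)) > 0"
    by (auto simp: eventually_at_top_linorder)
  hence "thY (q ^ (3 ^ k)) < thX (q ^ (3 ^ k))"
    using powX_eq[of "q ^ (3 ^ k)"] powY1_eq[of "q ^ (3 ^ k)"] pos[of k] by simp
  thus ?thesis by (rule down)
qed

definition thU :: "real \<Rightarrow> real" where "thU q = thY q / thX q"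
definition thU' :: "real \<Rightarrow> real" where "thU' q = (thY' q * thX q - thY q * thX' q) / thX q ^ 2"

lemma thU_bounds: assumes "0 < q" "q < 1" shows "0 < thU q" "thU q < 1"
  using thY_pos[OF assms] thX_ge_1[of q] thY_less_thX[OF assms] assms by (auto simp: thU_def)

lemma thU_deriv':
  assumes "0 < q" "q < 1"
  shows "(thU has_field_derivative thU' q) (at q)"
  unfolding thU_def[abs_def] thU'_def
  using thX_deriv[OF assms] thY_deriv[OF assms] thX_ge_1[of q] assms
  by (auto intro!: derivative_eq_intros simp: power2_eq_square)

lemma thX_cube': assumes "0 < q" "q < 1" shows "thX q = thX (q ^ 3) * (1 + 2 * thU (q ^ 3))"
proof -
  have "thX (q ^ 3) \<noteq> 0" using thX_ge_1[of "q ^ 3"] assms by (auto simp: power_less_one_iff)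
  thus ?thesis using thX_cube[of q] assms by (simp add: thU_def field_simps)
qed

lemma thU_cube:
  assumes "0 < q" "q < 1"
  shows "thU q ^ 3 = cubic_phi (thU (q ^ 3))"
proof -
  have q3: "0 < q ^ 3" "q ^ 3 < 1" using assms by (auto simp: power_less_one_iff)
  have X: "thX (q ^ 3) > 0" "thX q > 0" using thX_ge_1[of "q ^ 3"] thX_ge_1[of q] q3 assms by auto
  have "1 - thU q ^ 3 = (thX q ^ 3 - thY q ^ 3) / thX q ^ 3"
    using X by (simp add: thU_def power_divide diff_divide_distrib)
  also have "\<dots> = ((thX (q ^ 3) - thY (q ^ 3)) / thX q) ^ 3"
    using thXY_cubes[of q] assms by (simp add: power_divide)
  also have "(thX (q ^ 3) - thY (q ^ 3)) / thX q = (1 - thU (q ^ 3)) / (1 + 2 * thU (q ^ 3))"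
    unfolding thX_cube'[OF assms] using X by (simp add: thU_def diff_divide_distrib)
  finally show ?thesis unfolding cubic_phi_def by simp
qed

text \<open>Going from \<open>q ^ 3\<close> to q multiplies both sides by the same factor
  \<open>1 + 2 * thU (q ^ 3)\<close>: the left by \<open>thX_cube'\<close>, the right by the cubic
  transformation at u = \<open>thU (q ^ 3)\<close>.\<close>

lemma thX_eq_cubic_F:
  assumes "0 < q" "q < 1"
  shows "thX q = cubic_F (thU q ^ 3)"
proof -
  have U3: "0 \<le> thU q ^ 3" "thU q ^ 3 < 1" if "0 < q" "q < 1" for q
    using thU_bounds[OF that] by (auto simp: power_less_one_iff)
  define g where "g x = powX x / cubic_F ((x * powY1 x / powX x) ^ 3)" for x
  have "thX q / cubic_F (thU q ^ 3) = g 0"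
  proof (rule cube_invariant_eq[where h = "\<lambda>q. thX q / cubic_F (thU q ^ 3)" and g = g])
    fix q :: real assume q: "0 < q" "q < 1"
    have q3: "0 < q ^ 3" "q ^ 3 < 1" using q by (auto simp: power_less_one_iff)
    have "cubic_F (thU q ^ 3) = (1 + 2 * thU (q ^ 3)) * cubic_F (thU (q ^ 3) ^ 3)"
      unfolding thU_cube[OF q] using thU_bounds[OF q3] by (intro cubic_F_transformation) auto
    thus "thX q / cubic_F (thU q ^ 3) = thX (q ^ 3) / cubic_F (thU (q ^ 3) ^ 3)"
      unfolding thX_cube'[OF q] using thU_bounds[OF q3] by simp
    show "thX q / cubic_F (thU q ^ 3) = g q"
      using q by (simp add: g_def thU_def powX_eq powY1_eq)
  next
    have "isCont (\<lambda>x. cubic_F ((x * powY1 x / powX x) ^ 3)) 0"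
      by (rule isCont_o2[where g = cubic_F])
         (auto intro!: continuous_intros isCont_powX isCont_powY1 DERIV_isCont[OF cubic_F_deriv] simp: powX_0)
    thus "isCont g 0" unfolding g_def[abs_def]
      by (intro continuous_intros isCont_powX) (auto simp: cubic_F_def powX_0)
  qed (use assms in auto)
  also have "g 0 = 1" by (simp add: g_def powX_0 cubic_F_def)
  finally show ?thesis using cubic_F_ge_1[OF U3[OF assms]] by simp
qed

text \<open>
  The ratio of the two sides is invariant under \<open>q \<mapsto> q\<^sup>3\<close> and tends to 1 at 0.
\<close>
lemma thU_ode:
  assumes "0 < q" "q < 1"
  shows "q * thU' q = thU q * (1 - thU q ^ 3) * thX q ^ 2"
proof -
  define W where "W q = q * thU' q / (thU q * (1 - thU q ^ 3) * thX q ^ 2)" for q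
  \<comment> \<open>W written with the logarithmic derivative q U'/U = q Y'/Y - q X'/X. With Y = q
    \<open>powY1\<close> the first summand is \<open>thY' / powY1\<close>, which is regular at 0
    with value 1.\<close>
  define g where "g x = (thY' x / powY1 x - x * thX' x / powX x) /
      ((1 - (x * powY1 x / powX x) ^ 3) * powX x ^ 2)" for x
  have nz: "thU q * (1 - thU q ^ 3) * thX q ^ 2 \<noteq> 0" "1 - thU q ^ 3 > 0" "thX q > 0" "thU q > 0"
    if "0 < q" "q < 1" for q
  proof -
    have "thU q ^ 3 < 1" using thU_bounds[OF that] by (simp add: power_less_one_iff)
    thus "thU q * (1 - thU q ^ 3) * thX q ^ 2 \<noteq> 0" "1 - thU q ^ 3 > 0" "thX q > 0" "thU q > 0"
      using thU_bounds[OF that] thX_ge_1[of q] that by auto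
  qed
  have "W q = g 0"
  proof (rule cube_invariant_eq[where h = W and g = g])
    fix q :: real assume q: "0 < q" "q < 1"
    have q3: "0 < q ^ 3" "q ^ 3 < 1" using q by (auto simp: power_less_one_iff)
    define V v D where "V = thU (q ^ 3)" and "v = thU' (q ^ 3)" and "D = 9 * (1 - V) ^ 2 / (1 + 2 * V) ^ 4"
    note V = thU_bounds[OF q3, folded V_def]
    have "((\<lambda>q. cubic_phi (thU (q ^ 3))) has_field_derivative D * (v * (3 * q ^ 2))) (at q)"
    proof (rule DERIV_chain2[where f = cubic_phi and g = "\<lambda>q. thU (q ^ 3)"])
      show "(cubic_phi has_field_derivative D) (at (thU (q ^ 3)))"
        unfolding D_def V_def using thU_bounds[OF q3] by (intro cubic_phi_deriv) auto
      show "((\<lambda>q. thU (q ^ 3)) has_field_derivative v * (3 * q ^ 2)) (at q)"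
        unfolding v_def
        by (rule DERIV_chain2[where f = thU and g = "\<lambda>q. q ^ 3"])
           (auto intro!: derivative_eq_intros thU_deriv' q3)
    qed
    hence "((\<lambda>q. thU q ^ 3) has_field_derivative D * (v * (3 * q ^ 2))) (at q)"
      by (rule has_field_derivative_transform_within_open[where S = "{0<..<1}"])
         (use q in \<open>auto simp: thU_cube\<close>)
    moreover have "((\<lambda>q. thU q ^ 3) has_field_derivative 3 * thU q ^ 2 * thU' q) (at q)"
      using thU_deriv'[OF q] by (auto intro!: derivative_eq_intros)
    ultimately have *: "thU q ^ 2 * thU' q = D * v * q ^ 2"
      by (auto dest: DERIV_unique)
    \<comment> \<open>Multiplying through by U^2 produces the derivative of U^3 above and U^3 =
      \<open>cubic_phi V\<close> below, so that W at q depends only on data at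
      \<open>q ^ 3\<close>.\<close>
    have "W q = q * (thU q ^ 2 * thU' q) / (thU q ^ 3 * (1 - thU q ^ 3) * thX q ^ 2)"
      unfolding W_def using nz[OF q] by (simp add: power2_eq_square power3_eq_cube)
    also have "\<dots> = q ^ 3 * v * D / ((cubic_phi V * (1 - cubic_phi V)) * thX q ^ 2)"
      unfolding * thU_cube[OF q] V_def by (simp add: power2_eq_square power3_eq_cube mult_ac)
    also have "thX q ^ 2 = (1 + 2 * V) ^ 2 * thX (q ^ 3) ^ 2"
      unfolding thX_cube'[OF q] V_def by (simp add: power_mult_distrib)
    also have "(cubic_phi V * (1 - cubic_phi V)) * ((1 + 2 * V) ^ 2 * thX (q ^ 3) ^ 2) =
        (V * (1 - V ^ 3) * thX (q ^ 3) ^ 2) * D"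
    proof -
      have id: "V * (1 - V ^ 3) * D = (1 + 2 * V) ^ 2 * (cubic_phi V * (1 - cubic_phi V))"
        unfolding D_def using V by (intro cubic_phi_identity) auto
      have "(cubic_phi V * (1 - cubic_phi V)) * ((1 + 2 * V) ^ 2 * thX (q ^ 3) ^ 2) =
            ((1 + 2 * V) ^ 2 * (cubic_phi V * (1 - cubic_phi V))) * thX (q ^ 3) ^ 2"
        by (simp only: mult_ac)
      thus ?thesis unfolding id [symmetric] by (simp only: mult_ac)
    qed
    also have "q ^ 3 * v * D / \<dots> = W (q ^ 3)"
      using V by (simp add: W_def V_def v_def D_def)
    finally show "W q = W (q ^ 3)" .
    have *: "thU' q / thU q = thY' q / thY q - thX' q / thX q"
      using nz[OF q] thY_pos[OF q] by (simp add: thU'_def thU_def field_simps power2_eq_square)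
    have "W q = q * (thY' q / thY q - thX' q / thX q) / ((1 - thU q ^ 3) * thX q ^ 2)"
      unfolding W_def * [symmetric] by simp
    thus "W q = g q"
      using q by (simp add: g_def thU_def powX_eq powY1_eq right_diff_distrib)
  next
    show "isCont g 0" unfolding g_def[abs_def] using powY1_0
      by (intro continuous_intros isCont_powX isCont_powY1 isCont_thX' isCont_thY') (auto simp: powX_0)
  qed (use assms in auto)
  also have "g 0 = 1" using powY1_0 by (simp add: g_def powX_0)
  finally show ?thesis using nz(1)[OF assms] by (simp add: W_def)
qed

section \<open>Behaviour near the cusp q = 1\<close>

definition thZ :: "real \<Rightarrow> real" where "thZ q = thX (q ^ 3) - thY (q ^ 3)"

lemma thZ_pos: "0 < q \<Longrightarrow> q < 1 \<Longrightarrow> 0 < thZ q"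
  using thY_less_thX[of "q ^ 3"] by (simp add: thZ_def power_less_one_iff)

lemma thZ_cubed:
  assumes "0 < q" "q < 1" shows "thZ q ^ 3 = thX q ^ 3 * (1 - thU q ^ 3)"
proof -
  have "thX q ^ 3 * (1 - thU q ^ 3) = thX q ^ 3 - thY q ^ 3"
    using thX_ge_1[of q] assms by (simp add: thU_def right_diff_distrib power_divide)
  thus ?thesis using thXY_cubes[of q] assms by (simp add: thZ_def)
qed

lemma thZ_eq:
  assumes "0 < q" "q < 1" shows "thZ q = thX q * (1 - thU q ^ 3) powr (1/3)"
proof -
  have y: "0 < 1 - thU q ^ 3" using thU_bounds[OF assms] by (simp add: power_less_one_iff)
  have "thZ q = (thZ q ^ 3) powr (1/3)"
    using thZ_pos[OF assms] by (simp add: powr_powr flip: powr_numeral)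
  also have "\<dots> = (thX q ^ 3) powr (1/3) * (1 - thU q ^ 3) powr (1/3)"
    unfolding thZ_cubed[OF assms] by (rule powr_mult)
  also have "(thX q ^ 3) powr (1/3) = thX q"
    using thX_ge_1[of q] assms by (simp add: powr_powr flip: powr_numeral)
  finally show ?thesis .
qed

text \<open>With N about 1 / sqrt t, the (N + 1)^2 lattice points of the square P have norm at most
  3 N^2. In base \<open>exp (- t) ^ 3\<close> each of them contributes at least exp (- 9 N^2 t),
  hence at least exp (- 9).\<close>

lemma thX_lower:
  assumes "0 < t" shows "exp (- 9) / t \<le> thX (exp (- t))"
proof -
  define N where "N = nat \<lfloor>1 / sqrt t\<rfloor>"
  have N: "real N \<le> 1 / sqrt t" "1 / sqrt t < real N + 1"
    using assms unfolding N_def by (simp_all, linarith?)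
  define P where "P = {0..int N} \<times> {0..int N}"
  define q where "q = exp (- t) ^ 3"
  have q: "0 \<le> q" "q < 1" using assms by (auto simp: q_def power_less_one_iff)
  have "real N ^ 2 \<le> (1 / sqrt t) ^ 2" using N by (intro power_mono) auto
  hence N2: "real N ^ 2 * t \<le> 1" using assms by (simp add: power_divide field_simps)
  have "(1 / sqrt t) ^ 2 \<le> (real N + 1) ^ 2" using N assms by (intro power_mono) auto
  hence N3: "1 / t \<le> (real N + 1) ^ 2" using assms by (simp add: power_divide)
  have "exp (- 9) / t = exp (- 9) * (1 / t)" by simp
  also have "\<dots> \<le> exp (- 9) * (real N + 1) ^ 2" using N3 by (intro mult_left_mono) auto
  also have "\<dots> = (\<Sum>p\<in>P. exp (- 9))"
    by (simp add: P_def power2_eq_square card_cartesian_product add.commute)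
  also have "\<dots> \<le> (\<Sum>p\<in>P. q ^ eis_norm p)"
  proof (rule sum_mono)
    fix p assume "p \<in> P"
    hence p: "0 \<le> fst p" "fst p \<le> int N" "0 \<le> snd p" "snd p \<le> int N" by (auto simp: P_def)
    have "int (eis_norm p) \<le> int N ^ 2 + int N * int N + int N ^ 2"
      unfolding int_eis_norm using p by (intro add_mono power_mono mult_mono) auto
    hence "int (eis_norm p) \<le> int (3 * N ^ 2)" by (simp add: power2_eq_square)
    hence "eis_norm p \<le> 3 * N ^ 2" by linarith
    hence "q ^ (3 * N ^ 2) \<le> q ^ eis_norm p" using q by (intro power_decreasing) auto
    moreover have "q ^ (3 * N ^ 2) = exp (- 9 * (real N ^ 2 * t))"
      by (simp add: q_def power_mult [symmetric] exp_of_nat_mult [symmetric])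
    moreover have "exp (- 9) \<le> exp (- 9 * (real N ^ 2 * t))" using N2 by simp
    ultimately show "exp (- 9) \<le> q ^ eis_norm p" by linarith
  qed
  also have "\<dots> \<le> eis_theta UNIV q" unfolding eis_theta_def
    by (rule finite_sum_le_infsum) (use q eis_summable in \<open>auto simp: P_def\<close>)
  also have "\<dots> = thX (exp (- t))" unfolding q_def by (rule thX_eq_UNIV [symmetric])
  finally show ?thesis .
qed

text \<open>The range reaches 3 so that the bound also covers \<open>exp (- t) ^ 3\<close> for t up
  to 1. On it t / (1 + t) is at least t / 4, which accounts for the constant 8 = 2 * 4.\<close>

lemma thX_upper:
  assumes "0 < t" "t \<le> 3" shows "thX (exp (- t)) \<le> 8 * (1 + pi) ^ 2 / t"
proof -
  have "exp (- t) \<le> 1 / (1 + t)"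
    using exp_ge_add_one_self[of t] assms by (simp add: exp_minus field_simps)
  hence "t / (1 + t) \<le> 1 - exp (- t)" using assms by (simp add: field_simps)
  moreover have "t / 4 \<le> t / (1 + t)" using assms by (intro divide_left_mono) auto
  ultimately have *: "t / 4 \<le> 1 - exp (- t)" by linarith
  have "thX (exp (- t)) \<le> 2 * (1 + pi) ^ 2 / (1 - exp (- t))"
    unfolding thX_def using assms by (intro eis_theta_le) auto
  also have "\<dots> \<le> 2 * (1 + pi) ^ 2 / (t / 4)"
    using * assms by (intro divide_left_mono) auto
  finally show ?thesis by simp
qed

definition expU :: "real \<Rightarrow> real" where "expU t = thU (exp (- t))"

lemma expU_bounds: "0 < t \<Longrightarrow> 0 < expU t" "0 < t \<Longrightarrow> expU t < 1"
  using thU_bounds[of "exp (- t)"] by (simp_all add: expU_def)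

lemma expU_deriv:
  assumes "0 < t"
  shows "(expU has_field_derivative - (expU t * (1 - expU t ^ 3) * thX (exp (- t)) ^ 2)) (at t)"
proof -
  have q: "0 < exp (- t)" "exp (- t) < 1" using assms by auto
  have "((\<lambda>t. thU (exp (- t))) has_field_derivative thU' (exp (- t)) * (- exp (- t))) (at t)"
    by (rule DERIV_chain2[where f = thU and g = "\<lambda>t. exp (- t)"])
       (auto intro!: derivative_eq_intros thU_deriv' simp: assms)
  thus ?thesis using thU_ode[OF q] by (simp add: expU_def[abs_def] mult.commute)
qed

lemma expU_decreasing:
  assumes "0 < s" "s < t" shows "expU t < expU s"
proof (rule DERIV_neg_imp_decreasing[OF assms(2)])
  fix x assume "s \<le> x" "x \<le> t"
  hence x: "0 < x" using assms by simp
  have "0 < expU x * (1 - expU x ^ 3) * thX (exp (- x)) ^ 2"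
    using expU_bounds[OF x] thX_ge_1[of "exp (- x)"] x
    by (intro mult_pos_pos zero_less_power) (auto simp: power_less_one_iff)
  thus "\<exists>y. DERIV expU x :> y \<and> y < 0" using expU_deriv[OF x] by (intro exI conjI) auto
qed

text \<open>
  By \<open>thU_ode\<close>, \<open>ln (1 - expU\<^sup>3)\<close> grows at least like \<open>- \<delta> / t\<close> because \<open>thX\<close> is at least
  of order \<open>1 / t\<close>; no modular transformation is needed.
\<close>
lemma one_minus_expU_cube_decay:
  "\<exists>C d. 0 < C \<and> 0 < d \<and> (\<forall>t. 0 < t \<longrightarrow> t \<le> 3 \<longrightarrow> 1 - expU t ^ 3 \<le> C * exp (- d / t))"
proof -
  \<comment> \<open>The derivative of ln (1 - U^3) is 3 U^3 X^2. On (0, 3] it is at least d / t^2,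
    because U is decreasing and X is at least exp (- 9) / t. Thus adding d / t still leaves a
    nondecreasing function.\<close>
  define d where "d = 3 * expU 3 ^ 3 * exp (- 9) ^ 2"
  have d: "0 < d" unfolding d_def using expU_bounds[of 3] by simp
  define g where "g t = ln (1 - expU t ^ 3) + d / t" for t
  have y: "0 < 1 - expU t ^ 3" if "0 < t" for t
    using expU_bounds[OF that] by (simp add: power_less_one_iff)
  have dg: "(g has_field_derivative 3 * expU t ^ 3 * thX (exp (- t)) ^ 2 - d / t ^ 2) (at t)"
    if t: "0 < t" for t
  proof -
    have "(g has_field_derivative
        - (3 * expU t ^ 2 * (- (expU t * (1 - expU t ^ 3) * thX (exp (- t)) ^ 2))) / (1 - expU t ^ 3) - d / t ^ 2) (at t)"
      unfolding g_def[abs_def] using y[OF t] t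
      by (auto intro!: derivative_eq_intros expU_deriv simp: power2_eq_square divide_inverse)
    thus ?thesis using y[OF t] by (simp add: power2_eq_square power3_eq_cube mult.assoc)
  qed
  have mono: "g t \<le> g 3" if t: "0 < t" "t \<le> 3" for t
  proof (rule DERIV_nonneg_imp_nondecreasing[OF t(2)])
    fix s assume s: "t \<le> s" "s \<le> 3"
    have s0: "0 < s" using s t by simp
    have "expU 3 \<le> expU s" using expU_decreasing[OF s0, of 3] s by (cases "s = 3") auto
    hence 1: "expU 3 ^ 3 \<le> expU s ^ 3" using expU_bounds[of 3] by (intro power_mono) auto
    have 2: "(exp (- 9) / s) ^ 2 \<le> thX (exp (- s)) ^ 2"
      using thX_lower[OF s0] s0 by (intro power_mono) auto
    have "d / s ^ 2 = 3 * expU 3 ^ 3 * (exp (- 9) / s) ^ 2" by (simp add: d_def power_divide)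
    also have "\<dots> \<le> 3 * expU s ^ 3 * thX (exp (- s)) ^ 2"
      using 1 2 expU_bounds[of 3] expU_bounds[OF s0] by (intro mult_mono) auto
    finally show "\<exists>y. DERIV g s :> y \<and> 0 \<le> y" using dg[OF s0] by (intro exI conjI) auto
  qed
  show ?thesis
  proof (rule exI[of _ "exp (g 3)"], rule exI[of _ d], intro conjI allI impI)
    fix t :: real assume t: "0 < t" "t \<le> 3"
    have "1 - expU t ^ 3 = exp (g t - d / t)" using y[OF t(1)] by (simp add: g_def)
    also have "\<dots> \<le> exp (g 3 - d / t)" using mono[OF t] by simp
    also have "\<dots> = exp (g 3) * exp (- d / t)" by (simp flip: exp_add)
    finally show "1 - expU t ^ 3 \<le> exp (g 3) * exp (- d / t)" .
  qed (use d in auto)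
qed

lemma power_div_fact_le_exp:
  assumes "0 \<le> (x :: real)" shows "x ^ n / fact n \<le> exp x"
proof -
  have s: "(\<lambda>n. x ^ n /\<^sub>R fact n) sums exp x" by (rule exp_converges)
  have "(\<Sum>i\<in>{n}. x ^ i /\<^sub>R fact i) \<le> (\<Sum>i. x ^ i /\<^sub>R fact i)"
    by (rule sum_le_suminf[OF sums_summable[OF s]]) (use assms in auto)
  thus ?thesis using s by (simp add: sums_iff divide_inverse mult.commute)
qed

lemma exp_neg_inverse_le:
  assumes "0 < d" "0 < (t::real)"
  shows "exp (- d / t) \<le> fact n / d ^ n * t ^ n"
proof -
  have "(d / t) ^ n / fact n \<le> exp (d / t)"
    using assms by (intro power_div_fact_le_exp) simp
  hence "1 / exp (d / t) \<le> 1 / ((d / t) ^ n / fact n)"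
    using assms by (intro divide_left_mono) auto
  moreover have "1 / ((d / t) ^ n / fact n) = fact n / d ^ n * t ^ n"
    by (simp add: power_divide)
  ultimately show ?thesis by (simp add: exp_minus inverse_eq_divide)
qed

lemma thZ_rapid:
  "\<exists>C. \<forall>t. 0 < t \<longrightarrow> t \<le> 3 \<longrightarrow> thZ (exp (- t)) \<le> C * t ^ n"
proof -
  obtain C d where C: "0 < C" "0 < d"
    "\<And>t. 0 < t \<Longrightarrow> t \<le> 3 \<Longrightarrow> 1 - expU t ^ 3 \<le> C * exp (- d / t)"
    using one_minus_expU_cube_decay by blast
  define K where "K = 8 * (1 + pi) ^ 2"
  \<comment> \<open>One extra power of t pays for X, bounded by K / t; d becomes d / 3 through the
    cube root in \<open>thZ_eq\<close>.\<close>
  define D where "D = K * (C powr (1/3) * (fact (Suc n) / (d / 3) ^ Suc n))"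
  show ?thesis
  proof (intro exI[of _ D] allI impI)
    fix t :: real assume t: "0 < t" "t \<le> 3"
    have q: "0 < exp (- t)" "exp (- t) < 1" using t by auto
    have y: "0 \<le> 1 - expU t ^ 3" using expU_bounds[OF t(1)] by (simp add: power_le_one)
    have "thZ (exp (- t)) = thX (exp (- t)) * (1 - expU t ^ 3) powr (1/3)"
      using thZ_eq[OF q] by (simp add: expU_def)
    also have "\<dots> \<le> (K / t) * (C * exp (- d / t)) powr (1/3)"
      using thX_upper[OF t] C(3)[OF t] y t thX_ge_1[of "exp (- t)"] unfolding K_def
      by (intro mult_mono powr_mono2) auto
    also have "(C * exp (- d / t)) powr (1/3) = C powr (1/3) * exp (- (d / 3) / t)"
      using C(1) by (simp add: powr_mult exp_powr_real)
    also have "(K / t) * \<dots> \<le> (K / t) * (C powr (1/3) * (fact (Suc n) / (d / 3) ^ Suc n * t ^ Suc n))"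
      using t C by (intro mult_left_mono exp_neg_inverse_le) (auto simp: K_def)
    also have "\<dots> = D * t ^ n" using t by (simp add: D_def)
    finally show "thZ (exp (- t)) \<le> D * t ^ n" .
  qed
qed

lemma bij_expU: "bij_betw expU {0<..} {0<..<1}"
proof (rule bij_betw_imageI)
  show "inj_on expU {0<..}"
    by (rule linorder_inj_onI) (use expU_decreasing in fastforce)+
  show "expU ` {0<..} = {0<..<1}"
  proof (intro equalityI subsetI)
    fix v assume v: "v \<in> {0<..<(1::real)}"
    obtain C d where C: "0 < C" "0 < d"
      "\<And>t. 0 < t \<Longrightarrow> t \<le> 3 \<Longrightarrow> 1 - expU t ^ 3 \<le> C * exp (- d / t)"
      using one_minus_expU_cube_decay by blast
    have v3: "0 < 1 - v ^ 3" using v by (simp add: power_less_one_iff)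
    \<comment> \<open>Chosen so that C exp (- d / t1), bounded by C t1 / d, is at most half of 1 -
      v^3, which forces \<open>expU t1\<close> above v. The minimum with 1 keeps t1 in the range of
      the decay estimate.\<close>
    define t1 where "t1 = min 1 ((1 - v ^ 3) * d / (2 * C))"
    have t1: "0 < t1" "t1 \<le> 3" using v3 C by (auto simp: t1_def)
    have "1 - expU t1 ^ 3 \<le> C * (fact 1 / d ^ 1 * t1 ^ 1)"
      using C(3)[OF t1] exp_neg_inverse_le[OF C(2) t1(1), of 1] C(1)
      by (meson mult_left_mono order_trans less_imp_le)
    also have "\<dots> \<le> C * (1 / d * ((1 - v ^ 3) * d / (2 * C)))"
    proof -
      have "t1 \<le> (1 - v ^ 3) * d / (2 * C)" by (simp add: t1_def)
      thus ?thesis using C by (simp del: times_divide_eq_left times_divide_eq_right add: divide_right_mono)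
    qed
    also have "\<dots> = (1 - v ^ 3) / 2" using C by simp
    also have "\<dots> < 1 - v ^ 3" using v3 by simp
    finally have "v ^ 3 < expU t1 ^ 3" by simp
    hence vt1: "v < expU t1" by (rule power_less_imp_less_base) (use expU_bounds[OF t1(1)] in auto)
    \<comment> \<open>A point with value below v is found among the iterated cubes of 1/2, along
      which U tends to 0; the intermediate value theorem then applies.\<close>
    have "isCont (\<lambda>x. x * powY1 x / powX x) 0"
      by (intro continuous_intros isCont_powX isCont_powY1) (simp add: powX_0)
    from isCont_tendsto_compose[OF this cube_iterates_tendsto[of "1/2"]]
    have "(\<lambda>k. (1/2) ^ (3 ^ k) * powY1 ((1/2) ^ (3 ^ k)) / powX ((1/2) ^ (3 ^ k))) \<longlonglongrightarrow> 0" by simp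
    from order_tendstoD(2)[OF this, of v] v obtain k where
      k: "(1/2) ^ (3 ^ k) * powY1 ((1/2) ^ (3 ^ k)) / powX ((1/2) ^ (3 ^ k)) < v"
      by (auto simp: eventually_at_top_linorder)
    define q :: real where "q = (1/2) ^ (3 ^ k)"
    have q: "0 < q" "q < 1" by (auto simp: q_def power_less_one_iff)
    define t2 where "t2 = - ln q"
    have t2: "0 < t2" "exp (- t2) = q" using q by (auto simp: t2_def)
    have vt2: "expU t2 < v"
      using k q t2 powX_eq[of q] powY1_eq[of q] unfolding q_def [symmetric] expU_def thU_def by simp
    have "t1 \<le> t2"
      using expU_decreasing[OF t2(1), of t1] vt1 vt2 by (cases "t1 \<le> t2") auto
    have "\<exists>x\<ge>t1. x \<le> t2 \<and> expU x = v"
      by (rule IVT2) (use vt1 vt2 \<open>t1 \<le> t2\<close> t1 in \<open>auto intro!: DERIV_isCont[OF expU_deriv]\<close>)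
    thus "v \<in> expU ` {0<..}" using t1 by force
  qed (use expU_bounds in auto)
qed

section \<open>Mellin transforms\<close>

lemma growth_series_sums:
  assumes "growth_series k f a" "0 < q" "q < 1"
  shows   "(\<lambda>n. a n * q ^ n) sums f q"
proof -
  from assms(1) obtain M where M: "\<forall>q. 0 < q \<longrightarrow> q < 1 \<longrightarrow>
     (\<lambda>n. a n * q ^ n) sums f q \<and> summable (\<lambda>n. \<bar>a n\<bar> * q ^ n) \<and>
     (\<Sum>n. \<bar>a n\<bar> * q ^ n) \<le> M / (1 - q) ^ k"
    unfolding growth_series_def ..
  with assms(2,3) show ?thesis by simp
qed

text \<open>Write \<open>exp (- t)\<close> as r * r. Since \<open>a 0 = 0\<close>, every surviving
  term can give away one factor r, which yields the exponential decay; the series in r that remains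
  has the growth bound of order 3. One estimate thus covers both ends of (0, \<infinity>).\<close>

lemma growth_series_exp_bound:
  assumes gs: "growth_series 3 f a" and a0: "a 0 = 0"
  shows "\<exists>D\<ge>0. \<forall>t>0. summable (\<lambda>n. \<bar>a n\<bar> * exp (- t) ^ n) \<and>
           (\<Sum>n. \<bar>a n\<bar> * exp (- t) ^ n) \<le> D / t ^ 3 * exp (- t / 4)"
proof -
  obtain M where
    M: "\<And>q. 0 < q \<Longrightarrow> q < 1 \<Longrightarrow> summable (\<lambda>n. \<bar>a n\<bar> * q ^ n)"
       "\<And>q. 0 < q \<Longrightarrow> q < 1 \<Longrightarrow> (\<Sum>n. \<bar>a n\<bar> * q ^ n) \<le> M / (1 - q) ^ 3"
    by (rule growth_seriesE[OF gs]) blast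
  have M0: "0 \<le> M"
  proof -
    have "0 \<le> (\<Sum>n. \<bar>a n\<bar> * (1/2) ^ n)" by (intro suminf_nonneg M) auto
    also have "\<dots> \<le> M / (1 - 1/2) ^ 3" by (rule M) auto
    finally show ?thesis by (simp add: zero_le_divide_iff)
  qed
  show ?thesis
  proof (rule exI[of _ "384 * exp (1/2) * M"], intro conjI allI impI)
    fix t :: real assume t: "0 < t"
    show s: "summable (\<lambda>n. \<bar>a n\<bar> * exp (- t) ^ n)" using t by (intro M) auto
    define r where "r = exp (- t / 2)"
    have r: "0 < r" "r < 1" "exp (- t) = r * r" using t by (auto simp: r_def simp flip: exp_add)
    have le: "\<bar>a n\<bar> * exp (- t) ^ n \<le> r * (\<bar>a n\<bar> * r ^ n)" for n
    proof (cases n)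
      case (Suc m)
      have "exp (- t) ^ n = r ^ n * r ^ n" by (simp add: r(3) power_mult_distrib)
      also have "\<dots> \<le> r ^ n * r"
        using r Suc power_decreasing[of 1 n r] by (intro mult_left_mono) auto
      finally have "exp (- t) ^ n \<le> r * r ^ n" by (simp add: mult.commute)
      hence "\<bar>a n\<bar> * exp (- t) ^ n \<le> \<bar>a n\<bar> * (r * r ^ n)" by (intro mult_left_mono) auto
      thus ?thesis by (simp add: mult_ac)
    qed (simp add: a0)
    have "(\<Sum>n. \<bar>a n\<bar> * exp (- t) ^ n) \<le> (\<Sum>n. r * (\<bar>a n\<bar> * r ^ n))"
      by (rule suminf_le[OF le s]) (intro summable_mult M r)
    also have "\<dots> = r * (\<Sum>n. \<bar>a n\<bar> * r ^ n)" by (intro suminf_mult M r)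
    also have "\<dots> \<le> r * (M / (1 - r) ^ 3)" using r by (intro mult_left_mono M) auto
    also have "M / (1 - r) ^ 3 \<le> M / (t / (2 + t)) ^ 3"
    proof (intro divide_left_mono power_mono M0)
      have "1 + t / 2 \<le> exp (t / 2)" by (rule exp_ge_add_one_self)
      hence "r \<le> 1 / (1 + t / 2)" using t by (simp add: r_def exp_minus field_simps)
      thus "t / (2 + t) \<le> 1 - r" using t by (simp add: field_simps)
    qed (use r t in auto)
    also have "\<dots> = M * (2 + t) ^ 3 / t ^ 3" by (simp add: power_divide)
    also have "\<dots> \<le> M * (384 * exp (1/2) * exp (t / 4)) / t ^ 3"
    proof (intro divide_right_mono mult_left_mono M0)
      \<comment> \<open>With this x, x^3 / 6 \<le> exp x reads (2 + t)^3 \<le> 6 * 64 * exp (1/2) *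
        exp (t / 4), which gives 384. The factor exp (t / 4) costs half of the decay exp (- t / 2)
        of r.\<close>
      define x where "x = (2 + t) / 4"
      have "x ^ 3 / 6 \<le> exp x"
        using power_div_fact_le_exp[of x 3] t by (simp add: x_def fact_numeral)
      also have "exp x = exp (1/2) * exp (t / 4)" by (simp add: x_def add_divide_distrib exp_add)
      finally show "(2 + t) ^ 3 \<le> 384 * exp (1/2) * exp (t / 4)"
        by (simp add: x_def power_divide)
    qed (use t in auto)
    also have "r * (M * (384 * exp (1/2) * exp (t / 4)) / t ^ 3) =
               384 * exp (1/2) * M / t ^ 3 * (r * exp (t / 4))" by simp
    also have "r * exp (t / 4) = exp (- t / 4)" by (simp add: r_def flip: exp_add)
    finally show "(\<Sum>n. \<bar>a n\<bar> * exp (- t) ^ n) \<le> 384 * exp (1/2) * M / t ^ 3 * exp (- t / 4)"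
      using r by (simp add: mult_left_mono)
  qed (use M0 in auto)
qed

lemma power_le_exp_eighth: "\<exists>C\<ge>0. \<forall>t>0. (t::real) ^ n \<le> C * exp (t / 8)"
proof (intro exI[of _ "8 ^ n * fact n"] conjI allI impI)
  fix t :: real assume t: "0 < t"
  have "(t / 8) ^ n / fact n \<le> exp (t / 8)" using t by (intro power_div_fact_le_exp) simp
  hence "t ^ n / (8 ^ n * fact n) \<le> exp (t / 8)" by (simp only: power_divide divide_divide_eq_left)
  thus "t ^ n \<le> 8 ^ n * fact n * exp (t / 8)"
    by (subst (asm) pos_divide_le_eq) (simp_all add: mult.commute)
qed auto

lemma growth_series_continuous:
  assumes "growth_series k f a" shows "continuous_on {0<..} (\<lambda>t. f (exp (- t)))"
proof -
  note M = growth_series_sums[OF assms]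
  have "continuous_on {0<..} (\<lambda>t. \<Sum>n. a n * exp (- t) ^ n)"
  proof (intro continuous_at_imp_continuous_on ballI)
    fix t :: real assume t: "t \<in> {0<..}"
    have "summable (\<lambda>n. a n * exp (- t / 2) ^ n)"
      by (rule sums_summable[OF M]) (use t in simp_all)
    hence "isCont (\<lambda>x. \<Sum>n. a n * x ^ n) (exp (- t))"
      by (rule isCont_powser) (use t in simp)
    moreover have "isCont (\<lambda>t::real. exp (- t)) t" by (intro continuous_intros)
    ultimately show "isCont (\<lambda>t. \<Sum>n. a n * exp (- t) ^ n) t"
      by (intro isCont_o2[where g = "\<lambda>x. \<Sum>n. a n * x ^ n" and f = "\<lambda>t. exp (- t)"])
  qed
  thus ?thesis
    by (rule continuous_on_eq) (rule sums_unique[OF M, symmetric], auto)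
qed

lemma integral_extend_zero:
  fixes h :: "real \<Rightarrow> 'b :: banach"
  assumes "h integrable_on S" "S \<subseteq> T"
  shows "(\<lambda>t. if t \<in> S then h t else 0) integrable_on T"
    and "integral T (\<lambda>t. if t \<in> S then h t else 0) = integral S h"
proof -
  have "((\<lambda>t. if t \<in> S then h t else 0) has_integral integral S h) T"
    using integrable_integral[OF assms(1)] by (simp only: has_integral_restrict[OF assms(2)])
  thus "(\<lambda>t. if t \<in> S then h t else 0) integrable_on T"
    and "integral T (\<lambda>t. if t \<in> S then h t else 0) = integral S h"
    by (auto intro: integral_unique)
qed

lemma has_integral_Gamma_scaled:
  assumes s: "Re s > 0" and n: "0 < n"
  shows "((\<lambda>t. of_real (exp (- t) ^ n) * exp ((s - 1) * of_real (ln t))) has_integral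
           (of_nat n powr (- s) * Gamma s)) {0<..}"
proof -
  define f where "f t = complex_of_real t powr (s - 1) / of_real (exp t)" for t
  have img: "(\<lambda>t. real n * t) ` {0<..} = {0<..}"
  proof (intro equalityI subsetI)
    fix t :: real assume "t \<in> {0<..}"
    thus "t \<in> (\<lambda>t. real n * t) ` {0<..}" using n by (intro image_eqI[of _ _ "t / real n"]) auto
  qed (use n in auto)
  have "f absolutely_integrable_on {0<..}" "integral {0<..} f = Gamma s"
    using absolutely_integrable_Gamma_integral'[OF s] integral_unique[OF Gamma_integral_complex'[OF s]]
    by (simp_all add: f_def[abs_def])
  moreover have "(\<lambda>t. \<bar>real n\<bar> *\<^sub>R f (real n * t)) absolutely_integrable_on {0<..} \<and>
        integral {0<..} (\<lambda>t. \<bar>real n\<bar> *\<^sub>R f (real n * t)) = Gamma s \<longleftrightarrow>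
      f absolutely_integrable_on ((\<lambda>t. real n * t) ` {0<..}) \<and>
        integral ((\<lambda>t. real n * t) ` {0<..}) f = Gamma s"
    by (rule has_absolute_integral_change_of_variables_real)
       (use n in \<open>auto intro!: derivative_eq_intros simp: inj_on_def\<close>)
  ultimately have "(\<lambda>t. \<bar>real n\<bar> *\<^sub>R f (real n * t)) absolutely_integrable_on {0<..}"
        "integral {0<..} (\<lambda>t. \<bar>real n\<bar> *\<^sub>R f (real n * t)) = Gamma s"
    unfolding img by auto
  hence "((\<lambda>t. \<bar>real n\<bar> *\<^sub>R f (real n * t)) has_integral Gamma s) {0<..}"
    using set_lebesgue_integral_eq_integral(1) has_integral_iff by blast
  hence "((\<lambda>t. of_nat n powr (- s) * (\<bar>real n\<bar> *\<^sub>R f (real n * t))) has_integral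
          of_nat n powr (- s) * Gamma s) {0<..}"
    by (rule has_integral_mult_right)
  thus ?thesis
  proof (rule has_integral_eq[rotated])
    fix t :: real assume "t \<in> {0<..}"
    hence t: "0 < t" by simp
    have pw: "complex_of_real x powr z = exp (z * of_real (ln x))" if "0 < x" for x z
      using that by (simp add: powr_def Ln_of_real)
    have n': "(of_nat n :: complex) = exp (of_real (ln (real n)))"
      using exp_of_real[of "ln (real n)", where 'a = complex] n by simp
    have "of_nat n powr (- s) = exp (- s * of_real (ln (real n)))"
      using pw[of "real n" "- s"] n by simp
    moreover have "\<bar>real n\<bar> *\<^sub>R f (real n * t) =
       exp (of_real (ln (real n))) * exp ((s - 1) * (of_real (ln (real n)) + of_real (ln t))) / of_real (exp (real n * t))"
      using pw[of "real n * t" "s - 1"] n t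
      by (simp add: f_def scaleR_conv_of_real n' ln_mult exp_minus)
    moreover have "exp (- s * of_real (ln (real n))) *
        (exp (of_real (ln (real n))) * exp ((s - 1) * (of_real (ln (real n)) + of_real (ln t)))) =
        exp ((s - 1) * complex_of_real (ln t))"
      unfolding exp_add [symmetric] by (rule arg_cong[of _ _ exp]) (simp add: algebra_simps)
    moreover have "exp (- t) ^ n = 1 / exp (real n * t)"
      by (simp add: exp_of_nat_mult exp_minus inverse_eq_divide power_one_over)
    ultimately show "of_nat n powr (- s) * (\<bar>real n\<bar> *\<^sub>R f (real n * t)) =
        of_real (exp (- t) ^ n) * exp ((s - 1) * of_real (ln t))"
      by (simp add: mult.assoc)
  qed
qed

text \<open>
  Since \<open>f (exp (- t))\<close> decays rapidly at both ends, its Mellin transform is entire.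
\<close>
locale rapid_series =
  fixes f :: "real \<Rightarrow> real" and a :: "nat \<Rightarrow> real"
  assumes series: "growth_series 3 f a" and a_0: "a 0 = 0"
    and rapid: "\<And>n. \<exists>C. \<forall>t. 0 < t \<longrightarrow> t \<le> 1 \<longrightarrow> \<bar>f (exp (- t))\<bar> \<le> C * t ^ n"
begin

lemma sums_f: "0 < q \<Longrightarrow> q < 1 \<Longrightarrow> (\<lambda>n. a n * q ^ n) sums f q"
  by (rule growth_series_sums[OF series])

text \<open>The integrand f(exp (- t)) t^(s - 1). The exponential form makes it visibly entire in s,
  with derivative \<open>kern s t * ln t\<close>.\<close>

definition kern :: "complex \<Rightarrow> real \<Rightarrow> complex" where
  "kern s t = of_real (f (exp (- t))) * exp ((s - 1) * of_real (ln t))"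

lemma norm_kern: "norm (kern s t) = \<bar>f (exp (- t))\<bar> * exp ((Re s - 1) * ln t)"
  by (simp add: kern_def norm_mult)

text \<open>One integrable majorant for a whole vertical strip. For t \<le> 1, decay of order N + 1
  offsets t^(Re s - 1); for t > 1, t^N is absorbed by half of the decay exp (- t / 4).\<close>

lemma kern_bound:
  "\<exists>C\<ge>0. \<forall>s t. \<bar>Re s\<bar> \<le> real N \<longrightarrow> 0 < t \<longrightarrow> norm (kern s t) \<le> C * exp (- t / 8)"
proof -
  obtain C1 where C1: "\<And>t. 0 < t \<Longrightarrow> t \<le> 1 \<Longrightarrow> \<bar>f (exp (- t))\<bar> \<le> C1 * t ^ (N + 1)"
    using rapid[of "N + 1"] by blast
  have "0 \<le> C1" using C1[of 1] by simp
  from growth_series_exp_bound[OF series a_0] obtain D where D0: "0 \<le> D"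
    and D1: "\<forall>t>0. summable (\<lambda>n. \<bar>a n\<bar> * exp (- t) ^ n) \<and>
           (\<Sum>n. \<bar>a n\<bar> * exp (- t) ^ n) \<le> D / t ^ 3 * exp (- t / 4)" by (elim exE conjE)
  have D: "0 \<le> D" "\<And>t. t > 0 \<Longrightarrow> summable (\<lambda>n. \<bar>a n\<bar> * exp (- t) ^ n)"
           "\<And>t. t > 0 \<Longrightarrow> (\<Sum>n. \<bar>a n\<bar> * exp (- t) ^ n) \<le> D / t ^ 3 * exp (- t / 4)"
    using D0 D1 by simp_all
  from power_le_exp_eighth[of N] obtain C2 where C2_0: "0 \<le> C2"
    and C2_1: "\<forall>t::real>0. t ^ N \<le> C2 * exp (t / 8)" by (elim exE conjE)
  have C2: "0 \<le> C2" "\<And>t::real. t > 0 \<Longrightarrow> t ^ N \<le> C2 * exp (t / 8)"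
    using C2_0 C2_1 by simp_all
  show ?thesis
  proof (intro exI[of _ "C1 * exp (1/8) + D * C2"] conjI allI impI)
    fix s :: complex and t :: real assume s: "\<bar>Re s\<bar> \<le> real N" and t: "0 < t"
    show "norm (kern s t) \<le> (C1 * exp (1/8) + D * C2) * exp (- t / 8)"
    proof (cases "t \<le> 1")
      case True
      have ln: "ln t \<le> 0" using t True by simp
      have "(Re s - 1) * ln t \<le> - real (N + 1) * ln t"
        using s ln by (intro mult_right_mono_neg) auto
      hence "exp ((Re s - 1) * ln t) \<le> exp (- real (N + 1) * ln t)" by (simp only: exp_le_cancel_iff)
      also have "\<dots> = inverse (exp (ln t) ^ (N + 1))"
        by (simp only: mult_minus_left exp_minus exp_of_nat_mult)
      also have "\<dots> = 1 / t ^ (N + 1)" using t by (simp add: inverse_eq_divide)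
      finally have "norm (kern s t) \<le> (C1 * t ^ (N + 1)) * (1 / t ^ (N + 1))"
        unfolding norm_kern using C1[OF t True] \<open>0 \<le> C1\<close> t by (intro mult_mono) auto
      also have "\<dots> = C1 * 1" using t by simp
      also have "\<dots> \<le> C1 * (exp (1/8) * exp (- t / 8))"
        using \<open>0 \<le> C1\<close> True by (intro mult_left_mono) (auto simp flip: exp_add)
      also have "\<dots> \<le> (C1 * exp (1/8) + D * C2) * exp (- t / 8)"
        using D(1) C2(1) by (simp add: algebra_simps)
      finally show ?thesis .
    next
      case False
      have "\<bar>f (exp (- t))\<bar> \<le> (\<Sum>n. \<bar>a n\<bar> * exp (- t) ^ n)"
      proof -
        have "f (exp (- t)) = (\<Sum>n. a n * exp (- t) ^ n)"
          using sums_f[of "exp (- t)"] t by (simp add: sums_iff)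
        moreover have "summable (\<lambda>n. norm (a n * exp (- t) ^ n))"
          using D(2)[OF t] by (simp add: abs_mult)
        from summable_norm[OF this] have
          "\<bar>\<Sum>n. a n * exp (- t) ^ n\<bar> \<le> (\<Sum>n. \<bar>a n\<bar> * exp (- t) ^ n)" by (simp add: abs_mult)
        ultimately show ?thesis by simp
      qed
      also have "\<dots> \<le> D / t ^ 3 * exp (- t / 4)" by (rule D(3)[OF t])
      also have "\<dots> \<le> D * exp (- t / 4)"
      proof (intro mult_right_mono)
        have "1 ^ 3 \<le> t ^ 3" using False by (intro power_mono) auto
        thus "D / t ^ 3 \<le> D" using D(1) t mult_left_mono[of 1 "t ^ 3" D] by (simp add: divide_le_eq)
      qed auto
      finally have 1: "\<bar>f (exp (- t))\<bar> \<le> D * exp (- t / 4)" .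
      have "(Re s - 1) * ln t \<le> real N * ln t"
        using s False by (intro mult_right_mono) auto
      hence "exp ((Re s - 1) * ln t) \<le> exp (real N * ln t)" by simp
      also have "\<dots> = t ^ N" using t by (simp add: exp_of_nat_mult)
      also have "\<dots> \<le> C2 * exp (t / 8)" by (rule C2(2)[OF t])
      finally have "norm (kern s t) \<le> D * exp (- t / 4) * (C2 * exp (t / 8))"
        unfolding norm_kern using 1 D(1) by (intro mult_mono) auto
      also have "\<dots> = D * C2 * (exp (- t / 4) * exp (t / 8))" by simp
      also have "exp (- t / 4) * exp (t / 8) = exp (- t / 8)" by (simp flip: exp_add)
      also have "D * C2 * exp (- t / 8) \<le> (C1 * exp (1/8) + D * C2) * exp (- t / 8)"
        using \<open>0 \<le> C1\<close> by (intro mult_right_mono) auto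
      finally show ?thesis .
    qed
  qed (use \<open>0 \<le> C1\<close> D(1) C2(1) in auto)
qed

lemma continuous_f: "continuous_on {0<..} (\<lambda>t. f (exp (- t)))"
  by (rule growth_series_continuous[OF series])

lemma continuous_kern: "continuous_on {0<..} (kern s)"
  unfolding kern_def[abs_def] by (intro continuous_intros continuous_f) auto

lemma integrable_exp_eighth: "(\<lambda>t::real. C * exp (- t / 8)) integrable_on {0<..}"
proof -
  have "(\<lambda>t::real. exp (- (1/8) * t)) integrable_on {0..}"
    by (rule integrable_on_exp_minus_to_infinity) simp
  hence "(\<lambda>t::real. exp (- (1/8) * t)) integrable_on {0<..}"
    by (rule integrable_spike_set) (auto intro: negligible_subset[of "{0}"])
  hence "(\<lambda>t::real. exp (- t / 8)) integrable_on {0<..}" by simp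
  thus ?thesis by (rule integrable_on_mult_right)
qed

lemma kern_absolutely_integrable: "kern s absolutely_integrable_on {0<..}"
proof -
  obtain N :: nat where N: "\<bar>Re s\<bar> \<le> real N" using real_arch_simple by blast
  from kern_bound[of N] obtain C where
    "\<forall>s t. \<bar>Re s\<bar> \<le> real N \<longrightarrow> 0 < t \<longrightarrow> norm (kern s t) \<le> C * exp (- t / 8)" by (elim exE conjE)
  with N have "norm (kern s t) \<le> C * exp (- t / 8)" if "0 < t" for t using that by simp
  thus ?thesis
    by (intro measurable_bounded_by_integrable_imp_absolutely_integrable[OF _ _ integrable_exp_eighth]
         continuous_imp_measurable_on_sets_lebesgue continuous_kern) auto
qed

definition mellin :: "complex \<Rightarrow> complex" where "mellin s = integral {0<..} (kern s)"

text \<open>Compact exhaustion of (0, \<infinity>): on a compact interval the Leibniz rule gives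
  holomorphy in s.\<close>

definition window :: "nat \<Rightarrow> real set" where "window n = cbox (1 / real (Suc n)) (real (Suc n))"

lemma window_subset: "window n \<subseteq> {0<..}"
  by (auto simp: window_def intro: less_le_trans[of _ "1 / real (Suc n)"])

lemma eventually_window: "0 < t \<Longrightarrow> eventually (\<lambda>n. t \<in> window n) sequentially"
proof -
  assume t: "0 < t"
  obtain n0 where n0: "t \<le> real n0" "1 / t \<le> real n0"
    using real_arch_simple[of "max t (1 / t)"] by auto
  have "t \<in> window n" if "n \<ge> n0" for n
  proof -
    have "1 / t \<le> real (Suc n)" "t \<le> real (Suc n)" using n0 that by linarith+
    thus ?thesis using t by (simp add: window_def field_simps)
  qed
  thus ?thesis by (auto simp: eventually_at_top_linorder)
qed

lemma window_holomorphic: "(\<lambda>s. integral (window n) (kern s)) holomorphic_on UNIV"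
  unfolding window_def
proof (rule leibniz_rule_holomorphic[where fx = "\<lambda>s t. kern s t * of_real (ln t)"])
  fix s :: complex and t :: real
  show "((\<lambda>s. kern s t) has_field_derivative kern s t * of_real (ln t)) (at s within UNIV)"
    unfolding kern_def by (auto intro!: derivative_eq_intros)
next
  fix s :: complex
  have "continuous_on (cbox (1 / real (Suc n)) (real (Suc n))) (kern s)"
    by (rule continuous_on_subset[OF continuous_kern]) (rule window_subset[unfolded window_def])
  thus "kern s integrable_on cbox (1 / real (Suc n)) (real (Suc n))" by (rule integrable_continuous)
next
  have "continuous_on (UNIV \<times> {0<..}) (\<lambda>(s, t). kern s t * of_real (ln t))"
    unfolding kern_def case_prod_unfold
    by (intro continuous_intros continuous_on_compose2[OF continuous_f continuous_on_snd]) auto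
  thus "continuous_on (UNIV \<times> cbox (1 / real (Suc n)) (real (Suc n))) (\<lambda>(s, t). kern s t * of_real (ln t))"
    by (rule continuous_on_subset) (use window_subset[of n, unfolded window_def] in auto)
qed auto

text \<open>The integrals over \<open>window n\<close> converge uniformly on the unit ball around x,
  because the error is at most the tail \<open>e n\<close> of a majorant that does not depend on
  s.\<close>

lemma mellin_holomorphic: "mellin holomorphic_on UNIV"
proof (rule holomorphic_uniform_sequence[OF open_UNIV window_holomorphic])
  fix x :: complex
  obtain N :: nat where N: "\<bar>Re x\<bar> + 1 \<le> real N" using real_arch_simple by blast
  from kern_bound[of N] obtain C where C0: "0 \<le> C" and
    C1: "\<forall>s t. \<bar>Re s\<bar> \<le> real N \<longrightarrow> 0 < t \<longrightarrow> norm (kern s t) \<le> C * exp (- t / 8)" by (elim exE conjE)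
  have C: "0 \<le> C" "\<And>s t. \<bar>Re s\<bar> \<le> real N \<Longrightarrow> 0 < t \<Longrightarrow> norm (kern s t) \<le> C * exp (- t / 8)"
    using C0 C1 by simp_all
  define h where "h t = C * exp (- t / 8)" for t
  have h: "h integrable_on {0<..}" unfolding h_def by (rule integrable_exp_eighth)
  have h_window: "h integrable_on window n" for n
    unfolding window_def h_def by (intro integrable_continuous continuous_intros) simp
  define e where "e n = integral {0<..} h - integral (window n) h" for n
  note restr = integral_extend_zero[OF h_window window_subset]
  have "(\<lambda>n. integral {0<..} (\<lambda>t. if t \<in> window n then h t else 0)) \<longlonglongrightarrow> integral {0<..} h"
  proof (rule dominated_convergence(2)[OF restr(1) h])
    show "norm (if t \<in> window n then h t else 0) \<le> h t" for n t using C(1) by (auto simp: h_def)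
    show "(\<lambda>n. if t \<in> window n then h t else 0) \<longlonglongrightarrow> h t" if "t \<in> {0<..}" for t
    proof (rule tendsto_eventually)
      show "\<forall>\<^sub>F n in sequentially. (if t \<in> window n then h t else 0) = h t"
        using that by (intro eventually_mono[OF eventually_window]) auto
    qed
  qed
  hence e: "e \<longlonglongrightarrow> 0"
    unfolding e_def restr(2) by (intro tendsto_eq_intros) auto
  have bound: "norm (integral (window n) (kern s) - mellin s) \<le> e n" if s: "\<bar>Re s\<bar> \<le> real N" for s n
  proof -
    have k: "kern s integrable_on {0<..}"
      using kern_absolutely_integrable set_lebesgue_integral_eq_integral(1) by blast
    have kw: "kern s integrable_on window n"
      unfolding window_def
      by (rule integrable_continuous)
         (rule continuous_on_subset[OF continuous_kern], rule window_subset[unfolded window_def])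
    note restr_k = integral_extend_zero[OF kw window_subset]
    have "norm (integral {0<..} (\<lambda>t. (if t \<in> window n then kern s t else 0) - kern s t)) \<le>
          integral {0<..} (\<lambda>t. h t - (if t \<in> window n then h t else 0))"
    proof (rule integral_norm_bound_integral)
      show "(\<lambda>t. (if t \<in> window n then kern s t else 0) - kern s t) integrable_on {0<..}"
        by (intro integrable_diff restr_k k)
      show "(\<lambda>t. h t - (if t \<in> window n then h t else 0)) integrable_on {0<..}"
        by (intro integrable_diff restr h)
      show "norm ((if t \<in> window n then kern s t else 0) - kern s t) \<le> h t - (if t \<in> window n then h t else 0)"
        if "t \<in> {0<..}" for t using C(2)[OF s, of t] that by (simp add: h_def)
    qed
    thus ?thesis
      using restr restr_k k h by (simp add: integral_diff mellin_def e_def)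
  qed
  show "\<exists>d>0. cball x d \<subseteq> UNIV \<and> uniform_limit (cball x d) (\<lambda>n s. integral (window n) (kern s)) mellin sequentially"
  proof (intro exI[of _ 1] conjI)
    show "uniform_limit (cball x 1) (\<lambda>n s. integral (window n) (kern s)) mellin sequentially"
      unfolding uniform_limit_iff
    proof (intro allI impI)
      fix \<epsilon> :: real assume "\<epsilon> > 0"
      from order_tendstoD(2)[OF e this] show
        "\<forall>\<^sub>F n in sequentially. \<forall>s\<in>cball x 1. dist (integral (window n) (kern s)) (mellin s) < \<epsilon>"
      proof eventually_elim
        case (elim n)
        show ?case
        proof
          fix s assume "s \<in> cball x 1"
          hence "\<bar>Re s - Re x\<bar> \<le> 1"
            using abs_Re_le_cmod[of "s - x"] by (simp add: dist_norm norm_minus_commute)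
          hence "\<bar>Re s\<bar> \<le> real N" using N by linarith
          from bound[OF this, of n] elim show "dist (integral (window n) (kern s)) (mellin s) < \<epsilon>"
            by (simp add: dist_norm)
        qed
      qed
    qed
  qed auto
qed

lemma f_absolutely_integrable: "(\<lambda>t. f (exp (- t))) absolutely_integrable_on {0<..}"
proof -
  from kern_bound[of 1] obtain C where
    C: "\<forall>s t. \<bar>Re s\<bar> \<le> real 1 \<longrightarrow> 0 < t \<longrightarrow> norm (kern s t) \<le> C * exp (- t / 8)" by (elim exE conjE)
  have "norm (f (exp (- t))) \<le> C * exp (- t / 8)" if "0 < t" for t
    using C[rule_format, of 1 t] that by (simp add: norm_kern)
  thus ?thesis
    by (intro measurable_bounded_by_integrable_imp_absolutely_integrable[OF _ _ integrable_exp_eighth]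
         continuous_imp_measurable_on_sets_lebesgue continuous_f) auto
qed

lemma mellin_1: "mellin 1 = of_real (integral {0<..} (\<lambda>t. f (exp (- t))))"
proof -
  have "(\<lambda>t. f (exp (- t))) integrable_on {0<..}"
    using f_absolutely_integrable set_lebesgue_integral_eq_integral(1) by blast
  from integral_linear[OF this bounded_linear_of_real[where 'a = complex]] show ?thesis
    by (simp add: mellin_def kern_def[abs_def] o_def)
qed

lemma dirichlet_series:
  assumes s: "Re s > 4"
  shows "(\<lambda>n. of_real (a (Suc n)) * of_nat (Suc n) powr (- s)) sums (rGamma s * mellin s)"
proof -
  define T where "T n = of_real (a n) * (of_nat n powr (- s) * Gamma s)" for n
  define F where "F n t = of_real (a n) * (of_real (exp (- t) ^ n) * exp ((s - 1) * of_real (ln t)))" for n t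
  from growth_series_exp_bound[OF series a_0] obtain D where D0: "0 \<le> D"
    and D1: "\<forall>t>0. summable (\<lambda>n. \<bar>a n\<bar> * exp (- t) ^ n) \<and>
           (\<Sum>n. \<bar>a n\<bar> * exp (- t) ^ n) \<le> D / t ^ 3 * exp (- t / 4)" by (elim exE conjE)
  \<comment> \<open>The majorant D t^(Re s - 4) exp (- t / 4), written as the modulus of a Gamma
    integrand at s - 3 so that its integrability can be quoted.\<close>
  define h where "h t = D * norm (complex_of_real t powr ((s - 3) - 1) / of_real (exp (1/4 * t)))" for t
  have int_F: "(F n has_integral T n) {0<..}" for n
  proof (cases "n = 0")
    case True
    thus ?thesis by (simp add: F_def[abs_def] T_def a_0)
  next
    case False
    hence "((\<lambda>t. of_real (exp (- t) ^ n) * exp ((s - 1) * of_real (ln t))) has_integral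
               (of_nat n powr (- s) * Gamma s)) {0<..}"
      using s by (intro has_integral_Gamma_scaled) auto
    thus ?thesis unfolding F_def[abs_def] T_def by (rule has_integral_mult_right)
  qed
  have int_P: "((\<lambda>t. \<Sum>n<k. F n t) has_integral (\<Sum>n<k. T n)) {0<..}" for k
    by (intro has_integral_sum int_F) auto
  have "(\<lambda>k. integral {0<..} (\<lambda>t. \<Sum>n<k. F n t)) \<longlonglongrightarrow> integral {0<..} (kern s)"
  proof (rule dominated_convergence(2))
    show "(\<lambda>t. \<Sum>n<k. F n t) integrable_on {0<..}" for k
      using int_P by (rule has_integral_integrable)
    have "(\<lambda>t. complex_of_real t powr ((s - 3) - 1) / of_real (exp (1/4 * t))) absolutely_integrable_on {0<..}"
      using s by (intro absolutely_integrable_Gamma_integral) auto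
    thus "h integrable_on {0<..}"
      unfolding h_def[abs_def] absolutely_integrable_on_def by (intro integrable_on_mult_right) auto
  next
    fix k and t :: real assume "t \<in> {0<..}"
    hence t: "0 < t" by simp
    have "norm (\<Sum>n<k. F n t) \<le> (\<Sum>n<k. norm (F n t))" by (rule norm_sum)
    also have "\<dots> = (\<Sum>n<k. \<bar>a n\<bar> * exp (- t) ^ n) * exp ((Re s - 1) * ln t)"
      unfolding sum_distrib_right by (simp add: F_def norm_mult norm_power mult.assoc)
    also have "\<dots> \<le> (D / t ^ 3 * exp (- t / 4)) * exp ((Re s - 1) * ln t)"
    proof (intro mult_right_mono)
      have "(\<Sum>n<k. \<bar>a n\<bar> * exp (- t) ^ n) \<le> (\<Sum>n. \<bar>a n\<bar> * exp (- t) ^ n)"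
        using D1[rule_format, OF t] by (intro sum_le_suminf) auto
      thus "(\<Sum>n<k. \<bar>a n\<bar> * exp (- t) ^ n) \<le> D / t ^ 3 * exp (- t / 4)"
        using D1[rule_format, OF t] by linarith
    qed auto
    also have "\<dots> = h t"
    proof -
      have "norm (complex_of_real t powr ((s - 3) - 1)) = t powr (Re s - 1 - 3)"
        using t by (simp add: norm_powr_real_powr)
      also have "\<dots> = t powr (Re s - 1) / t powr 3" by (rule powr_diff)
      also have "\<dots> = exp ((Re s - 1) * ln t) / t ^ 3"
        using t by (simp add: powr_def[of t "Re s - 1"])
      finally have *: "norm (complex_of_real t powr ((s - 3) - 1)) = exp ((Re s - 1) * ln t) / t ^ 3" .
      have "exp (- t / 4) = 1 / exp (1/4 * t)" by (simp add: exp_minus inverse_eq_divide)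
      thus ?thesis unfolding h_def norm_divide * by simp
    qed
    finally show "norm (\<Sum>n<k. F n t) \<le> h t" .
  next
    fix t :: real assume "t \<in> {0<..}"
    hence "(\<lambda>n. a n * exp (- t) ^ n) sums f (exp (- t))" by (intro sums_f) auto
    hence "(\<lambda>n. complex_of_real (a n * exp (- t) ^ n)) sums of_real (f (exp (- t)))"
      by (rule sums_of_real)
    hence "(\<lambda>n. complex_of_real (a n * exp (- t) ^ n) * exp ((s - 1) * of_real (ln t))) sums kern s t"
      unfolding kern_def by (rule sums_mult2)
    thus "(\<lambda>k. \<Sum>n<k. F n t) \<longlonglongrightarrow> kern s t"
      unfolding sums_def F_def by (simp add: mult.assoc)
  qed
  moreover have "integral {0<..} (\<lambda>t. \<Sum>n<k. F n t) = (\<Sum>n<k. T n)" for k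
    by (rule integral_unique[OF int_P])
  ultimately have "T sums mellin s" by (simp add: sums_def mellin_def)
  hence "(\<lambda>n. rGamma s * T n) sums (rGamma s * mellin s)" by (rule sums_mult)
  moreover have "rGamma s * T n = of_real (a n) * of_nat n powr (- s)" for n
  proof -
    have "s \<notin> \<int>\<^sub>\<le>\<^sub>0" using s by (auto elim!: nonpos_Ints_cases)
    hence "Gamma s \<noteq> 0" by (simp add: Gamma_eq_zero_iff)
    thus ?thesis by (simp add: T_def rGamma_inverse_Gamma)
  qed
  ultimately have "(\<lambda>n. of_real (a n) * of_nat n powr (- s)) sums (rGamma s * mellin s)" by simp
  thus ?thesis by (subst sums_Suc_iff) (simp add: a_0)
qed

text \<open>The reciprocal Gamma function is entire, so \<open>rGamma s * mellin s\<close> is an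
  entire continuation of the Dirichlet series. At s = 1 both \<open>rGamma\<close> and the power of
  t equal 1.\<close>

theorem has_L_value_1:
  "has_L_value 3 (\<lambda>q. of_real (f q)) 1 (of_real (integral {0<..} (\<lambda>t. f (exp (- t)))))"
  unfolding has_L_value_def
proof (intro exI[of _ "\<lambda>s. rGamma s * mellin s"] conjI)
  have "(\<lambda>s. rGamma s * mellin s) holomorphic_on UNIV"
    by (intro holomorphic_intros mellin_holomorphic)
  hence an: "(\<lambda>s. rGamma s * mellin s) analytic_on UNIV" by (simp add: analytic_on_open)
  thus "(\<lambda>s. rGamma s * mellin s) analytic_on {1}" by (rule analytic_on_subset) auto
  show "is_L_function 3 (\<lambda>q. of_real (f q)) (\<lambda>s. rGamma s * mellin s)"
    unfolding is_L_function_def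
  proof (intro conjI exI[of _ "\<lambda>n. of_real (a n)"] allI impI)
    show "has_q_expansion (\<lambda>q. complex_of_real (f q)) (\<lambda>n. of_real (a n))"
      unfolding has_q_expansion_def
    proof (intro allI impI)
      fix q :: real assume q: "0 < q \<and> q < 1"
      have "(\<lambda>n. a (Suc n) * q ^ Suc n) sums f q"
        using sums_f[of q] q by (subst sums_Suc_iff) (simp add: a_0)
      from sums_of_real[OF this]
      show "(\<lambda>n. complex_of_real (a (Suc n)) * of_real (q ^ Suc n)) sums of_real (f q)"
        by (simp only: of_real_mult)
    qed
    show "(\<lambda>n. complex_of_real (a (Suc n)) * of_nat (Suc n) powr (- s)) sums (rGamma s * mellin s)"
      if "real 3 + 1 < Re s" for s
      using that by (intro dirichlet_series) simp
    show "(\<lambda>s. rGamma s * mellin s) nicely_meromorphic_on UNIV"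
      using an by (rule analytic_on_imp_nicely_meromorphic_on)
  qed
  show "rGamma 1 * mellin 1 = of_real (integral {0<..} (\<lambda>t. f (exp (- t))))"
    by (simp add: mellin_1)
qed

end

section \<open>Beta integrals\<close>

text \<open>With nonnegative terms the sum G itself dominates the partial sums. Hence integrability
  of G, later supplied by a change of variables, suffices for termwise integration, without any
  estimate of the series near 1.\<close>

lemma nonneg_series_integral:
  fixes F :: "nat \<Rightarrow> real \<Rightarrow> real"
  assumes F: "\<And>n. (F n has_integral I n) S" "\<And>n x. x \<in> S \<Longrightarrow> 0 \<le> F n x"
    and G: "\<And>x. x \<in> S \<Longrightarrow> (\<lambda>n. F n x) sums G x" "G integrable_on S"
  shows "I sums integral S G"
proof -
  have P: "((\<lambda>x. \<Sum>n<k. F n x) has_integral (\<Sum>n<k. I n)) S" for k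
    by (intro has_integral_sum F) auto
  have "(\<lambda>k. integral S (\<lambda>x. \<Sum>n<k. F n x)) \<longlonglongrightarrow> integral S G"
  proof (rule dominated_convergence(2)[OF _ G(2)])
    show "(\<lambda>x. \<Sum>n<k. F n x) integrable_on S" for k using P by (rule has_integral_integrable)
    show "norm (\<Sum>n<k. F n x) \<le> G x" if x: "x \<in> S" for k x
    proof -
      have "(\<Sum>n<k. F n x) \<le> (\<Sum>n. F n x)"
        using G(1)[OF x] F(2)[OF x] by (intro sum_le_suminf) (auto simp: sums_iff)
      thus ?thesis using G(1)[OF x] F(2)[OF x] by (simp add: sums_iff sum_nonneg)
    qed
    show "(\<lambda>k. \<Sum>n<k. F n x) \<longlonglongrightarrow> G x" if "x \<in> S" for x using G(1)[OF that] by (simp add: sums_def)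
  qed
  thus ?thesis by (simp add: sums_def integral_unique[OF P])
qed

lemma has_integral_Beta_power:
  fixes a b :: real
  assumes "0 < a" "0 < b"
  shows "((\<lambda>x. x ^ m * (x powr (a - 1) * (1 - x) powr (b - 1))) has_integral Beta (a + real m) b) {0<..<1}"
proof -
  have "((\<lambda>x. x powr (a + real m - 1) * (1 - x) powr (b - 1)) has_integral Beta (a + real m) b) {0<..<1}"
    using has_integral_Beta_real[of "a + real m" b] assms by (simp add: has_integral_Icc_iff_Ioo)
  thus ?thesis
  proof (rule has_integral_eq[rotated])
    fix x :: real assume "x \<in> {0<..<1}"
    hence x: "0 < x" by simp
    have "a + real m - 1 = real m + (a - 1)" by simp
    hence "x powr (a + real m - 1) = x ^ m * x powr (a - 1)"
      using x by (simp only: powr_add powr_realpow)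
    thus "x powr (a + real m - 1) * (1 - x) powr (b - 1) = x ^ m * (x powr (a - 1) * (1 - x) powr (b - 1))"
      by simp
  qed
qed

text \<open>The arguments add up to 1 + m, so the Gamma function in the denominator is a factorial.
  This is how the lower parameters 1 of the 3F2 series arise.\<close>

lemma Beta_shift_complement:
  fixes a :: real
  assumes "0 < a" "a < 1"
  shows "Beta (a + real m) (1 - a) = pochhammer a m / fact m * (Gamma a * Gamma (1 - a))"
proof -
  have a: "a \<notin> \<int>\<^sub>\<le>\<^sub>0" using assms by (auto elim!: nonpos_Ints_cases)
  have "Gamma a \<noteq> 0" using a by (simp add: Gamma_eq_zero_iff)
  hence "Gamma (a + real m) = pochhammer a m * Gamma a" using pochhammer_Gamma[OF a, of m] by simp
  moreover have "a + real m + (1 - a) = 1 + real m" by simp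
  ultimately show ?thesis
    by (simp only: Beta_def Gamma_fact) simp
qed

lemma Gamma_third_product: "Gamma (1/3) * Gamma (2/3 :: real) = 2 * pi / sqrt 3"
proof -
  have "complex_of_real (Gamma (1/3) * Gamma (2/3)) = Gamma (complex_of_real (1/3)) * Gamma (complex_of_real (2/3))"
    by (simp only: of_real_mult Gamma_complex_of_real)
  also have "complex_of_real (2/3) = 1 - complex_of_real (1/3)" by simp
  also have "Gamma (complex_of_real (1/3)) * Gamma (1 - complex_of_real (1/3)) =
               of_real pi / sin (of_real pi * complex_of_real (1/3))"
    by (rule Gamma_reflection_complex)
  also have "of_real pi * complex_of_real (1/3) = of_real (pi / 3)" by simp
  also have "of_real pi / sin (complex_of_real (pi / 3)) = of_real (pi / sin (pi / 3))"
    by (subst sin_of_real) (simp only: of_real_divide)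
  finally have "Gamma (1/3) * Gamma (2/3 :: real) = pi / sin (pi / 3)"
    by (simp only: of_real_eq_iff)
  thus ?thesis by (simp add: sin_60)
qed

text \<open>Gauss's value of 2F1(1/3, 1/3; 1; 1): the binomial series of (1 - x)^(-1/3) is
  integrated against the beta kernel with parameters 1/3 and 2/3, and the total is
  \<open>Beta (1/3) (1/3)\<close>.\<close>

lemma sums_square_binomial_third:
  "(\<lambda>n. (pochhammer (1/3) n / fact n) ^ 2) sums (Gamma (1/3) / Gamma (2/3 :: real) ^ 2)"
proof -
  define c :: "nat \<Rightarrow> real" where "c n = pochhammer (1/3) n / fact n" for n
  have c: "0 \<le> c n" for n unfolding c_def by (intro divide_nonneg_nonneg pochhammer_nonneg) auto
  have "(\<lambda>n. c n * Beta (1/3 + real n) (2/3)) sums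
      integral {0<..<1} (\<lambda>x. x powr (1/3 - 1) * (1 - x) powr (1/3 - 1))"
  proof (rule nonneg_series_integral)
    fix n
    show "((\<lambda>x. c n * (x ^ n * (x powr (1/3 - 1) * (1 - x) powr (2/3 - 1)))) has_integral
             c n * Beta (1/3 + real n) (2/3)) {0<..<1}"
      by (intro has_integral_mult_right has_integral_Beta_power) auto
  next
    fix x :: real assume x: "x \<in> {0<..<1}"
    have "(\<lambda>n. ((-1/3) gchoose n) * (- x) ^ n) sums (1 + - x) powr (- 1/3)"
      using x by (intro gen_binomial_real) auto
    also have "(\<lambda>n. ((-1/3) gchoose n) * (- x) ^ n) = (\<lambda>n. c n * x ^ n)"
    proof
      fix n
      have "(-1) ^ n * (- x) ^ n = x ^ n" by (simp flip: power_mult_distrib)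
      thus "((-1/3) gchoose n) * (- x) ^ n = c n * x ^ n"
        unfolding gbinomial_pochhammer c_def by (simp add: mult_ac)
    qed
    finally have "(\<lambda>n. c n * x ^ n) sums (1 - x) powr (- 1/3)" by simp
    hence "(\<lambda>n. c n * x ^ n * (x powr (1/3 - 1) * (1 - x) powr (2/3 - 1))) sums
             ((1 - x) powr (- 1/3) * (x powr (1/3 - 1) * (1 - x) powr (2/3 - 1)))"
      by (rule sums_mult2)
    moreover have "(1 - x) powr (- 1/3) * (x powr (1/3 - 1) * (1 - x) powr (2/3 - 1)) =
        x powr (1/3 - 1) * (1 - x) powr (1/3 - 1)"
    proof -
      have "(1 - x) powr (1/3 - 1) = (1 - x) powr (- 1/3) * (1 - x) powr (2/3 - 1)"
        by (subst powr_add [symmetric]) simp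
      thus ?thesis by simp
    qed
    ultimately show "(\<lambda>n. c n * (x ^ n * (x powr (1/3 - 1) * (1 - x) powr (2/3 - 1)))) sums
        (x powr (1/3 - 1) * (1 - x) powr (1/3 - 1))" by (simp only: mult.assoc)
  next
    show "(\<lambda>x::real. x powr (1/3 - 1) * (1 - x) powr (1/3 - 1)) integrable_on {0<..<1}"
      using has_integral_Beta_power[of "1/3" "1/3" 0] by (auto simp: integrable_on_def)
  qed (use c in auto)
  also have "integral {0<..<1} (\<lambda>x. x powr (1/3 - 1) * (1 - x) powr (1/3 - 1)) = Beta (1/3) (1/3 :: real)"
    using has_integral_Beta_power[of "1/3" "1/3" 0] by (intro integral_unique) simp
  also have "(\<lambda>n. c n * Beta (1/3 + real n) (2/3)) = (\<lambda>n. c n ^ 2 * (Gamma (1/3) * Gamma (2/3)))"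
    using Beta_shift_complement[of "1/3"] by (simp add: c_def power2_eq_square mult.assoc)
  finally have "(\<lambda>n. c n ^ 2 * (Gamma (1/3) * Gamma (2/3)) / (Gamma (1/3) * Gamma (2/3))) sums
      (Beta (1/3) (1/3) / (Gamma (1/3) * Gamma (2/3)))"
    by (rule sums_divide)
  moreover have "Gamma (1/3 :: real) > 0" "Gamma (2/3 :: real) > 0" by (auto intro: Gamma_real_pos)
  ultimately show ?thesis
    by (simp add: c_def Beta_def power2_eq_square)
qed

text \<open>The substitution v = \<open>expU (m * t)\<close>, used with m = 1 and, for the forms
  containing b(q^9), with m = 3. Integrability is carried from t, where rapid decay provides it, to
  v, where the kernel may be singular at the ends.\<close>

lemma expU_substitution:
  fixes \<phi> \<rho> :: "real \<Rightarrow> real"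
  assumes m: "0 < m" and \<phi>: "\<phi> absolutely_integrable_on {0<..}"
    and eq: "\<And>t. 0 < t \<Longrightarrow> \<phi> t = \<rho> (expU (m * t)) *
               (expU (m * t) * (1 - expU (m * t) ^ 3) * thX (exp (- (m * t))) ^ 2)"
  shows "\<rho> absolutely_integrable_on {0<..<1} \<and> integral {0<..<1} \<rho> = m * integral {0<..} \<phi>"
proof -
  define g' where "g' t = - (m * (expU (m * t) * (1 - expU (m * t) ^ 3) * thX (exp (- (m * t))) ^ 2))" for t
  have pos: "0 \<le> expU s * (1 - expU s ^ 3) * thX (exp (- s)) ^ 2" if "0 < s" for s
    using expU_bounds[OF that] by (intro mult_nonneg_nonneg) (auto simp: power_le_one)
  have img: "(\<lambda>t. expU (m * t)) ` {0<..} = {0<..<1}" and inj: "inj_on (\<lambda>t. expU (m * t)) {0<..}"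
  proof -
    have "bij_betw (\<lambda>t. m * t) {0<..} {0<..}"
      by (rule bij_betwI[of _ _ _ "\<lambda>t. t / m"]) (use m in auto)
    from bij_betw_trans[OF this bij_expU]
    have "bij_betw (\<lambda>t. expU (m * t)) {0<..} {0<..<1}" by (simp add: o_def)
    thus "(\<lambda>t. expU (m * t)) ` {0<..} = {0<..<1}" "inj_on (\<lambda>t. expU (m * t)) {0<..}"
      by (auto simp: bij_betw_def)
  qed
  have deriv: "((\<lambda>t. expU (m * t)) has_field_derivative g' t) (at t within {0<..})" if "t \<in> {0<..}" for t
  proof -
    have mt: "0 < m * t" using m that by simp
    have "((\<lambda>t. m * t) has_field_derivative m) (at t)" by (auto intro!: derivative_eq_intros)
    from DERIV_chain2[where f = expU and g = "\<lambda>t. m * t", OF expU_deriv[OF mt] this]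
    moreover have "- (expU (m * t) * (1 - expU (m * t) ^ 3) * thX (exp (- (m * t))) ^ 2) * m = g' t"
      by (simp add: g'_def)
    ultimately have "((\<lambda>t. expU (m * t)) has_field_derivative g' t) (at t)" by simp
    thus ?thesis by (rule has_field_derivative_at_within)
  qed
  have "(\<lambda>t. \<bar>g' t\<bar> * \<rho> (expU (m * t))) absolutely_integrable_on {0<..} \<and>
          integral {0<..} (\<lambda>t. \<bar>g' t\<bar> * \<rho> (expU (m * t))) = m * integral {0<..} \<phi> \<longleftrightarrow>
        \<rho> absolutely_integrable_on ((\<lambda>t. expU (m * t)) ` {0<..}) \<and>
          integral ((\<lambda>t. expU (m * t)) ` {0<..}) \<rho> = m * integral {0<..} \<phi>"
  proof (rule has_absolute_integral_change_of_variables_1'[OF _ deriv inj])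
    show "{0<..} \<in> sets (lebesgue :: real measure)" by simp
  qed
  moreover have E: "\<bar>g' t\<bar> * \<rho> (expU (m * t)) = m * \<phi> t" if "t \<in> {0<..}" for t
  proof -
    have "0 < m * t" using that m by simp
    hence "\<bar>g' t\<bar> = m * (expU (m * t) * (1 - expU (m * t) ^ 3) * thX (exp (- (m * t))) ^ 2)"
      unfolding g'_def abs_minus_cancel
      by (intro abs_of_nonneg mult_nonneg_nonneg[OF less_imp_le[OF m] pos])
    thus ?thesis using eq[of t] that by simp
  qed
  have "(\<lambda>t. \<bar>g' t\<bar> * \<rho> (expU (m * t))) absolutely_integrable_on {0<..} \<longleftrightarrow>
        (\<lambda>t. m * \<phi> t) absolutely_integrable_on {0<..}"
    by (intro set_integrable_cong refl E)
  moreover have "(\<lambda>t. m * \<phi> t) absolutely_integrable_on {0<..}"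
    by (intro set_integrable_mult_right \<phi>)
  moreover have "integral {0<..} (\<lambda>t. \<bar>g' t\<bar> * \<rho> (expU (m * t))) = integral {0<..} (\<lambda>t. m * \<phi> t)"
    by (rule Henstock_Kurzweil_Integration.integral_cong) (rule E)
  ultimately show ?thesis unfolding img by simp
qed

lemma cube_substitution:
  fixes \<sigma> \<rho> :: "real \<Rightarrow> real"
  assumes "\<rho> absolutely_integrable_on {0<..<1}"
    and eq: "\<And>v. 0 < v \<Longrightarrow> v < 1 \<Longrightarrow> \<rho> v = 3 * v ^ 2 * \<sigma> (v ^ 3)"
  shows "\<sigma> absolutely_integrable_on {0<..<1} \<and> integral {0<..<1} \<sigma> = integral {0<..<1} \<rho>"
proof -
  have bij: "bij_betw (\<lambda>v::real. v ^ 3) {0<..<1} {0<..<1}"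
    by (rule bij_betwI[of _ _ _ "root 3"])
       (auto simp: power_less_one_iff real_root_power_cancel odd_real_root_power_cancel odd_real_root_pow)
  hence img: "(\<lambda>v::real. v ^ 3) ` {0<..<1} = {0<..<1}" and inj: "inj_on (\<lambda>v::real. v ^ 3) {0<..<1}"
    by (auto simp: bij_betw_def)
  have "(\<lambda>v. \<bar>3 * v ^ 2\<bar> * \<sigma> (v ^ 3)) absolutely_integrable_on {0<..<1} \<and>
          integral {0<..<1} (\<lambda>v. \<bar>3 * v ^ 2\<bar> * \<sigma> (v ^ 3)) = integral {0<..<1} \<rho> \<longleftrightarrow>
        \<sigma> absolutely_integrable_on ((\<lambda>v. v ^ 3) ` {0<..<1}) \<and>
          integral ((\<lambda>v. v ^ 3) ` {0<..<1}) \<sigma> = integral {0<..<1} \<rho>"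
    by (rule has_absolute_integral_change_of_variables_1'[OF _ _ inj])
       (auto intro!: derivative_eq_intros)
  moreover have E: "\<bar>3 * v ^ 2\<bar> * \<sigma> (v ^ 3) = \<rho> v" if "v \<in> {0<..<1}" for v
    using eq[of v] that by simp
  have "(\<lambda>v. \<bar>3 * v ^ 2\<bar> * \<sigma> (v ^ 3)) absolutely_integrable_on {0<..<1} \<longleftrightarrow>
        \<rho> absolutely_integrable_on {0<..<1}"
    by (intro set_integrable_cong refl E)
  moreover have "integral {0<..<1} (\<lambda>v. \<bar>3 * v ^ 2\<bar> * \<sigma> (v ^ 3)) = integral {0<..<1} \<rho>"
    by (rule Henstock_Kurzweil_Integration.integral_cong) (rule E)
  ultimately show ?thesis unfolding img using assms(1) by blast
qed

lemma thX_exp_eq: "0 < t \<Longrightarrow> thX (exp (- t)) = cubic_F (expU t ^ 3)"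
  unfolding expU_def by (rule thX_eq_cubic_F) auto

text \<open>For x = U^3 one has dx = - 3 x (1 - x) X^2 dt. Two of the three factors X are absorbed,
  and the third is \<open>cubic_F x\<close>, integrated termwise against x^(a - 1) (1 - x)^(b -
  1).\<close>

lemma cubic_integral_series:
  fixes \<phi> :: "real \<Rightarrow> real"
  assumes \<phi>: "\<phi> absolutely_integrable_on {0<..}" and a: "0 < a" and b: "0 < b" and \<kappa>: "0 \<le> \<kappa>"
    and eq: "\<And>t. 0 < t \<Longrightarrow> \<phi> t = 3 * \<kappa> * thX (exp (- t)) ^ 3 * expU t powr (3 * a) * (1 - expU t ^ 3) powr b"
  shows "(\<lambda>n. \<kappa> * cubic_coeff n * Beta (a + real n) b) sums integral {0<..} \<phi>"
proof -
  define \<sigma> where "\<sigma> x = \<kappa> * cubic_F x * (x powr (a - 1) * (1 - x) powr (b - 1))" for x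
  define \<rho> where "\<rho> v = 3 * v ^ 2 * \<sigma> (v ^ 3)" for v
  have "\<rho> absolutely_integrable_on {0<..<1} \<and> integral {0<..<1} \<rho> = 1 * integral {0<..} \<phi>"
  proof (rule expU_substitution[OF _ \<phi>])
    fix t :: real assume t: "0 < t"
    define v where "v = expU t"
    have v: "0 < v" "v < 1" using expU_bounds[OF t] by (simp_all add: v_def)
    have v3: "0 < 1 - v ^ 3" using v by (simp add: power_less_one_iff)
    have 1: "(v ^ 3) powr (a - 1) * v ^ 3 = v powr (3 * a)"
    proof -
      have "(v ^ 3) powr (a - 1) * (v ^ 3) powr 1 = (v ^ 3) powr a"
        by (subst powr_add [symmetric]) simp
      moreover have "(v ^ 3) powr a = v powr (3 * a)"
        using v by (simp add: powr_powr flip: powr_numeral)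
      ultimately show ?thesis using v by simp
    qed
    have 2: "(1 - v ^ 3) powr (b - 1) * (1 - v ^ 3) = (1 - v ^ 3) powr b"
    proof -
      have "(1 - v ^ 3) powr (b - 1) * (1 - v ^ 3) powr 1 = (1 - v ^ 3) powr b"
        by (subst powr_add [symmetric]) simp
      thus ?thesis using v3 by simp
    qed
    have X: "cubic_F (v ^ 3) = thX (exp (- t))" unfolding v_def by (rule thX_exp_eq[OF t, symmetric])
    have "\<rho> v * (v * (1 - v ^ 3) * thX (exp (- t)) ^ 2) =
        3 * \<kappa> * thX (exp (- t)) ^ 3 * ((v ^ 3) powr (a - 1) * v ^ 3) * ((1 - v ^ 3) powr (b - 1) * (1 - v ^ 3))"
      unfolding \<rho>_def \<sigma>_def X by (simp add: power2_eq_square power3_eq_cube)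
    also have "\<dots> = \<phi> t" unfolding 1 2 using eq[OF t] by (simp add: v_def)
    finally show "\<phi> t = \<rho> (expU (1 * t)) * (expU (1 * t) * (1 - expU (1 * t) ^ 3) * thX (exp (- (1 * t))) ^ 2)"
      by (simp add: v_def)
  qed simp
  moreover from this have "\<sigma> absolutely_integrable_on {0<..<1} \<and> integral {0<..<1} \<sigma> = integral {0<..<1} \<rho>"
    by (intro cube_substitution) (auto simp: \<rho>_def)
  ultimately have \<sigma>: "\<sigma> integrable_on {0<..<1}" "integral {0<..<1} \<sigma> = integral {0<..} \<phi>"
    using set_lebesgue_integral_eq_integral(1) by auto
  have "(\<lambda>n. \<kappa> * cubic_coeff n * Beta (a + real n) b) sums integral {0<..<1} \<sigma>"
  proof (rule nonneg_series_integral[OF _ _ _ \<sigma>(1)])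
    show "((\<lambda>x. \<kappa> * cubic_coeff n * (x ^ n * (x powr (a - 1) * (1 - x) powr (b - 1)))) has_integral
             \<kappa> * cubic_coeff n * Beta (a + real n) b) {0<..<1}" for n
      by (intro has_integral_mult_right has_integral_Beta_power a b)
    show "(\<lambda>n. \<kappa> * cubic_coeff n * (x ^ n * (x powr (a - 1) * (1 - x) powr (b - 1)))) sums \<sigma> x"
      if "x \<in> {0<..<1}" for x
    proof -
      have "(\<lambda>n. \<kappa> * (cubic_coeff n * x ^ n) * (x powr (a - 1) * (1 - x) powr (b - 1))) sums \<sigma> x"
        unfolding \<sigma>_def using that by (intro sums_mult sums_mult2 cubic_F_sums) auto
      thus ?thesis by (simp add: mult.assoc)
    qed
  qed (use \<kappa> cubic_coeff_nonneg in auto)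
  thus ?thesis using \<sigma>(2) by simp
qed

text \<open>Here the variable is v = U at 3 t, without cubing. The factor 1 + v + v^2 cancels
  against 1 - v^3 in the Jacobian, and the moments of \<open>cubic_F (v ^ 3)\<close> have index 3 n.
  The final division by 3 undoes the factor m = 3 of the substitution.\<close>

lemma cubic_integral_series':
  fixes \<phi> :: "real \<Rightarrow> real"
  assumes \<phi>: "\<phi> absolutely_integrable_on {0<..}" and a: "0 < a" and b: "0 < b" and \<kappa>: "0 \<le> \<kappa>"
    and eq: "\<And>t. 0 < t \<Longrightarrow> \<phi> t = 3 * \<kappa> * thX (exp (- (3 * t))) ^ 3 * expU (3 * t) powr a *
               (1 + expU (3 * t) + expU (3 * t) ^ 2) * (1 - expU (3 * t)) powr b"
  shows "(\<lambda>n. \<kappa> * cubic_coeff n * Beta (a + real (3 * n)) b) sums integral {0<..} \<phi>"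
proof -
  define \<rho> where "\<rho> v = 3 * \<kappa> * cubic_F (v ^ 3) * (v powr (a - 1) * (1 - v) powr (b - 1))" for v
  have "\<rho> absolutely_integrable_on {0<..<1} \<and> integral {0<..<1} \<rho> = 3 * integral {0<..} \<phi>"
  proof (rule expU_substitution[OF _ \<phi>])
    fix t :: real assume t: "0 < t"
    hence t3: "0 < 3 * t" by simp
    define v where "v = expU (3 * t)"
    have v: "0 < v" "v < 1" using expU_bounds[OF t3] by (simp_all add: v_def)
    have 1: "w powr (c - 1) * w = w powr c" if "0 < w" for w c :: real
    proof -
      have "w powr (c - 1) * w powr 1 = w powr c" by (subst powr_add [symmetric]) simp
      thus ?thesis using that by simp
    qed
    have X: "cubic_F (v ^ 3) = thX (exp (- (3 * t)))"
      unfolding v_def by (rule thX_exp_eq[OF t3, symmetric])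
    have f: "1 - v ^ 3 = (1 - v) * (1 + v + v ^ 2)"
      by (simp add: power2_eq_square power3_eq_cube algebra_simps)
    have "\<rho> v * (v * (1 - v ^ 3) * thX (exp (- (3 * t))) ^ 2) =
        3 * \<kappa> * thX (exp (- (3 * t))) ^ 3 * (v powr (a - 1) * v) * (1 + v + v ^ 2) *
           ((1 - v) powr (b - 1) * (1 - v))"
      unfolding \<rho>_def X f by (simp only: power2_eq_square power3_eq_cube mult_ac)
    also have "\<dots> = \<phi> t" using v eq[OF t] by (simp add: 1 v_def)
    finally show "\<phi> t = \<rho> (expU (3 * t)) * (expU (3 * t) * (1 - expU (3 * t) ^ 3) * thX (exp (- (3 * t))) ^ 2)"
      by (simp add: v_def)
  qed simp
  hence \<rho>: "\<rho> integrable_on {0<..<1}" "integral {0<..<1} \<rho> = 3 * integral {0<..} \<phi>"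
    using set_lebesgue_integral_eq_integral(1) by auto
  have "(\<lambda>n. 3 * \<kappa> * cubic_coeff n * Beta (a + real (3 * n)) b) sums integral {0<..<1} \<rho>"
  proof (rule nonneg_series_integral[OF _ _ _ \<rho>(1)])
    show "((\<lambda>x. 3 * \<kappa> * cubic_coeff n * (x ^ (3 * n) * (x powr (a - 1) * (1 - x) powr (b - 1)))) has_integral
             3 * \<kappa> * cubic_coeff n * Beta (a + real (3 * n)) b) {0<..<1}" for n
      by (intro has_integral_mult_right has_integral_Beta_power a b)
    show "(\<lambda>n. 3 * \<kappa> * cubic_coeff n * (x ^ (3 * n) * (x powr (a - 1) * (1 - x) powr (b - 1)))) sums \<rho> x"
      if "x \<in> {0<..<1}" for x
    proof -
      have "(\<lambda>n. 3 * \<kappa> * (cubic_coeff n * (x ^ 3) ^ n) * (x powr (a - 1) * (1 - x) powr (b - 1))) sums \<rho> x"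
        unfolding \<rho>_def using that
        by (intro sums_mult sums_mult2 cubic_F_sums) (auto simp: power_less_one_iff)
      thus ?thesis by (simp add: mult.assoc power_mult)
    qed
  qed (use \<kappa> cubic_coeff_nonneg in auto)
  from sums_divide[OF this, of 3] show ?thesis using \<rho>(2) by (simp add: mult.assoc)
qed

section \<open>The five forms\<close>

lemma borwein_a_cube:
  assumes "0 < q" "q < 1" shows "borwein_a (q ^ 3) = of_real (thX q)"
proof -
  have q3: "0 \<le> q ^ 3" "q ^ 3 < 1" using assms by (auto simp: power_less_one_iff)
  have e: "(q ^ 3) powi (fst p ^ 2 + fst p * snd p + snd p ^ 2) = (q ^ 3) ^ eis_norm p" for p
    by (simp only: int_eis_norm [symmetric] power_int_of_nat)
  have "((\<lambda>p. complex_of_real ((q ^ 3) ^ eis_norm p)) has_sum of_real (eis_theta UNIV (q ^ 3))) UNIV"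
    using eis_theta_has_sum[OF q3, of UNIV] by (simp only: has_sum_of_real_iff)
  from infsumI[OF this] show ?thesis
    unfolding borwein_a_def thX_eq_UNIV case_prod_unfold e .
qed

lemma borwein_c_cube:
  assumes "0 < q" "q < 1" shows "borwein_c (q ^ 3) = of_real (thY q)"
proof -
  have e: "(q ^ 3) powr ((of_int (fst p) + 1/3) ^ 2 + (of_int (fst p) + 1/3) * (of_int (snd p) + 1/3) +
             (of_int (snd p) + 1/3) ^ 2) = q ^ eis_norm (eis_shift p)" for p
  proof -
    have "real (eis_norm (eis_shift p)) = of_int (int (eis_norm (eis_shift p)))" by simp
    also have "\<dots> = 3 * ((of_int (fst p) + 1/3) ^ 2 + (of_int (fst p) + 1/3) * (of_int (snd p) + 1/3) +
             (of_int (snd p) + 1/3) ^ 2)"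
      unfolding int_eis_norm eis_shift_def by (simp add: power2_eq_square field_simps)
    finally have "q ^ eis_norm (eis_shift p) = q powr (3 * ((of_int (fst p) + 1/3) ^ 2 +
        (of_int (fst p) + 1/3) * (of_int (snd p) + 1/3) + (of_int (snd p) + 1/3) ^ 2))"
      using assms by (simp only: powr_realpow [symmetric])
    thus ?thesis using assms by (simp only: powr_powr [symmetric] powr_numeral)
  qed
  have "((\<lambda>p. complex_of_real (q ^ eis_norm p)) has_sum of_real (eis_theta (eis_class 1) q)) (eis_class 1)"
    using eis_theta_has_sum[of q "eis_class 1"] assms by (simp only: has_sum_of_real_iff)
  hence "((\<lambda>p. complex_of_real (q ^ eis_norm (eis_shift p))) has_sum of_real (thY q)) UNIV"
    unfolding thY_def
    by (subst has_sum_reindex_bij_betw[OF bij_eis_shift, where f = "\<lambda>p. complex_of_real (q ^ eis_norm p)"])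
  from infsumI[OF this] show ?thesis
    unfolding borwein_c_def case_prod_unfold e .
qed

text \<open>The weight \<omega>^(n - m) depends only on the residue class, and the two nonzero
  classes together carry \<omega> + \<omega>^2 = - 1.\<close>

lemma borwein_b_eq:
  fixes \<omega> :: complex
  assumes \<omega>: "\<omega> ^ 3 = 1" "\<omega> \<noteq> 1" and q: "0 < q" "q < 1"
  shows "borwein_b \<omega> q = of_real (thX q - thY q)"
proof -
  have \<omega>0: "\<omega> \<noteq> 0" using \<omega>(1) by auto
  have sum0: "1 + \<omega> + \<omega> ^ 2 = 0"
  proof -
    have "(\<omega> - 1) * (1 + \<omega> + \<omega> ^ 2) = \<omega> ^ 3 - 1"
      by (simp add: power2_eq_square power3_eq_cube algebra_simps)
    thus ?thesis using \<omega> by simp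
  qed
  have e: "q powi (fst p ^ 2 + fst p * snd p + snd p ^ 2) = q ^ eis_norm p" for p
    by (simp only: int_eis_norm [symmetric] power_int_of_nat)
  have pw: "\<omega> powi (fst p - snd p) = \<omega> ^ nat j" if "p \<in> eis_class j" for p j
  proof -
    define d where "d = fst p - snd p"
    have j: "d mod 3 = j" using that by (simp add: eis_class_def d_def)
    hence "0 \<le> j" by auto
    have "\<omega> powi d = \<omega> powi (3 * (d div 3) + j)" using j by (metis mult_div_mod_eq)
    also have "\<dots> = (\<omega> powi 3) powi (d div 3) * \<omega> powi j"
      using \<omega>0 by (simp only: power_int_add power_int_mult simp_thms)
    also have "\<dots> = \<omega> ^ nat j" using \<omega>(1) \<open>0 \<le> j\<close> by (simp add: power_int_nonneg_exp)
    finally show ?thesis by (simp add: d_def)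
  qed
  have part: "((\<lambda>p. \<omega> powi (fst p - snd p) * complex_of_real (q ^ eis_norm p)) has_sum
               \<omega> ^ nat j * of_real (eis_theta (eis_class j) q)) (eis_class j)" for j
  proof -
    have "((\<lambda>p. complex_of_real (q ^ eis_norm p)) has_sum of_real (eis_theta (eis_class j) q)) (eis_class j)"
      using eis_theta_has_sum[of q "eis_class j"] q by (simp only: has_sum_of_real_iff)
    from has_sum_cmult_right[OF this, of "\<omega> ^ nat j"] show ?thesis
      by (rule has_sum_cong[THEN iffD1, rotated]) (simp add: pw)
  qed
  have "((\<lambda>p. \<omega> powi (fst p - snd p) * complex_of_real (q ^ eis_norm p)) has_sum
          (\<omega> ^ nat 0 * of_real (eis_theta (eis_class 0) q) +
           (\<omega> ^ nat 1 * of_real (eis_theta (eis_class 1) q) +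
            \<omega> ^ nat 2 * of_real (eis_theta (eis_class 2) q)))) (eis_class 0 \<union> (eis_class 1 \<union> eis_class 2))"
    by (intro has_sum_Un_disjoint part) (auto simp: eis_class_def)
  hence "borwein_b \<omega> q = of_real (thX q) + (\<omega> * of_real (thY q) + \<omega> ^ 2 * of_real (thY q))"
    unfolding borwein_b_def case_prod_unfold e eis_class_partition [symmetric]
    by (simp add: infsumI eis_theta_class_2 thX_def thY_def)
  also have "\<dots> = of_real (thX q) + (1 + \<omega> + \<omega> ^ 2) * of_real (thY q) - of_real (thY q)"
    by (simp add: algebra_simps)
  finally show ?thesis by (simp add: sum0)
qed

lemma borwein_b_cube:
  fixes \<omega> :: complex
  assumes "\<omega> ^ 3 = 1" "\<omega> \<noteq> 1" "0 < q" "q < 1"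
  shows "borwein_b \<omega> (q ^ 3) = of_real (thZ q)"
  using borwein_b_eq[of \<omega> "q ^ 3"] assms by (simp add: thZ_def power_less_one_iff)

lemma borwein_b_ninth:
  fixes \<omega> :: complex
  assumes "\<omega> ^ 3 = 1" "\<omega> \<noteq> 1" "0 < q" "q < 1"
  shows "borwein_b \<omega> (q ^ 9) = of_real (thZ (q ^ 3))"
  using borwein_b_cube[of \<omega> "q ^ 3"] assms by (simp add: power_less_one_iff flip: power_mult)

section \<open>The forms satisfy the hypotheses of the Mellin argument\<close>

lemma has_L_value_cong:
  assumes "has_L_value k f s v" "\<And>q. 0 < q \<Longrightarrow> q < 1 \<Longrightarrow> f q = g q"
  shows   "has_L_value k g s v"
proof -
  have "has_q_expansion f = has_q_expansion g"
    unfolding has_q_expansion_def using assms(2) by auto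
  thus ?thesis using assms(1) unfolding has_L_value_def is_L_function_def by simp
qed

lemma growth_series_thX: "\<exists>a. growth_series 1 thX a"
  using growth_series_theta[of "eis_class 0"] unfolding thX_def by blast

lemma growth_series_thY: "\<exists>a. growth_series 1 thY a \<and> a 0 = 0"
  using growth_series_theta[of "eis_class 1"] eis_count_Y_0 unfolding thY_def by blast

lemma growth_series_thZ: "\<exists>a. growth_series 1 thZ a"
proof -
  have "growth_series 1 (\<lambda>q. thX (q ^ 3) - thY (q ^ 3))
     (\<lambda>n. (if 3 dvd n then eis_count (eis_class 0) (n div 3) else 0) -
          (if 3 dvd n then eis_count (eis_class 1) (n div 3) else 0))"
    unfolding thX_def thY_def
    by (intro growth_series_diff growth_series_cube growth_series_theta)
  thus ?thesis unfolding thZ_def[abs_def] by blast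
qed

lemma growth_series_thZ_cube: "\<exists>a. growth_series 1 (\<lambda>q. thZ (q ^ 3)) a"
  using growth_series_thZ growth_series_cube[of 1 thZ] by blast

lemma thY_bounds:
  assumes "0 < t" "t \<le> 3" shows "\<bar>thY (exp (- t))\<bar> \<le> 8 * (1 + pi) ^ 2 / t"
  using thX_upper[OF assms] thY_less_thX[of "exp (- t)"] thY_pos[of "exp (- t)"] assms by simp

lemma thZ_le_thX:
  assumes "0 < q" "q < 1" shows "thZ q \<le> thX q"
proof -
  have "(1 - thU q ^ 3) powr (1/3) \<le> 1"
    using thU_bounds[OF assms] by (intro powr_le1) (auto simp: power_le_one)
  hence "thX q * (1 - thU q ^ 3) powr (1/3) \<le> thX q * 1"
    using thX_ge_1[of q] assms by (intro mult_left_mono) auto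
  thus ?thesis using thZ_eq[OF assms] by simp
qed

lemma thZ_bounds:
  assumes "0 < t" "t \<le> 3" shows "\<bar>thZ (exp (- t))\<bar> \<le> 8 * (1 + pi) ^ 2 / t"
  using thX_upper[OF assms] thZ_le_thX[of "exp (- t)"] thZ_pos[of "exp (- t)"] assms by simp

lemma thX_bounds:
  assumes "0 < t" "t \<le> 3" shows "\<bar>thX (exp (- t))\<bar> \<le> 8 * (1 + pi) ^ 2 / t"
  using thX_upper[OF assms] thX_ge_1[of "exp (- t)"] assms by simp

lemma exp_minus_cubed: "exp (- t) ^ 3 = exp (- (3 * t :: real))"
  by (simp flip: exp_of_nat_mult)

lemma thZ_cube_bounds:
  assumes "0 < t" "t \<le> 1" shows "\<bar>thZ (exp (- t) ^ 3)\<bar> \<le> 8 * (1 + pi) ^ 2 / t"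
proof -
  have "\<bar>thZ (exp (- (3 * t)))\<bar> \<le> 8 * (1 + pi) ^ 2 / (3 * t)"
    using assms by (intro thZ_bounds) auto
  also have "\<dots> \<le> 8 * (1 + pi) ^ 2 / t"
    using assms by (intro divide_left_mono) auto
  finally show ?thesis unfolding exp_minus_cubed .
qed

lemma thZ_cube_rapid: "\<exists>C. \<forall>t. 0 < t \<longrightarrow> t \<le> 1 \<longrightarrow> thZ (exp (- t) ^ 3) \<le> C * t ^ n"
proof -
  from thZ_rapid[of n] obtain C where
    C: "\<forall>t. 0 < t \<longrightarrow> t \<le> 3 \<longrightarrow> thZ (exp (- t)) \<le> C * t ^ n" by (elim exE)
  have "thZ (exp (- t) ^ 3) \<le> (C * 3 ^ n) * t ^ n" if "0 < t" "t \<le> 1" for t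
    using C[rule_format, of "3 * t"] that unfolding exp_minus_cubed
    by (simp add: power_mult_distrib mult.assoc)
  thus ?thesis by blast
qed

text \<open>Every form is a multiple of Y g h. The factor Y removes the constant term, h is a factor
  b with rapid decay, and Y and g cost one power of 1 / t each; hence the exponent
  \<open>n + 2\<close> in the proof.\<close>

lemma rapid_seriesI:
  fixes g h :: "real \<Rightarrow> real" and \<kappa> :: real
  assumes series: "\<exists>b. growth_series 1 g b" "\<exists>c. growth_series 1 h c"
    and g: "\<And>t. 0 < t \<Longrightarrow> t \<le> 1 \<Longrightarrow> \<bar>g (exp (- t))\<bar> \<le> 8 * (1 + pi) ^ 2 / t"
    and h: "\<And>n. \<exists>C. \<forall>t. 0 < t \<longrightarrow> t \<le> 1 \<longrightarrow> h (exp (- t)) \<le> C * t ^ n"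
    and h0: "\<And>q. 0 < q \<Longrightarrow> q < 1 \<Longrightarrow> 0 < h q"
  shows "\<exists>a. rapid_series (\<lambda>q. \<kappa> * (thY q * g q * h q)) a"
proof -
  obtain y where y: "growth_series 1 thY y" "y 0 = 0" using growth_series_thY by blast
  obtain b where b: "growth_series 1 g b" using series(1) by blast
  obtain c where c: "growth_series 1 h c" using series(2) by blast
  define a where "a n = \<kappa> * (\<Sum>i\<le>n. (\<Sum>j\<le>i. y j * b (i - j)) * c (n - i))" for n
  have a: "growth_series 3 (\<lambda>q. \<kappa> * (thY q * g q * h q)) a"
    using growth_series_cmult[OF growth_series_mult[OF growth_series_mult[OF y(1) b] c], of \<kappa>]
    by (simp add: a_def[abs_def] numeral_3_eq_3)
  have "rapid_series (\<lambda>q. \<kappa> * (thY q * g q * h q)) a"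
  proof
    show "growth_series 3 (\<lambda>q. \<kappa> * (thY q * g q * h q)) a" by (rule a)
    show "a 0 = 0" by (simp add: a_def y)
    fix n
    from h[of "n + 2"] obtain C where
      C: "\<forall>t. 0 < t \<longrightarrow> t \<le> 1 \<longrightarrow> h (exp (- t)) \<le> C * t ^ (n + 2)" by (elim exE)
    define K where "K = 8 * (1 + pi) ^ 2"
    have K: "0 \<le> K" by (simp add: K_def)
    have "\<bar>\<kappa> * (thY (exp (- t)) * g (exp (- t)) * h (exp (- t)))\<bar> \<le> (\<bar>\<kappa>\<bar> * K ^ 2 * C) * t ^ n"
      if t: "0 < t" "t \<le> 1" for t
    proof -
      have "\<bar>\<kappa> * (thY (exp (- t)) * g (exp (- t)) * h (exp (- t)))\<bar> =
            \<bar>\<kappa>\<bar> * (\<bar>thY (exp (- t))\<bar> * \<bar>g (exp (- t))\<bar> * h (exp (- t)))"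
        using h0[of "exp (- t)"] t by (simp add: abs_mult)
      also have "\<dots> \<le> \<bar>\<kappa>\<bar> * ((K / t) * (K / t) * (C * t ^ (n + 2)))"
        using thY_bounds[of t] g[OF t] C[rule_format, OF t] h0[of "exp (- t)"] t K unfolding K_def [symmetric]
        by (intro mult_left_mono mult_mono) auto
      also have "\<dots> = (\<bar>\<kappa>\<bar> * K ^ 2 * C) * t ^ n"
        using t by (simp add: power2_eq_square power_add)
      finally show ?thesis .
    qed
    thus "\<exists>C. \<forall>t. 0 < t \<longrightarrow> t \<le> 1 \<longrightarrow>
        \<bar>\<kappa> * (thY (exp (- t)) * g (exp (- t)) * h (exp (- t)))\<bar> \<le> C * t ^ n" by blast
  qed
  thus ?thesis by blast
qed

text \<open>The evaluation of the integral may presuppose absolute integrability, since the locale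
  provides it.\<close>

lemma rapid_L_value:
  assumes "\<exists>a. rapid_series f a"
    and "\<And>q. 0 < q \<Longrightarrow> q < 1 \<Longrightarrow> of_real (f q) = F q"
    and "(\<lambda>t. f (exp (- t))) absolutely_integrable_on {0<..} \<Longrightarrow> integral {0<..} (\<lambda>t. f (exp (- t))) = v"
  shows "has_L_value 3 F 1 (of_real v)"
proof -
  obtain a where "rapid_series f a" using assms(1) by blast
  then interpret rapid_series f a .
  show ?thesis
    using has_L_value_cong[OF has_L_value_1, of F] assms(2) assms(3)[OF f_absolutely_integrable] by simp
qed

lemma thY_exp: "0 < t \<Longrightarrow> thY (exp (- t)) = thX (exp (- t)) * expU t"
  using thX_ge_1[of "exp (- t)"] by (simp add: expU_def thU_def)

lemma thZ_exp: "0 < t \<Longrightarrow> thZ (exp (- t)) = thX (exp (- t)) * (1 - expU t ^ 3) powr (1/3)"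
  unfolding expU_def by (rule thZ_eq) auto

lemma powr_third_power:
  assumes "0 \<le> (x::real)"
  shows "(x powr (1/3)) ^ 2 = x powr (2/3)" "(x powr (1/3)) ^ 3 = x"
proof -
  have "(x powr (1/3)) ^ 2 = x powr (1/3) * x powr (1/3)" by (simp only: power2_eq_square)
  also have "\<dots> = x powr (2/3)" by (subst powr_add [symmetric]) simp
  finally show *: "(x powr (1/3)) ^ 2 = x powr (2/3)" .
  have "(x powr (1/3)) ^ 3 = (x powr (1/3)) ^ 2 * x powr (1/3)" by (simp only: power2_eq_square power3_eq_cube)
  also have "\<dots> = x powr 1" unfolding * by (subst powr_add [symmetric]) simp
  finally show "(x powr (1/3)) ^ 3 = x" using assms by simp
qed

lemma thZ_exp_cube:
  assumes t: "0 < t"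
  shows "thZ (exp (- t) ^ 3) = thX (exp (- (3 * t))) *
    ((1 - expU (3 * t)) powr (1/3) * (1 + expU (3 * t) + expU (3 * t) ^ 2) powr (1/3))"
proof -
  have "1 - expU (3 * t) ^ 3 = (1 - expU (3 * t)) * (1 + expU (3 * t) + expU (3 * t) ^ 2)"
    by (simp add: power2_eq_square power3_eq_cube algebra_simps)
  thus ?thesis using thZ_exp[of "3 * t"] t by (simp add: exp_minus_cubed powr_mult)
qed

text \<open>The real cube root of \<open>thY_cube\<close>, legitimate because both sides are
  positive. Together with \<open>thZ_exp_cube\<close> it expresses the last two forms through U at 3
  t.\<close>

lemma thY_exp_cube:
  assumes t: "0 < t"
  shows "thY (exp (- t)) = thX (exp (- (3 * t))) *
    (9 powr (1/3) * expU (3 * t) powr (1/3) * (1 + expU (3 * t) + expU (3 * t) ^ 2) powr (1/3))"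
proof -
  define v where "v = expU (3 * t)"
  define x where "x = thX (exp (- (3 * t)))"
  have v: "0 < v" using expU_bounds[of "3 * t"] t by (simp add: v_def)
  have x: "0 < x" using thX_ge_1[of "exp (- (3 * t))"] t by (simp add: x_def)
  have y: "thY (exp (- t) ^ 3) = x * v"
    using thY_exp[of "3 * t"] t by (simp add: x_def v_def exp_minus_cubed)
  have "thY (exp (- t)) ^ 3 = 9 * (x * v) * (x ^ 2 + x * (x * v) + (x * v) ^ 2)"
    using thY_cube[of "exp (- t)"] t y by (simp add: x_def exp_minus_cubed)
  also have "\<dots> = x ^ 3 * (9 * v * (1 + v + v ^ 2))"
    by (simp add: power2_eq_square power3_eq_cube algebra_simps)
  also have "\<dots> = (x * (9 powr (1/3) * v powr (1/3) * (1 + v + v ^ 2) powr (1/3))) ^ 3"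
    using v by (simp add: power_mult_distrib powr_third_power)
  finally have "thY (exp (- t)) ^ 3 = (x * (9 powr (1/3) * v powr (1/3) * (1 + v + v ^ 2) powr (1/3))) ^ 3" .
  thus ?thesis unfolding v_def [symmetric] x_def [symmetric]
    by (rule power_eq_imp_eq_base) (use thY_pos[of "exp (- t)"] t x in auto)
qed

lemma pochhammer_triple:
  fixes a :: real
  shows "pochhammer a (3 * n) =
    27 ^ n * (pochhammer (a / 3) n * pochhammer ((a + 1) / 3) n * pochhammer ((a + 2) / 3) n)"
proof (induction n)
  case (Suc n)
  have "pochhammer a (3 * Suc n) =
      pochhammer a (3 * n) * (a + 3 * real n) * (a + 3 * real n + 1) * (a + 3 * real n + 2)"
  proof -
    have "3 * Suc n = Suc (Suc (Suc (3 * n)))" by simp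
    thus ?thesis by (simp only: pochhammer_Suc) (simp add: add_ac)
  qed
  also have "(a + 3 * real n) = 3 * (a / 3 + real n)" by simp
  also have "3 * (a / 3 + real n) + 1 = 3 * ((a + 1) / 3 + real n)" by simp
  also have "3 * (a / 3 + real n) + 2 = 3 * ((a + 2) / 3 + real n)" by simp
  finally have "pochhammer a (3 * Suc n) = 27 ^ n * (pochhammer (a / 3) n * pochhammer ((a + 1) / 3) n *
      pochhammer ((a + 2) / 3) n) * (3 * (a / 3 + real n)) * (3 * ((a + 1) / 3 + real n)) *
      (3 * ((a + 2) / 3 + real n))" by (simp only: Suc.IH)
  moreover have "K * (P * Q * R) * (3 * x) * (3 * y) * (3 * z) = 27 * K * ((P * x) * (Q * y) * (R * z))"
    for K P Q R x y z :: real by simp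
  ultimately show ?case by (simp only: pochhammer_Suc power_Suc)
qed simp

text \<open>By triplication (3 n)! = 27^n (1/3)_n (2/3)_n n!. The powers of 27 cancel, and the two
  Pochhammer symbols cancel the numerator of \<open>cubic_coeff n\<close>.\<close>

lemma cubic_coeff_pochhammer_triple:
  "cubic_coeff n * (pochhammer a (3 * n) / fact (3 * n)) =
     pochhammer (a / 3) n * pochhammer ((a + 1) / 3) n * pochhammer ((a + 2) / 3) n / fact n ^ 3"
proof -
  have "fact (3 * n) = (27 ^ n * (pochhammer (1/3) n * pochhammer (2/3) n * fact n) :: real)"
    unfolding pochhammer_fact using pochhammer_triple[of 1 n] by simp
  moreover have "pochhammer (1/3) n \<noteq> (0::real)" "pochhammer (2/3) n \<noteq> (0::real)"
    using pochhammer_pos[of "1/3::real" n] pochhammer_pos[of "2/3::real" n] by auto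
  ultimately show ?thesis
    unfolding pochhammer_triple cubic_coeff_def by (simp add: power2_eq_square power3_eq_cube)
qed

lemma hypergeometric_3F2_eq_suminf:
  "hypergeometric_3F2 a b c 1 1 1 = (\<Sum>n. pochhammer a n * pochhammer b n * pochhammer c n / fact n ^ 3)"
  unfolding hypergeometric_3F2_def
  by (simp add: pochhammer_fact [symmetric] power3_eq_cube)

lemma hypergeometric_value:
  assumes "(\<lambda>n. \<kappa> * (pochhammer a n * pochhammer b n * pochhammer c n / fact n ^ 3)) sums v" "\<kappa> \<noteq> 0"
  shows "v = \<kappa> * hypergeometric_3F2 a b c 1 1 1"
proof -
  have "(\<lambda>n. \<kappa> * (pochhammer a n * pochhammer b n * pochhammer c n / fact n ^ 3) / \<kappa>) sums (v / \<kappa>)"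
    using assms(1) by (rule sums_divide)
  hence "(\<lambda>n. pochhammer a n * pochhammer b n * pochhammer c n / fact n ^ 3) sums (v / \<kappa>)"
    using assms(2) by simp
  hence "hypergeometric_3F2 a b c 1 1 1 = v / \<kappa>"
    unfolding hypergeometric_3F2_eq_suminf by (rule sums_unique [symmetric])
  thus ?thesis using assms(2) by simp
qed

lemma thZ_rapid': "\<exists>C. \<forall>t. 0 < t \<longrightarrow> t \<le> 1 \<longrightarrow> thZ (exp (- t)) \<le> C * t ^ n"
proof -
  from thZ_rapid[of n] obtain C where
    C: "\<forall>t. 0 < t \<longrightarrow> t \<le> 3 \<longrightarrow> thZ (exp (- t)) \<le> C * t ^ n" by (elim exE)
  show ?thesis by (rule exI[of _ C]) (use C in simp)
qed

lemma thZ_cube_pos: "0 < q \<Longrightarrow> q < 1 \<Longrightarrow> 0 < thZ (q ^ 3)"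
  by (intro thZ_pos) (auto simp: power_less_one_iff)

lemma expU_aux:
  assumes "0 < t"
  shows "expU t > 0" "1 - expU t > 0" "1 - expU t ^ 3 > 0" "1 + expU t + expU t ^ 2 > 0"
  using expU_bounds[OF assms] by (auto simp: power_less_one_iff intro: add_pos_pos)

section \<open>Evaluation of the five integrals\<close>

lemma integral_XYZ:
  assumes "(\<lambda>t. 1/3 * (thY (exp (- t)) * thX (exp (- t)) * thZ (exp (- t)))) absolutely_integrable_on {0<..}"
  shows "integral {0<..} (\<lambda>t. 1/3 * (thY (exp (- t)) * thX (exp (- t)) * thZ (exp (- t)))) =
           Gamma (1/3) ^ 6 / (8 * sqrt 3 * pi ^ 3)" (is "?I = _")
proof -
  have "(\<lambda>n. 1/9 * cubic_coeff n * Beta (1/3 + real n) (1/3)) sums ?I"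
  proof (rule cubic_integral_series[OF assms])
    fix t :: real assume t: "0 < t"
    show "1/3 * (thY (exp (- t)) * thX (exp (- t)) * thZ (exp (- t))) =
        3 * (1/9) * thX (exp (- t)) ^ 3 * expU t powr (3 * (1/3)) * (1 - expU t ^ 3) powr (1/3)"
      using expU_aux[OF t] t by (simp add: thY_exp thZ_exp power3_eq_cube)
  qed auto
  \<comment> \<open>Here the beta parameters 1/3 and 1/3 are not complementary: the moment
    contributes 1 / (2/3)_n, which cancels against \<open>cubic_coeff n\<close> and leaves the
    square of (1/3)_n / n!.\<close>
  also have "(\<lambda>n. 1/9 * cubic_coeff n * Beta (1/3 + real n) (1/3)) =
             (\<lambda>n. 1/9 * Beta (1/3) (1/3) * (pochhammer (1/3) n / fact n) ^ 2)"
  proof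
    fix n
    have ni: "(1/3::real) \<notin> \<int>\<^sub>\<le>\<^sub>0" "(2/3::real) \<notin> \<int>\<^sub>\<le>\<^sub>0" by (auto elim!: nonpos_Ints_cases)
    have G: "Gamma (1/3::real) > 0" "Gamma (2/3::real) > 0" by (auto intro: Gamma_real_pos)
    have Gnz: "Gamma (1/3::real) \<noteq> 0" "Gamma (2/3::real) \<noteq> 0" using G by (metis less_irrefl)+
    have g1: "Gamma (1/3 + real n) = pochhammer (1/3) n * Gamma (1/3)"
      using pochhammer_Gamma[OF ni(1), of n] by (simp add: Gnz)
    have g2: "Gamma (1/3 + real n + 1/3) = pochhammer (2/3) n * Gamma (2/3)"
      using pochhammer_Gamma[OF ni(2), of n] by (simp add: Gnz add_ac)
    have p: "pochhammer (2/3) n \<noteq> (0::real)" using pochhammer_pos[of "2/3::real" n] by auto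
    show "1/9 * cubic_coeff n * Beta (1/3 + real n) (1/3) =
          1/9 * Beta (1/3) (1/3) * (pochhammer (1/3) n / fact n) ^ 2"
      unfolding Beta_def g1 g2 cubic_coeff_def using p by (simp add: power2_eq_square mult_ac)
  qed
  finally have "?I = 1/9 * Beta (1/3) (1/3) * (Gamma (1/3) / Gamma (2/3) ^ 2)"
    using sums_mult[OF sums_square_binomial_third, of "1/9 * Beta (1/3) (1/3)"] sums_unique2 by blast
  also have "\<dots> = Gamma (1/3) ^ 3 / (9 * Gamma (2/3) ^ 3)"
    by (simp add: Beta_def power2_eq_square power3_eq_cube)
  also have "Gamma (2/3 :: real) = 2 * pi / sqrt 3 / Gamma (1/3)"
  proof -
    have "Gamma (1/3::real) > 0" by (auto intro: Gamma_real_pos)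
    hence "Gamma (1/3::real) \<noteq> 0" by (metis less_irrefl)
    thus ?thesis unfolding Gamma_third_product [symmetric] by simp
  qed
  also have "Gamma (1/3) ^ 3 / (9 * (2 * pi / sqrt 3 / Gamma (1/3)) ^ 3) =
      Gamma (1/3) ^ 6 * (sqrt 3 ^ 3) / (9 * 8 * pi ^ 3)"
    by (simp add: power_divide power_mult_distrib flip: power_add)
  also have "sqrt 3 ^ 3 = 9 / sqrt 3"
  proof -
    have "sqrt 3 ^ 3 * sqrt 3 = (sqrt 3 ^ 2) ^ 2" by (simp only: power2_eq_square power3_eq_cube mult_ac)
    hence "sqrt 3 ^ 3 * sqrt 3 = 9" by simp
    thus ?thesis by (simp add: field_simps)
  qed
  also have "Gamma (1/3) ^ 6 * (9 / sqrt 3) / (9 * 8 * pi ^ 3) = Gamma (1/3) ^ 6 / (8 * sqrt 3 * pi ^ 3)"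
    by simp
  finally show ?thesis .
qed

lemma integral_YZZ:
  assumes "(\<lambda>t. 1/3 * (thY (exp (- t)) * thZ (exp (- t)) * thZ (exp (- t)))) absolutely_integrable_on {0<..}"
  shows "integral {0<..} (\<lambda>t. 1/3 * (thY (exp (- t)) * thZ (exp (- t)) * thZ (exp (- t)))) =
           2 * pi / (9 * sqrt 3) * hypergeometric_3F2 (1/3) (1/3) (2/3) 1 1 1" (is "?I = _")
proof -
  have "(\<lambda>n. 1/9 * cubic_coeff n * Beta (1/3 + real n) (2/3)) sums ?I"
  proof (rule cubic_integral_series[OF assms])
    fix t :: real assume t: "0 < t"
    show "1/3 * (thY (exp (- t)) * thZ (exp (- t)) * thZ (exp (- t))) =
        3 * (1/9) * thX (exp (- t)) ^ 3 * expU t powr (3 * (1/3)) * (1 - expU t ^ 3) powr (2/3)"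
      using expU_aux[OF t] powr_third_power(1)[of "1 - expU t ^ 3", symmetric] t
      by (simp add: thY_exp thZ_exp power2_eq_square power3_eq_cube)
  qed auto
  also have "(\<lambda>n. 1/9 * cubic_coeff n * Beta (1/3 + real n) (2/3)) =
     (\<lambda>n. 2 * pi / (9 * sqrt 3) * (pochhammer (1/3) n * pochhammer (1/3) n * pochhammer (2/3) n / fact n ^ 3))"
    using Beta_shift_complement[of "1/3"] Gamma_third_product
    by (simp add: fun_eq_iff cubic_coeff_def power2_eq_square power3_eq_cube mult_ac)
  finally show ?thesis by (rule hypergeometric_value) simp
qed

lemma integral_YYZ:
  assumes "(\<lambda>t. 1/9 * (thY (exp (- t)) * thY (exp (- t)) * thZ (exp (- t)))) absolutely_integrable_on {0<..}"
  shows "integral {0<..} (\<lambda>t. 1/9 * (thY (exp (- t)) * thY (exp (- t)) * thZ (exp (- t)))) =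
           2 * pi / (27 * sqrt 3) * hypergeometric_3F2 (1/3) (2/3) (2/3) 1 1 1" (is "?I = _")
proof -
  have "(\<lambda>n. 1/27 * cubic_coeff n * Beta (2/3 + real n) (1/3)) sums ?I"
  proof (rule cubic_integral_series[OF assms])
    fix t :: real assume t: "0 < t"
    show "1/9 * (thY (exp (- t)) * thY (exp (- t)) * thZ (exp (- t))) =
        3 * (1/27) * thX (exp (- t)) ^ 3 * expU t powr (3 * (2/3)) * (1 - expU t ^ 3) powr (1/3)"
      using expU_aux[OF t] t
      by (simp add: thY_exp thZ_exp power2_eq_square power3_eq_cube)
  qed auto
  also have "(\<lambda>n. 1/27 * cubic_coeff n * Beta (2/3 + real n) (1/3)) =
     (\<lambda>n. 2 * pi / (27 * sqrt 3) * (pochhammer (1/3) n * pochhammer (2/3) n * pochhammer (2/3) n / fact n ^ 3))"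
    using Beta_shift_complement[of "2/3"] Gamma_third_product
    by (simp add: fun_eq_iff cubic_coeff_def power2_eq_square power3_eq_cube mult_ac)
  finally show ?thesis by (rule hypergeometric_value) simp
qed

text \<open>The powers of 9 come from the cube root in \<open>thY_exp_cube\<close>, and 2 pi / sqrt
  3 is Gamma (1/3) Gamma (2/3). The exponents are 2/3 - 2 - 1/2 = - 11/6 and 4/3 - 3 - 1/2 = -
  13/6.\<close>

lemma three_powr_constants:
  "9 powr (1/3) / 9 * (2 * pi / sqrt 3) = 2 * pi / 3 powr (11/6 :: real)"
  "9 powr (2/3) / 27 * (2 * pi / sqrt 3) = 2 * pi / 3 powr (13/6 :: real)"
proof -
  have nine: "(9::real) powr c = 3 powr (2 * c)" for c
  proof -
    have "(9::real) = 3 powr 2" by simp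
    thus ?thesis by (simp only: powr_powr)
  qed
  have s: "sqrt 3 = 3 powr (1/2 :: real)" by (simp add: powr_half_sqrt)
  have "9 powr (1/3) / 9 * (2 * pi / sqrt 3) = 2 * pi * ((3::real) powr (2/3) / 3 powr 2 / 3 powr (1/2))"
    using nine[of "1/3"] s by simp
  also have "(3::real) powr (2/3) / 3 powr 2 / 3 powr (1/2) = 3 powr (2/3 - 2 - 1/2)" by (simp only: powr_diff)
  also have "\<dots> = 3 powr (- (11/6))" by simp
  finally show "9 powr (1/3) / 9 * (2 * pi / sqrt 3) = 2 * pi / 3 powr (11/6 :: real)"
    by (simp only: powr_minus_divide) simp
  have "9 powr (2/3) / 27 * (2 * pi / sqrt 3) = 2 * pi * ((3::real) powr (4/3) / 3 powr 3 / 3 powr (1/2))"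
    using nine[of "2/3"] s by simp
  also have "(3::real) powr (4/3) / 3 powr 3 / 3 powr (1/2) = 3 powr (4/3 - 3 - 1/2)" by (simp only: powr_diff)
  also have "\<dots> = 3 powr (- (13/6))" by simp
  finally show "9 powr (2/3) / 27 * (2 * pi / sqrt 3) = 2 * pi / 3 powr (13/6 :: real)"
    by (simp only: powr_minus_divide) simp
qed

lemma integral_YZZ_cube:
  assumes "(\<lambda>t. 1/3 * (thY (exp (- t)) * thZ (exp (- t) ^ 3) * thZ (exp (- t) ^ 3))) absolutely_integrable_on {0<..}"
  shows "integral {0<..} (\<lambda>t. 1/3 * (thY (exp (- t)) * thZ (exp (- t) ^ 3) * thZ (exp (- t) ^ 3))) =
           2 * pi / 3 powr (11/6) * hypergeometric_3F2 (1/9) (4/9) (7/9) 1 1 1" (is "?I = _")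
proof -
  have "(\<lambda>n. 9 powr (1/3) / 9 * cubic_coeff n * Beta (1/3 + real (3 * n)) (2/3)) sums ?I"
  proof (rule cubic_integral_series'[OF assms])
    fix t :: real assume t: "0 < t"
    define v x where "v = expU (3 * t)" and "x = thX (exp (- (3 * t)))"
    have v: "0 < v" "0 < 1 - v" "0 < 1 + v + v ^ 2"
      using expU_aux[of "3 * t"] t by (simp_all add: v_def)
    \<comment> \<open>One cube root of 1 + v + v^2 comes from Y and one from each Z; their product
      is the first power required by \<open>cubic_integral_series'\<close>.\<close>
    have E: "1/3 * (thY (exp (- t)) * thZ (exp (- t) ^ 3) * thZ (exp (- t) ^ 3)) =
        3 * (9 powr (1/3) / 9) * x ^ 3 * v powr (1/3) * ((1 + v + v ^ 2) powr (1/3)) ^ 3 * ((1 - v) powr (1/3)) ^ 2"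
      unfolding thY_exp_cube[OF t] thZ_exp_cube[OF t] v_def [symmetric] x_def [symmetric]
      by (simp add: power2_eq_square[of "(1 - v) powr (1/3)"] power3_eq_cube)
    show "1/3 * (thY (exp (- t)) * thZ (exp (- t) ^ 3) * thZ (exp (- t) ^ 3)) =
        3 * (9 powr (1/3) / 9) * thX (exp (- (3 * t))) ^ 3 * expU (3 * t) powr (1/3) *
          (1 + expU (3 * t) + expU (3 * t) ^ 2) * (1 - expU (3 * t)) powr (2/3)"
      unfolding E v_def [symmetric] x_def [symmetric]
      by (simp only: powr_third_power(1)[OF less_imp_le[OF v(2)]] powr_third_power(2)[OF less_imp_le[OF v(3)]])
  qed auto
  also have "(\<lambda>n. 9 powr (1/3) / 9 * cubic_coeff n * Beta (1/3 + real (3 * n)) (2/3)) =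
     (\<lambda>n. 2 * pi / 3 powr (11/6) * (pochhammer (1/9) n * pochhammer (4/9) n * pochhammer (7/9) n / fact n ^ 3))"
  proof
    fix n
    have E: "9 powr (1/3) / 9 * cubic_coeff n * Beta (1/3 + real (3 * n)) (2/3) =
        9 powr (1/3) / 9 * (2 * pi / sqrt 3) * (cubic_coeff n * (pochhammer (1/3) (3 * n) / fact (3 * n)))"
      using Beta_shift_complement[of "1/3" "3 * n"] Gamma_third_product by (simp add: mult_ac)
    show "9 powr (1/3) / 9 * cubic_coeff n * Beta (1/3 + real (3 * n)) (2/3) =
        2 * pi / 3 powr (11/6) * (pochhammer (1/9) n * pochhammer (4/9) n * pochhammer (7/9) n / fact n ^ 3)"
      unfolding E three_powr_constants cubic_coeff_pochhammer_triple by (simp add: mult_ac)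
  qed
  finally show ?thesis by (rule hypergeometric_value) simp
qed

lemma integral_YYZ_cube:
  assumes "(\<lambda>t. 1/9 * (thY (exp (- t)) * thY (exp (- t)) * thZ (exp (- t) ^ 3))) absolutely_integrable_on {0<..}"
  shows "integral {0<..} (\<lambda>t. 1/9 * (thY (exp (- t)) * thY (exp (- t)) * thZ (exp (- t) ^ 3))) =
           2 * pi / 3 powr (13/6) * hypergeometric_3F2 (2/9) (5/9) (8/9) 1 1 1" (is "?I = _")
proof -
  have "(\<lambda>n. 9 powr (2/3) / 27 * cubic_coeff n * Beta (2/3 + real (3 * n)) (1/3)) sums ?I"
  proof (rule cubic_integral_series'[OF assms])
    fix t :: real assume t: "0 < t"
    define v x where "v = expU (3 * t)" and "x = thX (exp (- (3 * t)))"
    have v: "0 < v" "0 < 1 - v" "0 < 1 + v + v ^ 2"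
      using expU_aux[of "3 * t"] t by (simp_all add: v_def)
    \<comment> \<open>Now two of the cube roots of 1 + v + v^2 come from the factors Y and one from
      Z, while v and 9 acquire the exponent 2/3.\<close>
    have E: "1/9 * (thY (exp (- t)) * thY (exp (- t)) * thZ (exp (- t) ^ 3)) =
        3 * ((9 powr (1/3)) ^ 2 / 27) * x ^ 3 * (v powr (1/3)) ^ 2 * ((1 + v + v ^ 2) powr (1/3)) ^ 3 * (1 - v) powr (1/3)"
      unfolding thY_exp_cube[OF t] thZ_exp_cube[OF t] v_def [symmetric] x_def [symmetric]
      by (simp add: power2_eq_square[of "v powr (1/3)"] power2_eq_square[of "9 powr (1/3)"] power3_eq_cube)
    have nine: "((9::real) powr (1/3)) ^ 2 = 9 powr (2/3)" by (rule powr_third_power) simp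
    show "1/9 * (thY (exp (- t)) * thY (exp (- t)) * thZ (exp (- t) ^ 3)) =
        3 * (9 powr (2/3) / 27) * thX (exp (- (3 * t))) ^ 3 * expU (3 * t) powr (2/3) *
          (1 + expU (3 * t) + expU (3 * t) ^ 2) * (1 - expU (3 * t)) powr (1/3)"
      unfolding E v_def [symmetric] x_def [symmetric]
      by (simp only: nine powr_third_power(1)[OF less_imp_le[OF v(1)]] powr_third_power(2)[OF less_imp_le[OF v(3)]])
  qed auto
  also have "(\<lambda>n. 9 powr (2/3) / 27 * cubic_coeff n * Beta (2/3 + real (3 * n)) (1/3)) =
     (\<lambda>n. 2 * pi / 3 powr (13/6) * (pochhammer (2/9) n * pochhammer (5/9) n * pochhammer (8/9) n / fact n ^ 3))"
  proof
    fix n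
    have E: "9 powr (2/3) / 27 * cubic_coeff n * Beta (2/3 + real (3 * n)) (1/3) =
        9 powr (2/3) / 27 * (2 * pi / sqrt 3) * (cubic_coeff n * (pochhammer (2/3) (3 * n) / fact (3 * n)))"
      using Beta_shift_complement[of "2/3" "3 * n"] Gamma_third_product by (simp add: mult_ac)
    show "9 powr (2/3) / 27 * cubic_coeff n * Beta (2/3 + real (3 * n)) (1/3) =
        2 * pi / 3 powr (13/6) * (pochhammer (2/9) n * pochhammer (5/9) n * pochhammer (8/9) n / fact n ^ 3)"
      unfolding E three_powr_constants cubic_coeff_pochhammer_triple by (simp add: mult_ac)
  qed
  finally show ?thesis by (rule hypergeometric_value) simp
qed

theorem theorem2:
  fixes \<omega> :: complex
  assumes "\<omega> ^ 3 = 1" and "\<forall>j\<in>{1..<3::nat}. \<omega> ^ j \<noteq> 1"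
  shows
    "has_L_value 3 (\<lambda>q. 1/3 * borwein_a (q ^ 3) * borwein_c (q ^ 3) * borwein_b \<omega> (q ^ 3)) 1
       (of_real (Gamma (1/3) ^ 6 / (8 * sqrt 3 * pi ^ 3)))
   \<and> has_L_value 3 (\<lambda>q. 1/3 * borwein_c (q ^ 3) * (borwein_b \<omega> (q ^ 3)) ^ 2) 1
       (of_real (2 * pi / (9 * sqrt 3) * hypergeometric_3F2 (1/3) (1/3) (2/3) 1 1 1))
   \<and> has_L_value 3 (\<lambda>q. 1/9 * (borwein_c (q ^ 3)) ^ 2 * borwein_b \<omega> (q ^ 3)) 1
       (of_real (2 * pi / (27 * sqrt 3) * hypergeometric_3F2 (1/3) (2/3) (2/3) 1 1 1))
   \<and> has_L_value 3 (\<lambda>q. 1/3 * borwein_c (q ^ 3) * (borwein_b \<omega> (q ^ 9)) ^ 2) 1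
       (of_real (2 * pi / 3 powr (11/6) * hypergeometric_3F2 (1/9) (4/9) (7/9) 1 1 1))
   \<and> has_L_value 3 (\<lambda>q. 1/9 * (borwein_c (q ^ 3)) ^ 2 * borwein_b \<omega> (q ^ 9)) 1
       (of_real (2 * pi / 3 powr (13/6) * hypergeometric_3F2 (2/9) (5/9) (8/9) 1 1 1))"
proof -
  have "\<omega> \<noteq> 1" using assms(2) by (auto dest: bspec[of _ _ 1])
  note b = borwein_b_cube[OF assms(1) this] borwein_b_ninth[OF assms(1) this]
  note thetas = borwein_a_cube borwein_c_cube b
  \<comment> \<open>For the forms with a squared c, the middle factor g of
    \<open>rapid_seriesI\<close> is \<open>thY\<close> itself.\<close>
  have gY: "\<exists>a. growth_series 1 thY a" using growth_series_thY by blast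
  show ?thesis
  proof (intro conjI)
    show "has_L_value 3 (\<lambda>q. 1/3 * borwein_a (q ^ 3) * borwein_c (q ^ 3) * borwein_b \<omega> (q ^ 3)) 1
       (of_real (Gamma (1/3) ^ 6 / (8 * sqrt 3 * pi ^ 3)))"
      by (rule rapid_L_value[OF rapid_seriesI[OF growth_series_thX growth_series_thZ, where \<kappa> = "1/3"] _ integral_XYZ])
         (use thX_bounds thZ_rapid' thZ_pos in \<open>auto simp: thetas\<close>)
    show "has_L_value 3 (\<lambda>q. 1/3 * borwein_c (q ^ 3) * (borwein_b \<omega> (q ^ 3)) ^ 2) 1
       (of_real (2 * pi / (9 * sqrt 3) * hypergeometric_3F2 (1/3) (1/3) (2/3) 1 1 1))"
      by (rule rapid_L_value[OF rapid_seriesI[OF growth_series_thZ growth_series_thZ, where \<kappa> = "1/3"] _ integral_YZZ])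
         (use thZ_bounds thZ_rapid' thZ_pos in \<open>auto simp: thetas power2_eq_square\<close>)
    show "has_L_value 3 (\<lambda>q. 1/9 * (borwein_c (q ^ 3)) ^ 2 * borwein_b \<omega> (q ^ 3)) 1
       (of_real (2 * pi / (27 * sqrt 3) * hypergeometric_3F2 (1/3) (2/3) (2/3) 1 1 1))"
      by (rule rapid_L_value[OF rapid_seriesI[OF gY growth_series_thZ, where \<kappa> = "1/9"] _ integral_YYZ])
         (use thY_bounds thZ_rapid' thZ_pos in \<open>auto simp: thetas power2_eq_square\<close>)
    show "has_L_value 3 (\<lambda>q. 1/3 * borwein_c (q ^ 3) * (borwein_b \<omega> (q ^ 9)) ^ 2) 1
       (of_real (2 * pi / 3 powr (11/6) * hypergeometric_3F2 (1/9) (4/9) (7/9) 1 1 1))"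
      by (rule rapid_L_value[OF rapid_seriesI[OF growth_series_thZ_cube growth_series_thZ_cube, where \<kappa> = "1/3"] _
            integral_YZZ_cube])
         (use thZ_cube_bounds thZ_cube_rapid thZ_cube_pos in \<open>auto simp: thetas power2_eq_square\<close>)
    show "has_L_value 3 (\<lambda>q. 1/9 * (borwein_c (q ^ 3)) ^ 2 * borwein_b \<omega> (q ^ 9)) 1
       (of_real (2 * pi / 3 powr (13/6) * hypergeometric_3F2 (2/9) (5/9) (8/9) 1 1 1))"
      by (rule rapid_L_value[OF rapid_seriesI[OF gY growth_series_thZ_cube, where \<kappa> = "1/9"] _ integral_YYZ_cube])
         (use thY_bounds thZ_cube_rapid thZ_cube_pos in \<open>auto simp: thetas power2_eq_square\<close>)
  qed
qed

end
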